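(* Let $\mathbb K=\mathbb C$, $M^-=M^+=\mathbb C^6$ and let $g$ be the usual dot product on $\mathbb C^6$. Then $\mathcal E=\mathcal E(\mathbb C^6,\mathbb C^6,\cdot)$ is a simple Lie algebra of type $\mathrm E_6$ and $$B_{\mathcal E}=\{h_i:1\le i\le6\}\cup\{\iota^+(E_{ij}):1\le i\ne j\le6\}\cup\{v_S^\sigma:\sigma=\pm,\ S\subseteq\{1,\dots,6\},\ |S|=3\}\cup\{v^\sigma_{\{1,\dots,6\}}:\sigma=\pm\}$$ is a Chevalley basis of $\mathcal E$.
   Context: Setting over a commutative ring $\mathbb K$ (here $\mathbb K=\mathbb C$), with $M^\pm$ free of rank $6$ and $g:M^-\times M^+\to\mathbb K$ a non-singular bilinear form; $\sigma=\pm$; $g(v^+,v^-)=g(v^-,v^+)$; $A^*$ is the adjoint relative to $g$. Exterior algebra notation. $\bigwedge(M^\sigma)=\bigoplus_k\bigwedge_k(M^\sigma)$ is the exterior algebra, product written $uv$. (1) For $v^{-\sigma}\in M^{-\sigma}$ let $\Delta_{v^{-\sigma}}$ be the unique anti-derivation of degree $-1$ of $\bigwedge(M^\sigma)$ (so $\Delta(xy)=\Delta(x)y+(-1)^kx\Delta(y)$ for $x\in\bigwedge_k$) with $\Delta_{v^{-\sigma}}(v^\sigma)=g(v^{-\sigma},v^\sigma)$. The map $v\mapsto\Delta_v$ extends to an associative algebra homomorphism $a\mapsto\Delta_a$ of $\bigwedge(M^{-\sigma})$ into $\mathrm{End}(\bigwedge(M^\sigma))$; write $a\cdot x=\Delta_a(x)$.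 (2) $\mathcal S=\{(A^-,A^+)\in\mathrm{End}(M^-)\oplus\mathrm{End}(M^+):g(A^-v^-,v^+)+g(v^-,A^+v^+)=0\}$, a Lie algebra; $\iota^+:\mathrm{End}(M^+)\to\mathcal S$, $\iota^+(A)=(-A^*,A)$. For $A=(A^-,A^+)\in\mathcal S$ and $x\in\bigwedge(M^\sigma)$, $A\circ x=D_{A^\sigma}(x)$, where $D_{A^\sigma}$ is the derivation of $\bigwedge(M^\sigma)$ extending $A^\sigma$. (3) For $x\in\bigwedge_k(M^\sigma)$, $a\in\bigwedge_k(M^{-\sigma})$, $k\ge1$: $E^\sigma(x,a)\in\mathrm{End}(M^\sigma)$, $E^\sigma(x,a)(v)=(v\cdot a)\cdot x$; and $E(x^-,x^+)=(E^-(x^-,x^+),-E^+(x^+,x^-))\in\mathcal S$. The Lie algebras. $\tilde{\mathcal S}=\mathcal S\oplus\mathbb Kh_0$ (direct sum of Lie algebras, $\mathbb Kh_0$ free of rank 1 with zero product); $h_0\circ p=\sigma kp$ for $p\in\bigwedge_{3k}(M^\sigma)$. $h_M=(-\mathrm{id}_{M^-},\mathrm{id}_{M^+})\in\mathcal S$. $\tilde{\mathcal E}=\bigoplus_{i=-2}^2\tilde{\mathcal E}_i$ with $\tilde{\mathcal E}_0=\tilde{\mathcal S}$, $\tilde{\mathcal E}_{\sigma k}=\bigwedge_{3k}(M^\sigma)$ for $k=1,2$, and with the skew-symmetric graded product extending that of $\tilde{\mathcal S}$ such that, for $A\in\tilde{\mathcal S}$ and $p_j,q_j\in\tilde{\mathcal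 E}_j$: $[A,p_i]=A\circ p_i$ ($i=\pm1,\pm2$); $[p_{-1},q_1]=E(p_{-1},q_1)+(p_{-1}\cdot q_1)h_0$; $[p_{-2},q_2]=-(p_{-2}\cdot q_2)(h_M-2h_0)$; $[p_i,q_i]=p_iq_i$ and $[p_i,q_{-2i}]=p_i\cdot q_{-2i}$ for $i=\pm1$. This is a $5$-graded Lie algebra. $\mathcal E=\bigoplus_i\mathcal E_i$ is the ideal with $\mathcal E_i=\tilde{\mathcal E}_i$ for $i\ne0$ and $\mathcal E_0=\{(A^-,A^+)+ah_0\in\tilde{\mathcal E}_0:\mathrm{tr}(A^+)+3a=0\}$. Basis notation. $\{v_1^\sigma,\dots,v_6^\sigma\}$ is the standard basis of $M^\sigma=\mathbb C^6$ (so $g(v_i^-,v_j^+)=\delta_{ij}$), $\mathrm{End}(M^\pm)$ is identified with $6\times6$ matrices, and $E_{ij}$ are the matrix units. For $S=\{i_1<\dots<i_\ell\}\subseteq\{1,\dots,6\}$: $v_S^-=v_{i_\ell}^-\cdots v_{i_1}^-$, $v_S^+=v_{i_1}^+\cdots v_{i_\ell}^+$. $h_i=\iota^+(E_{ii}-E_{i+1,i+1})$ for $1\le i\le5$ and $h_6=\iota^+(E_{44}+E_{55}+E_{66})-h_0$. *)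

theory Defs
  imports "HOL-Analysis.Analysis"
begin

section \<open>The exterior algebra of the coordinate space\<close>

text \<open>
  The exterior algebra of \<open>M = complex ^ 'n\<close> (\<open>'n\<close> linearly ordered) is realised on its standard
  basis: an element is the family of its coefficients with respect to the products
  \<open>v\<^sub>S = v\<^sub>i\<^sub>1 \<dots> v\<^sub>i\<^sub>l\<close>, where \<open>S = {i1 < \<dots> < il}\<close>.  The lemmas \<open>wedge_assoc\<close>, \<open>wedge_one_left\<close>,
  \<open>wedge_one_right\<close>, \<open>wedge_gen_self\<close> and \<open>ext_basis_eq_prod\<close> below show that this is an associative
  unital algebra, generated by \<open>M\<close>, in which the squares of the elements of \<open>M\<close> vanish, and that
  the ordered monomials form a basis.
\<close>

type_synonym 'n ext = "complex ^ ('n set)"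

definition ext_sign :: "'n::{finite,linorder} set \<Rightarrow> 'n set \<Rightarrow> complex" where
  "ext_sign S T = (-1) ^ card {(s, t). s \<in> S \<and> t \<in> T \<and> t < s}"

definition wedge :: "'n::{finite,linorder} ext \<Rightarrow> 'n ext \<Rightarrow> 'n ext" (infixl "\<and>\<^sub>e" 70) where
  "x \<and>\<^sub>e y = (\<chi> U. \<Sum>S\<in>Pow U. ext_sign S (U - S) * (x $ S) * (y $ (U - S)))"

definition ext_one :: "'n::finite ext" where
  "ext_one = axis {} 1"

text \<open>The embedding of \<open>M\<close> into its exterior algebra, and its left inverse.\<close>

definition gen :: "complex ^ 'n \<Rightarrow> 'n::finite ext" where
  "gen v = (\<Sum>i\<in>UNIV. (v $ i) *s axis {i} 1)"

definition vec_part :: "'n::finite ext \<Rightarrow> complex ^ 'n" where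
  "vec_part x = (\<chi> i. x $ {i})"

definition scalar_part :: "'n::finite ext \<Rightarrow> complex" where
  "scalar_part x = x $ {}"

definition ext_deg :: "nat \<Rightarrow> 'n::finite ext set" where
  "ext_deg k = {x. \<forall>S. x $ S \<noteq> 0 \<longrightarrow> card S = k}"

abbreviation clinear :: "(complex ^ 'a \<Rightarrow> complex ^ 'b) \<Rightarrow> bool" where
  "clinear \<equiv> Vector_Spaces.linear (*s) (*s)"

text \<open>The bilinear form \<open>g\<close>, i.e. the (complex bilinear) dot product.\<close>

definition dot :: "complex ^ 'n \<Rightarrow> complex ^ 'n \<Rightarrow> complex" where
  "dot v w = (\<Sum>i\<in>UNIV. (v $ i) * (w $ i))"

definition antiderivation :: "('n::{finite,linorder} ext \<Rightarrow> 'n ext) \<Rightarrow> bool" where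
  "antiderivation f \<longleftrightarrow> clinear f \<and>
     f ` ext_deg 0 \<subseteq> {0} \<and> (\<forall>k. f ` ext_deg (Suc k) \<subseteq> ext_deg k) \<and>
     (\<forall>k. \<forall>x \<in> ext_deg k. \<forall>y. f (x \<and>\<^sub>e y) = f x \<and>\<^sub>e y + (-1) ^ k *s (x \<and>\<^sub>e f y))"

definition derivation :: "('n::{finite,linorder} ext \<Rightarrow> 'n ext) \<Rightarrow> bool" where
  "derivation f \<longleftrightarrow> clinear f \<and> (\<forall>x y. f (x \<and>\<^sub>e y) = f x \<and>\<^sub>e y + x \<and>\<^sub>e f y)"

text \<open>
  \<open>Delta1\<close>, \<open>Delta\<close>, \<open>Der\<close> and \<open>adj\<close> are well defined by the lemmas \<open>Delta1_ex1\<close>, \<open>Delta_ex1\<close>,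
  \<open>Der_ex1\<close> and \<open>adj_ex1\<close>.  Since \<open>M\<^sup>-\<close> and \<open>M\<^sup>+\<close> are both the coordinate space and \<open>dot\<close> is symmetric,
  the same functions serve for both signs.
\<close>

definition is_contraction :: "complex ^ ('n::{finite,linorder}) \<Rightarrow> ('n ext \<Rightarrow> 'n ext) \<Rightarrow> bool" where
  "is_contraction v f \<longleftrightarrow> antiderivation f \<and> (\<forall>w. f (gen w) = dot v w *s ext_one)"

definition Delta1 :: "complex ^ ('n::{finite,linorder}) \<Rightarrow> 'n ext \<Rightarrow> 'n ext" where
  "Delta1 v = (THE f. is_contraction v f)"

definition extends_Delta1 :: "('n::{finite,linorder} ext \<Rightarrow> 'n ext \<Rightarrow> 'n ext) \<Rightarrow> bool" where
  "extends_Delta1 F \<longleftrightarrow>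
     (\<forall>a. clinear (F a)) \<and> (\<forall>x. clinear (\<lambda>a. F a x)) \<and>
     F ext_one = id \<and> (\<forall>a b. F (a \<and>\<^sub>e b) = F a \<circ> F b) \<and> (\<forall>v. F (gen v) = Delta1 v)"

text \<open>\<open>Delta a x\<close> is written \<open>a \<cdot> x\<close> in mathematical notation.\<close>

definition Delta :: "'n::{finite,linorder} ext \<Rightarrow> 'n ext \<Rightarrow> 'n ext" where
  "Delta = (THE F. extends_Delta1 F)"

definition Der :: "complex ^ ('n::{finite,linorder}) ^ ('n::{finite,linorder}) \<Rightarrow> 'n ext \<Rightarrow> 'n ext" where
  "Der A = (THE f. derivation f \<and> (\<forall>v. f (gen v) = gen (A *v v)))"

definition adj :: "complex ^ 'n ^ 'n \<Rightarrow> complex ^ 'n ^ 'n" where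
  "adj A = (THE B. \<forall>v w. dot (B *v v) w = dot v (A *v w))"

subsection \<open>The definitions make sense\<close>

lemma clinearI:
  assumes "\<And>x y. f (x + y) = f x + f y" "\<And>c x. f (c *s x) = c *s f x"
  shows "clinear (f :: complex ^ 'a \<Rightarrow> complex ^ 'b)"
  using assms by unfold_locales auto

lemma clinear_add: "clinear f \<Longrightarrow> f (x + y) = f x + f y"
  and clinear_scale: "clinear f \<Longrightarrow> f (c *s x) = c *s f x"
  by (simp_all add: Vector_Spaces.linear_iff)

lemma clinear_0: "clinear f \<Longrightarrow> f 0 = 0"
  using clinear_scale[of f 0 0] by simp

lemma clinear_sum: "clinear f \<Longrightarrow> f (sum h A) = (\<Sum>a\<in>A. f (h a))"
  by (induction A rule: infinite_finite_induct) (simp_all add: clinear_0 clinear_add)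

lemma clinear_comp: "clinear f \<Longrightarrow> clinear h \<Longrightarrow> clinear (\<lambda>x. f (h x))"
  by (rule clinearI) (simp_all add: clinear_add clinear_scale)

lemma clinear_plus: "clinear f \<Longrightarrow> clinear h \<Longrightarrow> clinear (\<lambda>x. f x + h x)"
  by (rule clinearI) (simp_all add: clinear_add clinear_scale vec.scale_right_distrib)

lemma clinear_scl: "clinear f \<Longrightarrow> clinear (\<lambda>x. c *s f x)"
  by (rule clinearI) (simp_all add: clinear_add clinear_scale vec.scale_right_distrib mult.commute)

lemma clinear_id: "clinear (\<lambda>x. x)"
  by (rule clinearI) simp_all

lemma ext_expand: "(x :: complex ^ 'a) = (\<Sum>S\<in>UNIV. (x $ S) *s axis S 1)"
proof -
  have "(\<Sum>S\<in>UNIV. (x $ S) *s axis S 1) $ T = (\<Sum>S\<in>UNIV. if S = T then x $ S else 0)" for T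
    unfolding sum_component by (intro sum.cong) (auto simp: axis_def)
  thus ?thesis by (simp add: vec_eq_iff)
qed

lemma clinear_ext:
  assumes "clinear f" "clinear h" "\<And>S. f (axis S 1) = h (axis S 1)"
  shows "f x = h x"
proof -
  have "f x = (\<Sum>S\<in>UNIV. (x $ S) *s f (axis S 1))"
    by (subst ext_expand[of x]) (simp add: clinear_sum[OF assms(1)] clinear_scale[OF assms(1)])
  also have "\<dots> = h x"
    by (subst (2) ext_expand[of x])
      (simp add: clinear_sum[OF assms(2)] clinear_scale[OF assms(2)] assms(3))
  finally show ?thesis .
qed

lemma clinear_wedge_left: "clinear (\<lambda>x. x \<and>\<^sub>e y)"
  and clinear_wedge_right: "clinear (\<lambda>y. x \<and>\<^sub>e y)"
  by (rule clinearI; simp add: wedge_def vec_eq_iff algebra_simps sum.distrib sum_distrib_left)+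

lemmas wedge_simps =
  clinear_add[OF clinear_wedge_left] clinear_scale[OF clinear_wedge_left]
  clinear_add[OF clinear_wedge_right] clinear_scale[OF clinear_wedge_right]
  clinear_0[OF clinear_wedge_left] clinear_0[OF clinear_wedge_right]

lemma wedge_axis:
  "axis S 1 \<and>\<^sub>e axis T 1 = (if S \<inter> T = {} then ext_sign S T *s axis (S \<union> T) 1 else 0)"
proof -
  have "(axis S 1 \<and>\<^sub>e axis T 1) $ U = (if S \<inter> T = {} then ext_sign S T *s axis (S \<union> T) 1 else 0) $ U"
    for U
  proof -
    have "(axis S 1 \<and>\<^sub>e axis T 1) $ U
        = (\<Sum>P\<in>Pow U. if P = S then (if U - S = T then ext_sign S T else 0) else 0)"
      unfolding wedge_def vec_lambda_beta by (intro sum.cong) (auto simp: axis_def)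
    also have "\<dots> = (if S \<subseteq> U then (if U - S = T then ext_sign S T else 0) else 0)"
      by (simp add: sum.delta')
    also have "\<dots> = (if S \<inter> T = {} then ext_sign S T *s axis (S \<union> T) 1 else 0) $ U"
      by (auto simp: axis_def)
    finally show ?thesis .
  qed
  thus ?thesis by (simp add: vec_eq_iff)
qed

lemma ext_sign_Un_left:
  assumes "A \<inter> B = {}"
  shows "ext_sign (A \<union> B) T = ext_sign A T * ext_sign B T"
proof -
  have "{(s, t). s \<in> A \<union> B \<and> t \<in> T \<and> t < s}
      = {(s, t). s \<in> A \<and> t \<in> T \<and> t < s} \<union> {(s, t). s \<in> B \<and> t \<in> T \<and> t < s}" by auto
  moreover have "{(s, t). s \<in> A \<and> t \<in> T \<and> t < s} \<inter> {(s, t). s \<in> B \<and> t \<in> T \<and> t < s} = {}"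
    using assms by auto
  ultimately show ?thesis
    by (simp add: ext_sign_def card_Un_disjoint power_add)
qed

lemma ext_sign_Un_right:
  assumes "A \<inter> B = {}"
  shows "ext_sign T (A \<union> B) = ext_sign T A * ext_sign T B"
proof -
  have "{(s, t). s \<in> T \<and> t \<in> A \<union> B \<and> t < s}
      = {(s, t). s \<in> T \<and> t \<in> A \<and> t < s} \<union> {(s, t). s \<in> T \<and> t \<in> B \<and> t < s}" by auto
  moreover have "{(s, t). s \<in> T \<and> t \<in> A \<and> t < s} \<inter> {(s, t). s \<in> T \<and> t \<in> B \<and> t < s} = {}"
    using assms by auto
  ultimately show ?thesis
    by (simp add: ext_sign_def card_Un_disjoint power_add)
qed

lemma ext_sign_swap:
  assumes "A \<inter> B = {}"
  shows "ext_sign A B * ext_sign B A = (-1) ^ (card A * card B)"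
proof -
  have "card {(s, t). s \<in> B \<and> t \<in> A \<and> t < s} = card {(s, t). s \<in> A \<and> t \<in> B \<and> s < t}"
    by (rule bij_betw_same_card[of "\<lambda>(s, t). (t, s)"]) (auto simp: bij_betw_def inj_on_def image_iff)
  moreover have "card {(s, t). s \<in> A \<and> t \<in> B \<and> t < s} + card {(s, t). s \<in> A \<and> t \<in> B \<and> s < t}
      = card ({(s, t). s \<in> A \<and> t \<in> B \<and> t < s} \<union> {(s, t). s \<in> A \<and> t \<in> B \<and> s < t})"
    by (rule card_Un_disjoint[symmetric]) auto
  moreover have "{(s, t). s \<in> A \<and> t \<in> B \<and> t < s} \<union> {(s, t). s \<in> A \<and> t \<in> B \<and> s < t} = A \<times> B"
    using assms by (auto simp: not_less_iff_gr_or_eq)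
  ultimately show ?thesis
    by (simp add: ext_sign_def card_cartesian_product flip: power_add)
qed

lemma ext_sign_empty [simp]: "ext_sign {} T = 1" "ext_sign S {} = 1"
  by (simp_all add: ext_sign_def)

lemma ext_sign_sq [simp]: "ext_sign S T * ext_sign S T = 1"
  by (simp add: ext_sign_def flip: power_add power_mult_distrib)

lemma wedge_assoc: "(x \<and>\<^sub>e y) \<and>\<^sub>e z = x \<and>\<^sub>e (y \<and>\<^sub>e z)"
proof -
  have 1: "(axis S 1 \<and>\<^sub>e axis T 1) \<and>\<^sub>e axis U 1 = axis S 1 \<and>\<^sub>e (axis T 1 \<and>\<^sub>e axis U (1::complex))"
    for S T U :: "'a set"
    by (auto simp: wedge_axis wedge_simps Int_Un_distrib Int_Un_distrib2 Un_assoc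
          ext_sign_Un_left ext_sign_Un_right)
  have 2: "(axis S 1 \<and>\<^sub>e axis T 1) \<and>\<^sub>e z = axis S 1 \<and>\<^sub>e (axis T 1 \<and>\<^sub>e z)" for S T and z :: "'a ext"
    by (rule clinear_ext[where f = "\<lambda>z. (axis S 1 \<and>\<^sub>e axis T 1) \<and>\<^sub>e z"])
      (intro clinear_wedge_right clinear_comp[OF clinear_wedge_right] | simp add: 1)+
  have 3: "(axis S 1 \<and>\<^sub>e y) \<and>\<^sub>e z = axis S 1 \<and>\<^sub>e (y \<and>\<^sub>e z)" for S and y z :: "'a ext"
    by (rule clinear_ext[where f = "\<lambda>y. (axis S 1 \<and>\<^sub>e y) \<and>\<^sub>e z"])
      (intro clinear_comp[OF clinear_wedge_left clinear_wedge_right]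
         clinear_comp[OF clinear_wedge_right clinear_wedge_left] | simp add: 2)+
  show ?thesis
    by (rule clinear_ext[where f = "\<lambda>x. (x \<and>\<^sub>e y) \<and>\<^sub>e z"])
      (intro clinear_wedge_left clinear_comp[OF clinear_wedge_left clinear_wedge_left] | simp add: 3)+
qed

lemma wedge_one_left: "ext_one \<and>\<^sub>e x = x"
  by (rule clinear_ext[OF clinear_wedge_right clinear_id]) (simp add: ext_one_def wedge_axis)

lemma wedge_one_right: "x \<and>\<^sub>e ext_one = x"
  by (rule clinear_ext[OF clinear_wedge_left clinear_id]) (simp add: ext_one_def wedge_axis)

lemma gen_nth: "gen v $ S = (\<Sum>i\<in>UNIV. if S = {i} then v $ i else 0)"
  by (simp add: gen_def axis_def if_distrib eq_commute cong: if_cong)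

lemma clinear_gen: "clinear gen"
  by (rule clinearI) (auto simp: vec_eq_iff gen_nth sum_distrib_left algebra_simps
        simp flip: sum.distrib intro!: sum.cong)

lemma vec_part_gen: "vec_part (gen v) = v"
  by (simp add: vec_part_def gen_nth vec_eq_iff)

lemma gen_axis: "gen (axis i 1) = axis {i} 1"
proof -
  have "gen (axis i 1) $ S = (\<Sum>j\<in>UNIV. if j = i then (if S = {i} then 1 else 0) else 0)" for S
    unfolding gen_nth by (intro sum.cong) (auto simp: axis_def)
  thus ?thesis by (auto simp: vec_eq_iff axis_def)
qed

lemma wedge_gen_swap: "gen v \<and>\<^sub>e gen w = (-1) *s (gen w \<and>\<^sub>e gen v)"
proof -
  have 1: "gen (axis i 1) \<and>\<^sub>e gen (axis j 1) = (-1) *s (gen (axis j 1) \<and>\<^sub>e gen (axis i 1))" for i j :: 'a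
  proof (cases "i = j")
    case True
    thus ?thesis by (simp add: gen_axis wedge_axis)
  next
    case False
    hence "ext_sign {i} {j} * ext_sign {j} {i} = -1"
      using ext_sign_swap[of "{i}" "{j}"] by simp
    hence "ext_sign {i} {j} * (ext_sign {j} {i} * ext_sign {j} {i}) = - ext_sign {j} {i}"
      by (simp only: mult.assoc[symmetric]) simp
    hence "ext_sign {i} {j} = - ext_sign {j} {i}" by simp
    thus ?thesis using False by (simp add: gen_axis wedge_axis insert_commute)
  qed
  have 2: "gen (axis i 1) \<and>\<^sub>e gen w = (-1) *s (gen w \<and>\<^sub>e gen (axis i 1))" for i :: 'a and w
    by (rule clinear_ext[OF clinear_comp[OF clinear_wedge_right clinear_gen]
          clinear_scl[OF clinear_comp[OF clinear_wedge_left clinear_gen]]]) (rule 1)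
  show ?thesis
    by (rule clinear_ext[OF clinear_comp[OF clinear_wedge_left clinear_gen]
          clinear_scl[OF clinear_comp[OF clinear_wedge_right clinear_gen]]]) (rule 2)
qed

lemma wedge_gen_self: "gen v \<and>\<^sub>e gen v = 0"
  using wedge_gen_swap[of v v] by (simp add: vec_eq_iff)

lemma ext_basis_eq_prod:
  "axis S 1 = foldr (\<lambda>i x. gen (axis i 1) \<and>\<^sub>e x) (sorted_list_of_set S) ext_one"
proof -
  have "axis (set l) 1 = foldr (\<lambda>i x. gen (axis i 1) \<and>\<^sub>e x) l ext_one"
    if "sorted l" "distinct l" for l :: "'a list"
    using that
  proof (induction l)
    case (Cons i l)
    have "{(s, t). s \<in> {i} \<and> t \<in> set l \<and> t < s} = {}" using Cons.prems by auto
    hence "ext_sign {i} (set l) = 1" by (simp only: ext_sign_def) simp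
    with Cons.prems have "axis (set (i # l)) 1 = gen (axis i 1) \<and>\<^sub>e axis (set l) 1"
      by (simp add: gen_axis wedge_axis)
    with Cons show ?case by simp
  qed (simp add: ext_one_def)
  from this[of "sorted_list_of_set S"] show ?thesis by simp
qed

lemma clinear_ext_gen:
  assumes "clinear f" "clinear h" "f ext_one = h ext_one"
    and step: "\<And>i y. f y = h y \<Longrightarrow> f (gen (axis i 1) \<and>\<^sub>e y) = h (gen (axis i 1) \<and>\<^sub>e y)"
  shows "f x = h x"
proof (rule clinear_ext[OF assms(1,2)])
  have "f (foldr (\<lambda>i x. gen (axis i 1) \<and>\<^sub>e x) l ext_one) = h (foldr (\<lambda>i x. gen (axis i 1) \<and>\<^sub>e x) l ext_one)"
    for l by (induction l) (simp_all add: assms(3) step)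
  thus "f (axis S 1) = h (axis S 1)" for S by (simp only: ext_basis_eq_prod)
qed

lemma wedge_deg: "x \<in> ext_deg k \<Longrightarrow> y \<in> ext_deg l \<Longrightarrow> x \<and>\<^sub>e y \<in> ext_deg (k + l)"
proof (unfold ext_deg_def, safe)
  fix U
  assume x: "\<forall>S. x $ S \<noteq> 0 \<longrightarrow> card S = k" and y: "\<forall>S. y $ S \<noteq> 0 \<longrightarrow> card S = l"
    and "(x \<and>\<^sub>e y) $ U \<noteq> 0"
  then obtain S where S: "S \<subseteq> U" "x $ S \<noteq> 0" "y $ (U - S) \<noteq> 0"
    unfolding wedge_def by (auto elim!: sum.not_neutral_contains_not_neutral)
  have "card U = card S + card (U - S)"
    using S(1) by (metis add_diff_inverse_nat card_Diff_subset card_mono finite not_le)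
  with S x y show "card U = k + l" by simp
qed

lemma gen_deg: "gen v \<in> ext_deg 1"
  unfolding ext_deg_def by (auto simp: gen_nth elim!: sum.not_neutral_contains_not_neutral split: if_splits)

lemma one_deg: "ext_one \<in> ext_deg 0"
  by (simp add: ext_deg_def ext_one_def axis_def)

lemma axis_deg: "axis S 1 \<in> ext_deg (card S)"
  by (simp add: ext_deg_def axis_def)

lemma dot_axis: "dot (axis i 1) v = v $ i" "dot v (axis i 1) = v $ i"
proof -
  have "dot (axis i 1) v = (\<Sum>j\<in>UNIV. if j = i then v $ j else 0)"
    unfolding dot_def by (intro sum.cong) (auto simp: axis_def)
  thus "dot (axis i 1) v = v $ i" by simp
  thus "dot v (axis i 1) = v $ i" by (simp add: dot_def mult.commute)
qed

context
begin

private definition pair :: "'n::finite ext \<Rightarrow> 'n ext \<Rightarrow> complex" where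
  "pair x y = (\<Sum>U\<in>UNIV. x $ U * y $ U)"

private definition grinv :: "'n::finite ext \<Rightarrow> 'n ext" where
  "grinv x = (\<chi> S. (-1) ^ card S * x $ S)"

private definition extrev :: "'n::finite ext \<Rightarrow> 'n ext" where
  "extrev x = (\<chi> S. (-1) ^ (card S choose 2) * x $ S)"

private definition G :: "'n::{finite,linorder} ext \<Rightarrow> 'n ext \<Rightarrow> 'n ext" where
  "G a x = (\<chi> T. pair (extrev a \<and>\<^sub>e axis T 1) x)"

private lemma clinear_grinv: "clinear grinv"
  by (rule clinearI) (simp_all add: grinv_def vec_eq_iff algebra_simps)

private lemma clinear_extrev: "clinear extrev"
  by (rule clinearI) (simp_all add: extrev_def vec_eq_iff algebra_simps)

private lemma grinv_deg: "x \<in> ext_deg k \<Longrightarrow> grinv x = (-1) ^ k *s x"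
  by (auto simp: grinv_def ext_deg_def vec_eq_iff)

private lemma grinv_axis: "grinv (axis S 1) = (-1) ^ card S *s axis S 1"
  by (rule grinv_deg[OF axis_deg])

private lemma extrev_axis: "extrev (axis S 1) = (-1) ^ (card S choose 2) *s axis S 1"
  by (auto simp: extrev_def vec_eq_iff axis_def)

private lemma extrev_gen: "extrev (gen v) = gen v"
proof -
  have "extrev (gen v) $ S = gen v $ S" for S
    using gen_deg[of v] by (cases "gen v $ S = 0") (auto simp: extrev_def ext_deg_def binomial_eq_0)
  thus ?thesis by (simp add: vec_eq_iff)
qed

private lemma pair_linear:
  "pair (x + x') y = pair x y + pair x' y" "pair (c *s x) y = c * pair x y"
  "pair x (y + y') = pair x y + pair x y'" "pair x (c *s y) = c * pair x y"
  by (simp_all add: pair_def algebra_simps sum.distrib sum_distrib_left)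

private lemma pair_axis: "pair (axis S 1) x = x $ S" "pair x (axis S 1) = x $ S"
proof -
  have "pair (axis S 1) x = (\<Sum>U\<in>UNIV. if U = S then x $ U else 0)"
    unfolding pair_def by (intro sum.cong) (auto simp: axis_def)
  thus "pair (axis S 1) x = x $ S" by simp
  thus "pair x (axis S 1) = x $ S" by (simp add: pair_def mult.commute)
qed

private lemma clinear_G: "clinear (G a)" "clinear (\<lambda>a. G a x)"
  by (rule clinearI; simp add: G_def vec_eq_iff pair_linear wedge_simps
        clinear_add[OF clinear_extrev] clinear_scale[OF clinear_extrev])+

private lemma choose2_add: "(m + n) choose 2 = (m choose 2) + (n choose 2) + m * n"
  by (induction m) (simp_all add: numeral_2_eq_2)

private lemma extrev_wedge: "extrev (a \<and>\<^sub>e b) = extrev b \<and>\<^sub>e extrev a"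
proof -
  have 1: "extrev (axis S 1 \<and>\<^sub>e axis T 1) = extrev (axis T 1) \<and>\<^sub>e extrev (axis S (1::complex))"
    for S T :: "'a set"
  proof (cases "S \<inter> T = {}")
    case True
    have "ext_sign S T * (ext_sign T S * ext_sign T S) = (-1) ^ (card S * card T) * ext_sign T S"
      using ext_sign_swap[OF True] by (simp only: mult.assoc[symmetric])
    hence "ext_sign S T = (-1) ^ (card S * card T) * ext_sign T S" by simp
    with True show ?thesis
      by (auto simp: wedge_axis extrev_axis wedge_simps clinear_scale[OF clinear_extrev]
          card_Un_disjoint choose2_add power_add Un_commute Int_commute)
  next
    case False
    thus ?thesis
      by (auto simp: wedge_axis extrev_axis wedge_simps clinear_0[OF clinear_extrev])
  qed
  have 2: "extrev (axis S 1 \<and>\<^sub>e b) = extrev b \<and>\<^sub>e extrev (axis S 1)" for S and b :: "'a ext"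
    by (rule clinear_ext[OF clinear_comp[OF clinear_extrev clinear_wedge_right]
          clinear_comp[OF clinear_wedge_left clinear_extrev]]) (rule 1)
  show ?thesis
    by (rule clinear_ext[OF clinear_comp[OF clinear_extrev clinear_wedge_left]
          clinear_comp[OF clinear_wedge_right clinear_extrev]]) (rule 2)
qed

private lemma pair_G: "pair z (G b x) = pair (extrev b \<and>\<^sub>e z) x"
proof -
  have "pair z (G b x) = (\<Sum>T\<in>UNIV. pair ((z $ T) *s (extrev b \<and>\<^sub>e axis T 1)) x)"
    by (simp add: pair_def[of z] G_def pair_linear)
  also have "\<dots> = pair (\<Sum>T\<in>UNIV. (z $ T) *s (extrev b \<and>\<^sub>e axis T 1)) x"
    by (simp add: pair_def sum_distrib_right) (rule sum.swap)
  also have "(\<Sum>T\<in>UNIV. (z $ T) *s (extrev b \<and>\<^sub>e axis T 1)) = extrev b \<and>\<^sub>e z"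
    by (subst (2) ext_expand[of z])
      (simp add: clinear_sum[OF clinear_wedge_right] clinear_scale[OF clinear_wedge_right])
  finally show ?thesis .
qed

private lemma G_wedge: "G (a \<and>\<^sub>e b) = G a \<circ> G b"
  by (rule ext) (simp add: vec_eq_iff G_def[of "a \<and>\<^sub>e b"] G_def[of a] pair_G extrev_wedge wedge_assoc)

private lemma G_one: "G ext_one = id"
proof -
  have "extrev ext_one = (ext_one :: 'a ext)" by (simp add: ext_one_def extrev_axis binomial_eq_0)
  hence "G ext_one x $ T = x $ T" for x :: "'a ext" and T
    by (simp add: G_def wedge_one_left pair_axis)
  thus ?thesis by (simp add: fun_eq_iff vec_eq_iff)
qed

private lemma G_gen_axis:
  "G (gen (axis i 1)) (axis S 1) = (if i \<in> S then ext_sign {i} (S - {i}) *s axis (S - {i}) 1 else 0)"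
proof -
  have "G (gen (axis i 1)) (axis S 1) $ T = (axis {i} 1 \<and>\<^sub>e axis T 1) $ S" for T
    by (simp add: G_def extrev_gen pair_axis flip: gen_axis)
  hence *: "G (gen (axis i 1)) (axis S 1) $ T
      = (if i \<notin> T \<and> insert i T = S then ext_sign {i} T else 0)" for T
    by (simp add: wedge_axis) (simp add: axis_def)
  have "(if i \<notin> T \<and> insert i T = S then ext_sign {i} T else 0)
      = (if i \<in> S then ext_sign {i} (S - {i}) *s axis (S - {i}) 1 else 0) $ T" for T
    by (auto simp: axis_def)
  with * show ?thesis by (simp add: vec_eq_iff)
qed

private lemma G_anti: "G (gen v) (x \<and>\<^sub>e y) = G (gen v) x \<and>\<^sub>e y + grinv x \<and>\<^sub>e G (gen v) y"
proof -
  have 1: "G (gen (axis i 1)) (axis S 1 \<and>\<^sub>e axis T 1) =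
      G (gen (axis i 1)) (axis S 1) \<and>\<^sub>e axis T 1 + grinv (axis S 1) \<and>\<^sub>e G (gen (axis i 1)) (axis T (1::complex))"
    for i :: 'a and S T
  proof -
    define S' T' where "S' = S - {i}" and "T' = T - {i}"
    note [simp] = grinv_axis G_gen_axis wedge_axis wedge_simps
      clinear_0[OF clinear_G(1)] clinear_scale[OF clinear_G(1)]
    consider "i \<notin> S" "i \<notin> T" | "i \<in> S" "i \<notin> T" | "i \<notin> S" "i \<in> T" | "i \<in> S" "i \<in> T" by blast
    thus ?thesis
    proof cases
      case 1
      thus ?thesis by auto
    next
      case 2
      hence S: "S = {i} \<union> S'" "i \<notin> S'" by (auto simp: S'_def)
      show ?thesis
      proof (cases "S' \<inter> T = {}")
        case True
        have "ext_sign S T = ext_sign {i} T * ext_sign S' T"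
          unfolding S(1) using S(2) by (intro ext_sign_Un_left) auto
        moreover have "ext_sign {i} (S' \<union> T) = ext_sign {i} S' * ext_sign {i} T"
          using True by (rule ext_sign_Un_right)
        moreover have "S \<union> T - {i} = S' \<union> T" "S - {i} = S'" "S \<inter> T = {}" using S 2 True by auto
        ultimately show ?thesis using 2 True by (simp add: algebra_simps)
      next
        case False
        hence "S \<inter> T \<noteq> {}" "S - {i} = S'" using S by auto
        with False 2 show ?thesis by simp
      qed
    next
      case 3
      hence T: "T = {i} \<union> T'" "i \<notin> T'" by (auto simp: T'_def)
      show ?thesis
      proof (cases "S \<inter> T' = {}")
        case True
        have "ext_sign S T = ext_sign S {i} * ext_sign S T'"
          unfolding T(1) using T(2) by (intro ext_sign_Un_right) auto
        moreover have "ext_sign {i} (S \<union> T') = ext_sign {i} S * ext_sign {i} T'"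
          using True by (rule ext_sign_Un_right)
        moreover have "ext_sign {i} S * ext_sign S {i} = (-1) ^ card S"
          using ext_sign_swap[of "{i}" S] 3 by simp
        moreover have "S \<union> T - {i} = S \<union> T'" "T - {i} = T'" "S \<inter> T = {}" using T 3 True by auto
        ultimately show ?thesis using 3 True by (simp add: algebra_simps)
      next
        case False
        hence "S \<inter> T \<noteq> {}" "T - {i} = T'" using T by auto
        with False 3 show ?thesis by simp
      qed
    next
      case 4
      hence S: "S = {i} \<union> S'" "i \<notin> S'" and T: "T = {i} \<union> T'" "i \<notin> T'"
        by (auto simp: S'_def T'_def)
      have *: "S - {i} = S'" "T - {i} = T'" "S \<inter> T \<noteq> {}" using S T by auto
      show ?thesis
      proof (cases "S' \<inter> T' = {}")
        case True
        have "ext_sign S' T = ext_sign S' {i} * ext_sign S' T'"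
          unfolding T(1) using T(2) by (intro ext_sign_Un_right) auto
        moreover have "ext_sign S T' = ext_sign {i} T' * ext_sign S' T'"
          unfolding S(1) using S(2) by (intro ext_sign_Un_left) auto
        moreover have "ext_sign {i} S' * ext_sign S' {i} = (-1) ^ card S'"
          using ext_sign_swap[of "{i}" S'] S by simp
        moreover have "card S = Suc (card S')" using S by simp
        moreover have "S' \<union> T = S \<union> T'" "S' \<inter> T = {}" "S \<inter> T' = {}" using S T True by auto
        moreover have "(-1) ^ card S *s axis S 1 \<and>\<^sub>e axis T' 1
            = (-1) ^ card S *s (axis S 1 \<and>\<^sub>e axis T' (1::complex))"
          by (rule clinear_scale[OF clinear_wedge_left])
        ultimately show ?thesis using 4 *
          by (simp add: vec_eq_iff mult.assoc[symmetric])
      next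
        case False
        hence "S' \<inter> T \<noteq> {}" "S \<inter> T' \<noteq> {}" using S T by auto
        with 4 * show ?thesis by simp
      qed
    qed
  qed
  have 2: "G (gen (axis i 1)) (axis S 1 \<and>\<^sub>e y) =
      G (gen (axis i 1)) (axis S 1) \<and>\<^sub>e y + grinv (axis S 1) \<and>\<^sub>e G (gen (axis i 1)) y"
    for i :: 'a and S y
    by (rule clinear_ext[OF clinear_comp[OF clinear_G(1) clinear_wedge_right]
          clinear_plus[OF clinear_wedge_right clinear_comp[OF clinear_wedge_right clinear_G(1)]]])
      (rule 1)
  have 3: "G (gen (axis i 1)) (x \<and>\<^sub>e y) =
      G (gen (axis i 1)) x \<and>\<^sub>e y + grinv x \<and>\<^sub>e G (gen (axis i 1)) y"
    for i :: 'a and x y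
    by (rule clinear_ext[OF clinear_comp[OF clinear_G(1) clinear_wedge_left]
          clinear_plus[OF clinear_comp[OF clinear_wedge_left clinear_G(1)]
            clinear_comp[OF clinear_wedge_left clinear_grinv]]]) (rule 2)
  show ?thesis
    by (rule clinear_ext[where f = "\<lambda>v. G (gen v) (x \<and>\<^sub>e y)"])
      (rule clinear_comp[OF clinear_G(2) clinear_gen]
        clinear_plus[OF clinear_comp[OF clinear_wedge_left clinear_comp[OF clinear_G(2) clinear_gen]]
          clinear_comp[OF clinear_wedge_right clinear_comp[OF clinear_G(2) clinear_gen]]] 3)+
qed

private lemma G_deg: "x \<in> ext_deg (Suc k) \<Longrightarrow> G (gen v) x \<in> ext_deg k"
proof -
  assume x: "x \<in> ext_deg (Suc k)"
  have "card T = k" if "G (gen v) x $ T \<noteq> 0" for T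
  proof -
    from that obtain U where "(gen v \<and>\<^sub>e axis T 1) $ U \<noteq> 0" "x $ U \<noteq> 0"
      by (auto simp: G_def pair_def extrev_gen elim!: sum.not_neutral_contains_not_neutral)
    with x wedge_deg[OF gen_deg axis_deg, of v T] show ?thesis
      by (auto simp: ext_deg_def)
  qed
  thus ?thesis by (simp add: ext_deg_def)
qed

private lemma G_deg0: "x \<in> ext_deg 0 \<Longrightarrow> G (gen v) x = 0"
proof -
  assume x: "x \<in> ext_deg 0"
  have "G (gen v) x $ T = 0" for T
  proof (rule ccontr)
    assume "G (gen v) x $ T \<noteq> 0"
    then obtain U where "(gen v \<and>\<^sub>e axis T 1) $ U \<noteq> 0" "x $ U \<noteq> 0"
      by (auto simp: G_def pair_def extrev_gen elim!: sum.not_neutral_contains_not_neutral)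
    with x wedge_deg[OF gen_deg axis_deg, of v T] show False
      by (auto simp: ext_deg_def)
  qed
  thus ?thesis by (simp add: vec_eq_iff)
qed

private lemma G_gen_gen: "G (gen v) (gen w) = dot v w *s ext_one"
proof -
  have 1: "G (gen (axis i 1)) (gen (axis j 1)) = (if i = j then 1 else 0) *s ext_one" for i j :: 'a
    by (subst (2) gen_axis) (simp add: G_gen_axis ext_one_def)
  have 2: "G (gen (axis i 1)) (gen w) = (w $ i) *s ext_one" for i :: 'a and w
  proof (rule clinear_ext[where h = "\<lambda>w. (w $ i) *s ext_one"])
    show "clinear (\<lambda>w. (w $ i) *s ext_one)"
      by (rule clinearI) (simp_all add: vec.scale_left_distrib)
    show "G (gen (axis i 1)) (gen (axis j 1)) = (axis j 1 $ i) *s ext_one" for j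
      by (simp add: 1) (simp add: axis_def)
  qed (rule clinear_comp[OF clinear_G(1) clinear_gen])
  show ?thesis
  proof (rule clinear_ext[where h = "\<lambda>v. dot v w *s ext_one"])
    show "clinear (\<lambda>v. dot v w *s ext_one)"
      by (rule clinearI)
        (simp_all add: dot_def algebra_simps sum.distrib vec.scale_left_distrib flip: sum_distrib_left)
    show "G (gen (axis i 1)) (gen w) = dot (axis i 1) w *s ext_one" for i
      by (simp add: 2 dot_axis)
  qed (rule clinear_comp[OF clinear_G(2) clinear_gen])
qed

private lemma G_contraction: "is_contraction v (G (gen v))"
  unfolding is_contraction_def antiderivation_def
  using G_deg G_deg0 by (auto simp: clinear_G G_gen_gen G_anti grinv_deg wedge_simps)

private lemma contraction_unique:
  assumes f: "is_contraction v f" and h: "is_contraction v h"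
  shows "f = h"
proof -
  have one: "k ext_one = 0" if "is_contraction v k" for k
    using that one_deg by (auto simp: is_contraction_def antiderivation_def)
  have step: "k (gen w \<and>\<^sub>e y) = dot v w *s ext_one \<and>\<^sub>e y + (-1) ^ 1 *s (gen w \<and>\<^sub>e k y)"
    if k: "is_contraction v k" for k w y
  proof -
    have "k (gen w \<and>\<^sub>e y) = k (gen w) \<and>\<^sub>e y + (-1) ^ 1 *s (gen w \<and>\<^sub>e k y)"
      using k gen_deg[of w] unfolding is_contraction_def antiderivation_def by blast
    moreover have "k (gen w) = dot v w *s ext_one"
      using k by (simp add: is_contraction_def)
    ultimately show ?thesis by simp
  qed
  have "f x = h x" for x
  proof (rule clinear_ext_gen[where f = f and h = h])
    show "clinear f" "clinear h" using f h by (simp_all add: is_contraction_def antiderivation_def)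
    show "f ext_one = h ext_one" using one[OF f] one[OF h] by simp
    fix i y assume "f y = h y"
    thus "f (gen (axis i 1) \<and>\<^sub>e y) = h (gen (axis i 1) \<and>\<^sub>e y)"
      by (simp only: step[OF f] step[OF h])
  qed
  thus ?thesis by (rule ext)
qed

lemma Delta1_ex1: "\<exists>!f. is_contraction v f"
  by (rule ex1I[where a = "G (gen v)"]) (rule G_contraction, erule contraction_unique[OF _ G_contraction])

lemma Delta1: "is_contraction v (Delta1 v)"
  unfolding Delta1_def by (rule theI'[OF Delta1_ex1])

private lemma Delta1_eq_G: "Delta1 v = G (gen v)"
  by (rule contraction_unique[OF Delta1 G_contraction])

lemma Delta_ex1: "\<exists>!F :: 'a::{finite,linorder} ext \<Rightarrow> 'a ext \<Rightarrow> 'a ext. extends_Delta1 F"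
proof (rule ex1I)
  show *: "extends_Delta1 (G :: 'a ext \<Rightarrow> 'a ext \<Rightarrow> 'a ext)"
    by (simp add: extends_Delta1_def clinear_G G_one G_wedge Delta1_eq_G)
  fix F :: "'a ext \<Rightarrow> 'a ext \<Rightarrow> 'a ext" assume F: "extends_Delta1 F"
  have gen: "F (gen v \<and>\<^sub>e b) x = Delta1 v (F b x)" "G (gen v \<and>\<^sub>e b) x = Delta1 v (G b x)" for v b and x :: "'a ext"
    using F by (simp add: extends_Delta1_def) (simp add: G_wedge Delta1_eq_G)
  have one: "F ext_one x = G ext_one x" for x :: "'a ext" using F by (simp add: extends_Delta1_def G_one)
  have "F a x = G a x" for a x
  proof (rule clinear_ext_gen[where f = "\<lambda>a. F a x" and h = "\<lambda>a. G a x"])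
    show "clinear (\<lambda>a. F a x)" "clinear (\<lambda>a. G a x)" using F clinear_G by (simp_all add: extends_Delta1_def)
  qed (simp_all add: gen one)
  thus "F = G" by blast
qed

lemma Delta: "extends_Delta1 Delta"
  unfolding Delta_def by (rule theI'[OF Delta_ex1])

private lemma gen_wedge_grinv: "gen w \<and>\<^sub>e grinv x = x \<and>\<^sub>e gen w"
proof -
  have 1: "gen (axis i 1) \<and>\<^sub>e grinv (axis S 1) = axis S 1 \<and>\<^sub>e gen (axis i (1::complex))" for i :: 'a and S
  proof (cases "i \<in> S")
    case False
    hence "ext_sign {i} S * ext_sign S {i} = (-1) ^ card S"
      using ext_sign_swap[of "{i}" S] by simp
    hence "ext_sign {i} S * (ext_sign S {i} * ext_sign S {i}) = (-1) ^ card S * ext_sign S {i}"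
      by (simp only: mult.assoc[symmetric])
    hence "ext_sign {i} S = (-1) ^ card S * ext_sign S {i}" by simp
    hence "(-1) ^ card S * ext_sign {i} S = ext_sign S {i}"
      by (simp flip: mult.assoc power_add power2_eq_square add: minus_one_power_iff)
    with False show ?thesis
      by (simp add: grinv_axis gen_axis wedge_axis wedge_simps)
  qed (simp add: grinv_axis gen_axis wedge_axis wedge_simps)
  have 2: "gen (axis i 1) \<and>\<^sub>e grinv x = x \<and>\<^sub>e gen (axis i 1)" for i :: 'a and x
    by (rule clinear_ext[OF clinear_comp[OF clinear_wedge_right clinear_grinv] clinear_wedge_left])
      (rule 1)
  show ?thesis
    by (rule clinear_ext[OF clinear_comp[OF clinear_wedge_left clinear_gen]
          clinear_comp[OF clinear_wedge_right clinear_gen]]) (rule 2)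
qed

lemma Der_ex1: "\<exists>!f. derivation f \<and> (\<forall>v. f (gen v) = gen (A *v v))"
proof (rule ex1I)
  define f where "f x = (\<Sum>j\<in>UNIV. gen (A *v axis j 1) \<and>\<^sub>e G (gen (axis j 1)) x)" for x
  have lin: "clinear f"
    by (rule clinearI)
      (simp_all add: f_def clinear_add[OF clinear_G(1)] clinear_scale[OF clinear_G(1)] wedge_simps
        sum.distrib vec.scale_sum_right)
  have "gen w \<and>\<^sub>e (grinv x \<and>\<^sub>e z) = x \<and>\<^sub>e (gen w \<and>\<^sub>e z)" for w and x z :: "'a ext"
    by (simp add: gen_wedge_grinv flip: wedge_assoc)
  hence "f (x \<and>\<^sub>e y) = f x \<and>\<^sub>e y + x \<and>\<^sub>e f y" for x y
    by (simp add: f_def G_anti wedge_simps sum.distrib wedge_assoc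
        clinear_sum[OF clinear_wedge_left] clinear_sum[OF clinear_wedge_right])
  moreover have "f (gen v) = gen (A *v v)" for v
  proof (rule clinear_ext[OF clinear_comp[OF lin clinear_gen]])
    show "clinear (\<lambda>v. gen (A *v v))"
      by (rule clinearI) (simp_all add: matrix_vector_right_distrib vec.scale
        clinear_add[OF clinear_gen] clinear_scale[OF clinear_gen])
    fix i
    have "f (gen (axis i 1)) = (\<Sum>j\<in>UNIV. if j = i then gen (A *v axis j 1) else 0)"
      unfolding f_def by (intro sum.cong) (auto simp: G_gen_gen dot_axis axis_def[of i] wedge_simps
          wedge_one_right)
    thus "f (gen (axis i 1)) = gen (A *v axis i 1)" by simp
  qed
  ultimately show f: "derivation f \<and> (\<forall>v. f (gen v) = gen (A *v v))"
    using lin by (simp add: derivation_def)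
  fix h assume h: "derivation h \<and> (\<forall>v. h (gen v) = gen (A *v v))"
  have one: "k ext_one = 0" if "derivation k" for k
  proof -
    have "k (ext_one \<and>\<^sub>e ext_one) = k ext_one \<and>\<^sub>e ext_one + ext_one \<and>\<^sub>e k ext_one"
      using that by (simp only: derivation_def)
    thus ?thesis by (simp add: wedge_one_left wedge_one_right)
  qed
  have "h x = f x" for x
    by (rule clinear_ext_gen) (use f h in \<open>auto simp: derivation_def one\<close>)
  thus "h = f" by blast
qed

lemma Der: "derivation (Der A)" "Der A (gen v) = gen (A *v v)"
  using theI'[OF Der_ex1, of A] by (simp_all add: Der_def)

end

lemma dot_transpose: "dot (transpose A *v v) w = dot v (A *v w)"
  by (simp add: dot_def matrix_vector_mult_def transpose_def sum_distrib_left sum_distrib_right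
      ac_simps) (rule sum.swap)

lemma adj_ex1: "\<exists>!B. \<forall>v w. dot (B *v v) w = dot v (A *v w)"
proof (rule ex1I[of _ "transpose A"])
  fix B assume B: "\<forall>v w. dot (B *v v) w = dot v (A *v w)"
  have "(B *v v) $ i = (transpose A *v v) $ i" for v i
    using B dot_transpose[of A v] by (metis dot_axis(2))
  thus "B = transpose A" by (simp add: matrix_eq vec_eq_iff)
qed (simp add: dot_transpose del: transpose_matrix_vector)

lemma adj_eq_transpose: "adj A = transpose A"
  unfolding adj_def by (rule the1_equality[OF adj_ex1]) (simp add: dot_transpose del: transpose_matrix_vector)


section \<open>Finite-dimensional complex Lie algebras\<close>

text \<open>
  A Lie algebra lives on a subspace \<open>L\<close> of an ambient vector space.  Linear functionals on a
  subspace \<open>H\<close> are represented by functions that vanish outside \<open>H\<close>, so that equality of functionals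
  is equality of functions.
\<close>

locale findim_lie_algebra = vector_space scale
  for scale :: "complex \<Rightarrow> 'a::ab_group_add \<Rightarrow> 'a" +
  fixes L :: "'a set" and br :: "'a \<Rightarrow> 'a \<Rightarrow> 'a"
  assumes subspace_carrier: "subspace L"
    and finite_dim: "\<exists>B. finite B \<and> span B = L"
    and br_closed: "x \<in> L \<Longrightarrow> y \<in> L \<Longrightarrow> br x y \<in> L"
    and br_add_left: "x \<in> L \<Longrightarrow> y \<in> L \<Longrightarrow> z \<in> L \<Longrightarrow> br (x + y) z = br x z + br y z"
    and br_add_right: "x \<in> L \<Longrightarrow> y \<in> L \<Longrightarrow> z \<in> L \<Longrightarrow> br x (y + z) = br x y + br x z"
    and br_scale_left: "x \<in> L \<Longrightarrow> y \<in> L \<Longrightarrow> br (scale c x) y = scale c (br x y)"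
    and br_scale_right: "x \<in> L \<Longrightarrow> y \<in> L \<Longrightarrow> br x (scale c y) = scale c (br x y)"
    and br_self: "x \<in> L \<Longrightarrow> br x x = 0"
    and jacobi: "x \<in> L \<Longrightarrow> y \<in> L \<Longrightarrow> z \<in> L \<Longrightarrow>
      br x (br y z) + br y (br z x) + br z (br x y) = 0"
begin

definition br_sets :: "'a set \<Rightarrow> 'a set \<Rightarrow> 'a set" where
  "br_sets A B = span {br x y | x y. x \<in> A \<and> y \<in> B}"

definition lie_ideal :: "'a set \<Rightarrow> bool" where
  "lie_ideal I \<longleftrightarrow> subspace I \<and> I \<subseteq> L \<and> (\<forall>x \<in> L. \<forall>y \<in> I. br x y \<in> I)"

definition simple_lie_algebra :: bool where
  "simple_lie_algebra \<longleftrightarrow> br_sets L L \<noteq> {0} \<and> (\<forall>I. lie_ideal I \<longrightarrow> I = {0} \<or> I = L)"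

definition subalgebra :: "'a set \<Rightarrow> bool" where
  "subalgebra H \<longleftrightarrow> subspace H \<and> H \<subseteq> L \<and> (\<forall>x \<in> H. \<forall>y \<in> H. br x y \<in> H)"

definition nilpotent :: "'a set \<Rightarrow> bool" where
  "nilpotent H \<longleftrightarrow> (\<exists>n. (br_sets H ^^ n) H = {0})"

definition cartan_subalgebra :: "'a set \<Rightarrow> bool" where
  "cartan_subalgebra H \<longleftrightarrow>
     subalgebra H \<and> nilpotent H \<and> {x \<in> L. \<forall>h \<in> H. br x h \<in> H} = H"

definition dual :: "'a set \<Rightarrow> ('a \<Rightarrow> complex) set" where
  "dual H = {\<alpha>. (\<forall>x \<in> H. \<forall>y \<in> H. \<alpha> (x + y) = \<alpha> x + \<alpha> y) \<and>
                (\<forall>c. \<forall>x \<in> H. \<alpha> (scale c x) = c * \<alpha> x) \<and> (\<forall>x. x \<notin> H \<longrightarrow> \<alpha> x = 0)}"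

definition root_space :: "'a set \<Rightarrow> ('a \<Rightarrow> complex) \<Rightarrow> 'a set" where
  "root_space H \<alpha> = {x \<in> L. \<forall>h \<in> H. br h x = scale (\<alpha> h) x}"

definition roots :: "'a set \<Rightarrow> ('a \<Rightarrow> complex) set" where
  "roots H = {\<alpha> \<in> dual H. \<alpha> \<noteq> (\<lambda>_. 0) \<and> root_space H \<alpha> \<noteq> {0}}"

text \<open>
  For semisimple \<open>L\<close>, \<open>[L\<^sub>\<alpha>, L\<^sub>-\<^sub>\<alpha>]\<close> is a line in \<open>H\<close> on which \<open>\<alpha>\<close> does not vanish, so the coroot is
  well defined.
\<close>

definition coroot :: "'a set \<Rightarrow> ('a \<Rightarrow> complex) \<Rightarrow> 'a" where
  "coroot H \<alpha> = (THE h. h \<in> br_sets (root_space H \<alpha>) (root_space H (\<lambda>x. - \<alpha> x)) \<and> \<alpha> h = 2)"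

definition root_base :: "'a set \<Rightarrow> ('a \<Rightarrow> complex) set \<Rightarrow> bool" where
  "root_base H \<Delta> \<longleftrightarrow> finite \<Delta> \<and> \<Delta> \<subseteq> roots H \<and>
     (\<forall>c. (\<forall>h. (\<Sum>\<alpha>\<in>\<Delta>. c \<alpha> * \<alpha> h) = 0) \<longrightarrow> (\<forall>\<alpha> \<in> \<Delta>. c \<alpha> = 0)) \<and>
     (\<forall>\<beta> \<in> roots H. \<exists>k :: ('a \<Rightarrow> complex) \<Rightarrow> int.
        (\<forall>h. \<beta> h = (\<Sum>\<alpha>\<in>\<Delta>. of_int (k \<alpha>) * \<alpha> h)) \<and>
        ((\<forall>\<alpha> \<in> \<Delta>. k \<alpha> \<ge> 0) \<or> (\<forall>\<alpha> \<in> \<Delta>. k \<alpha> \<le> 0)))"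

definition has_cartan_matrix :: "nat \<Rightarrow> (nat \<Rightarrow> nat \<Rightarrow> int) \<Rightarrow> bool" where
  "has_cartan_matrix l C \<longleftrightarrow> (\<exists>H \<alpha>. cartan_subalgebra H \<and> inj_on \<alpha> {1..l} \<and>
     root_base H (\<alpha> ` {1..l}) \<and>
     (\<forall>i \<in> {1..l}. \<forall>j \<in> {1..l}. (\<alpha> i) (coroot H (\<alpha> j)) = of_int (C i j)))"

text \<open>
  Chevalley bases in the sense of Humphreys, \<^emph>\<open>Introduction to Lie Algebras and Representation
  Theory\<close>, Section 25.2; the notion is meant for semisimple \<open>L\<close>.  The last condition on root vectors
  says that the structure constants satisfy \<open>c(\<alpha>, \<beta>) = - c(-\<alpha>, -\<beta>)\<close>.
\<close>

definition chevalley_basis :: "'a set \<Rightarrow> bool" where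
  "chevalley_basis B \<longleftrightarrow> independent B \<and> span B = L \<and>
     (\<exists>H \<Delta> e. cartan_subalgebra H \<and> root_base H \<Delta> \<and>
        B = coroot H ` \<Delta> \<union> e ` roots H \<and>
        (\<forall>\<alpha> \<in> roots H. e \<alpha> \<in> root_space H \<alpha> - {0}) \<and>
        (\<forall>\<alpha> \<in> roots H. br (e \<alpha>) (e (\<lambda>h. - \<alpha> h)) = coroot H \<alpha>) \<and>
        (\<forall>\<alpha> \<in> roots H. \<forall>\<beta> \<in> roots H. (\<lambda>h. \<alpha> h + \<beta> h) \<in> roots H \<longrightarrow>
           (\<exists>c. br (e \<alpha>) (e \<beta>) = scale c (e (\<lambda>h. \<alpha> h + \<beta> h)) \<and>
                br (e (\<lambda>h. - \<alpha> h)) (e (\<lambda>h. - \<beta> h)) = scale (- c) (e (\<lambda>h. - (\<alpha> h + \<beta> h))))))"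

end

text \<open>The Dynkin diagram of type \<open>E\<^sub>6\<close>, in Bourbaki's numbering.\<close>

definition cartan_matrix_E6 :: "nat \<Rightarrow> nat \<Rightarrow> int" where
  "cartan_matrix_E6 i j =
     (if i = j then 2
      else if {i, j} \<in> {{1, 3}, {3, 4}, {4, 5}, {5, 6}, {2, 4}} then -1 else 0)"

section \<open>The 5-graded Lie algebras\<close>

type_synonym form = "6 ext"
type_synonym mat6 = "complex ^ 6 ^ 6"

definition mscale :: "complex \<Rightarrow> mat6 \<Rightarrow> mat6" where
  "mscale c A = (\<chi> i j. c * A $ i $ j)"

definition pscale :: "complex \<Rightarrow> mat6 \<times> mat6 \<Rightarrow> mat6 \<times> mat6" where
  "pscale c A = (mscale c (fst A), mscale c (snd A))"

text \<open>Pairs are ordered as \<open>(A\<^sup>-, A\<^sup>+)\<close>.\<close>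

definition lieS :: "(mat6 \<times> mat6) set" where
  "lieS = {(Am, Ap). \<forall>v w. dot (Am *v v) w + dot v (Ap *v w) = 0}"

definition lieS_bracket :: "mat6 \<times> mat6 \<Rightarrow> mat6 \<times> mat6 \<Rightarrow> mat6 \<times> mat6" where
  "lieS_bracket A B =
     (fst A ** fst B - fst B ** fst A, snd A ** snd B - snd B ** snd A)"

definition E_op :: "form \<Rightarrow> form \<Rightarrow> mat6" where
  "E_op x a = matrix (\<lambda>v. vec_part (Delta (Delta (gen v) a) x))"

definition E_pair :: "form \<Rightarrow> form \<Rightarrow> mat6 \<times> mat6" where
  "E_pair xm xp = (E_op xm xp, - E_op xp xm)"

definition h_M :: "mat6 \<times> mat6" where
  "h_M = (- mat 1, mat 1)"

text \<open>
  The components of degrees \<open>-2, -1, 0, 0, 1, 2\<close>; the component of degree \<open>0\<close> consists of an element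
  of \<open>\<S>\<close> and the coefficient of \<open>h\<^sub>0\<close>.  The restrictions on the components are imposed in \<open>Etilde\<close>.
\<close>

datatype elt = Elt (neg2: form) (neg1: form) (endS: "mat6 \<times> mat6") (h0c: complex)
  (pos1: form) (pos2: form)

instantiation elt :: ab_group_add
begin

definition "0 = Elt 0 0 0 0 0 0"
definition "X + Y = Elt (neg2 X + neg2 Y) (neg1 X + neg1 Y) (endS X + endS Y) (h0c X + h0c Y)
  (pos1 X + pos1 Y) (pos2 X + pos2 Y)"
definition "X - Y = Elt (neg2 X - neg2 Y) (neg1 X - neg1 Y) (endS X - endS Y) (h0c X - h0c Y)
  (pos1 X - pos1 Y) (pos2 X - pos2 Y)"
definition "- X = Elt (- neg2 X) (- neg1 X) (- endS X) (- h0c X) (- pos1 X) (- pos2 X)"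

instance
  by standard (simp_all add: zero_elt_def plus_elt_def minus_elt_def uminus_elt_def algebra_simps)

end

definition escale :: "complex \<Rightarrow> elt \<Rightarrow> elt" where
  "escale c X = Elt (c *s neg2 X) (c *s neg1 X) (pscale c (endS X)) (c * h0c X)
     (c *s pos1 X) (c *s pos2 X)"

lemma vector_space_escale: "vector_space escale"
  by unfold_locales
    (simp_all add: escale_def pscale_def mscale_def plus_elt_def algebra_simps vec_eq_iff
      prod_eq_iff elt.expand)

definition Etilde :: "elt set" where
  "Etilde = {X. neg2 X \<in> ext_deg 6 \<and> neg1 X \<in> ext_deg 3 \<and> endS X \<in> lieS \<and>
                pos1 X \<in> ext_deg 3 \<and> pos2 X \<in> ext_deg 6}"

text \<open>The action of the degree \<open>0\<close> part of \<open>X\<close> on the components of degrees \<open>k\<close> and \<open>-k\<close>.\<close>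

definition act_pos :: "nat \<Rightarrow> elt \<Rightarrow> form \<Rightarrow> form" where
  "act_pos k X p = Der (snd (endS X)) p + (of_nat k * h0c X) *s p"

definition act_neg :: "nat \<Rightarrow> elt \<Rightarrow> form \<Rightarrow> form" where
  "act_neg k X p = Der (fst (endS X)) p - (of_nat k * h0c X) *s p"

text \<open>
  \<open>mixed_product X Y\<close> collects the products \<open>[X\<^sub>i, Y\<^sub>j]\<close> for which \<open>[X\<^sub>i, Y\<^sub>j]\<close> (rather than
  \<open>[Y\<^sub>j, X\<^sub>i]\<close>) is prescribed: \<open>(i, j) = (0, \<plusminus>1), (0, \<plusminus>2), (-1, 1), (-2, 2), (1, -2), (-1, 2)\<close>.
  Skew-symmetry determines the products in the opposite order; the products with \<open>i = j\<close> are
  added in \<open>ebr\<close>.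
\<close>

definition mixed_product :: "elt \<Rightarrow> elt \<Rightarrow> elt" where
  "mixed_product X Y =
     (let c1 = scalar_part (Delta (neg1 X) (pos1 Y)); c2 = scalar_part (Delta (neg2 X) (pos2 Y))
      in Elt
        (act_neg 2 X (neg2 Y))
        (act_neg 1 X (neg1 Y) + Delta (pos1 X) (neg2 Y))
        (E_pair (neg1 X) (pos1 Y) - pscale c2 h_M)
        (c1 + 2 * c2)
        (act_pos 1 X (pos1 Y) + Delta (neg1 X) (pos2 Y))
        (act_pos 2 X (pos2 Y)))"

definition ebr :: "elt \<Rightarrow> elt \<Rightarrow> elt" where
  "ebr X Y = mixed_product X Y - mixed_product Y X +
     Elt (neg1 X \<and>\<^sub>e neg1 Y) 0 (lieS_bracket (endS X) (endS Y)) 0 0 (pos1 X \<and>\<^sub>e pos1 Y)"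

definition E_alg :: "elt set" where
  "E_alg = {X \<in> Etilde. trace (snd (endS X)) + 3 * h0c X = 0}"

subsection \<open>The basis\<close>

text \<open>
  The type \<open>6\<close> is linearly ordered by \<open>0 < 1 < \<dots> < 5\<close>, and \<open>6 = 0\<close> in it; \<open>ix i\<close> is its
  \<open>i\<close>-th element for \<open>1 \<le> i \<le> 6\<close>.
\<close>

definition ix :: "nat \<Rightarrow> 6" where
  "ix i = of_nat (i - 1)"

lemma ix_strict_mono: "strict_mono_on {1..6} ix"
proof (rule strict_mono_onI)
  have rep: "Rep_bit0 (of_nat n :: 6) = int n" if "n < 6" for n
    using that by (simp add: bit0.of_nat_eq bit0.Abs_inverse)
  fix i j :: nat
  assume "i \<in> {1..6}" "j \<in> {1..6}" "i < j"
  thus "ix i < ix j" unfolding ix_def less_bit0_def by (subst (1 2) rep) auto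
qed

lemma ix_image: "ix ` {1..6} = UNIV"
proof (rule card_subset_eq)
  show "card (ix ` {1..6}) = card (UNIV :: 6 set)"
    by (subst card_image) (use strict_mono_on_imp_inj_on[OF ix_strict_mono] in auto)
qed auto

definition munit :: "6 \<Rightarrow> 6 \<Rightarrow> mat6" where
  "munit i j = (\<chi> a b. if a = i \<and> b = j then 1 else 0)"

definition iota_plus :: "mat6 \<Rightarrow> elt" where
  "iota_plus A = Elt 0 0 (- adj A, A) 0 0 0"

definition h_zero :: elt where
  "h_zero = Elt 0 0 0 1 0 0"

definition h_basis :: "nat \<Rightarrow> elt" where
  "h_basis i =
     (if i \<le> 5 then iota_plus (munit (ix i) (ix i) - munit (ix (i + 1)) (ix (i + 1)))
      else iota_plus (munit (ix 4) (ix 4) + munit (ix 5) (ix 5) + munit (ix 6) (ix 6)) - h_zero)"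

text \<open>The products \<open>v\<^sub>S\<^sup>+ = v\<^sub>i\<^sub>1 \<dots> v\<^sub>i\<^sub>l\<close> and \<open>v\<^sub>S\<^sup>- = v\<^sub>i\<^sub>l \<dots> v\<^sub>i\<^sub>1\<close> for \<open>S = {i1 < \<dots> < il}\<close>.\<close>

definition v_plus :: "6 set \<Rightarrow> form" where
  "v_plus S = foldr (\<lambda>i x. gen (axis i 1) \<and>\<^sub>e x) (sorted_list_of_set S) ext_one"

definition v_minus :: "6 set \<Rightarrow> form" where
  "v_minus S = foldr (\<lambda>i x. gen (axis i 1) \<and>\<^sub>e x) (rev (sorted_list_of_set S)) ext_one"

definition B_E :: "elt set" where
  "B_E = h_basis ` {1..6}
     \<union> {iota_plus (munit i j) | i j. i \<noteq> j}
     \<union> {Elt 0 0 0 0 (v_plus S) 0 | S. card S = 3}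
     \<union> {Elt 0 (v_minus S) 0 0 0 0 | S. card S = 3}
     \<union> {Elt 0 0 0 0 0 (v_plus UNIV), Elt (v_minus UNIV) 0 0 0 0 0}"

end

theory Submission
  imports Defs
begin

text \<open>
  The roots are realised in the lattice \<open>\<int>\<^sup>6 \<times> \<int>\<close> with the form \<open>\<Sum>a\<^sub>ib\<^sub>i - kl\<close>, as the vectors \<open>(a, k)\<close> of
  norm \<open>2\<close> with \<open>\<Sum>a\<^sub>i = 3k\<close>, where \<open>k\<close> is the degree: they are \<open>e\<^sub>i - e\<^sub>j\<close>, \<open>\<plusminus>e\<^sub>S\<close> with \<open>|S| = 3\<close>, and
  \<open>\<plusminus>(1, \<dots>, 1)\<close>.  The sign of a product or contraction of two ordered monomials is the value of the
  bimultiplicative function \<open>\<epsilon>(a, b) = (-1)^(\<Sum>\<^sub>j\<^sub><\<^sub>i a\<^sub>ib\<^sub>j)\<close>, which on the roots satisfies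
  \<open>\<epsilon>(a, b) \<epsilon>(b, a) = (-1)^(a, b)\<close> and \<open>\<epsilon>(a, a) = -1\<close>.  Hence, after a rescaling of the given basis by
  signs, the root vectors multiply by \<open>[e\<^sub>a, e\<^sub>b] = \<epsilon>(a, b) e\<^sub>a\<^sub>+\<^sub>b\<close> and \<open>[e\<^sub>a, e\<^sub>-\<^sub>a] = -h\<^sub>a\<close>, and for such a
  product the Jacobi identity, simplicity and the Chevalley relations are formal consequences of the
  properties of \<open>\<epsilon>\<close>.
\<close>

section \<open>Simply laced Lie algebras with a sign cocycle\<close>

text \<open>That \<open>E_alg\<close> is a Lie algebra is part of the claim, and the Jacobi
  identity, split by the five degrees, is a long list of identities in the exterior algebra. On
  three root vectors it involves only the integers \<open>ip\<close> and the signs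
  \<open>eps\<close>, and the exterior algebra is needed merely for brackets of two root elements.
  The condition that the entries of a add up to 3k reflects that degree k consists of forms of
  degree 3k. The term -kl of the form comes from \<open>h_zero\<close>: on a diagonal element of
  \<open>E_alg\<close> its coefficient is minus a third of the trace, and this shifts the weights of
  degree k. On the hyperplane so described the form is positive definite, whence (a, b) lies between
  -2 and 2 for roots, with the extreme values only for b = -a and b = a. This is what keeps the case
  analyses short.\<close>

text \<open>
  \<open>e a\<close> spans the root space of \<open>a\<close> and \<open>crd a\<close> is the coordinate along it, \<open>k a\<close> is the coroot of \<open>a\<close>,
  \<open>w a\<close> is \<open>a\<close> as a functional on \<open>H\<close>, and \<open>s\<close> enumerates the simple roots.
\<close>

locale simply_laced = vector_space scale
  for scale :: "complex \<Rightarrow> 'a::ab_group_add \<Rightarrow> 'a" +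
  fixes br :: "'a \<Rightarrow> 'a \<Rightarrow> 'a"
    and R :: "'r::ab_group_add set" and ip :: "'r \<Rightarrow> 'r \<Rightarrow> int" and eps :: "'r \<Rightarrow> 'r \<Rightarrow> complex"
    and H :: "'a set" and w :: "'r \<Rightarrow> 'a \<Rightarrow> complex" and k e :: "'r \<Rightarrow> 'a"
    and crd :: "'r \<Rightarrow> 'a \<Rightarrow> complex" and s :: "nat \<Rightarrow> 'r" and l :: nat
  assumes br_add: "br (x + y) z = br x z + br y z" "br x (y + z) = br x y + br x z"
    and br_scale: "br (scale c x) y = scale c (br x y)" "br x (scale c y) = scale c (br x y)"
    and finite_R: "finite R" and R_nonempty: "R \<noteq> {}"
    and ip_add: "ip (a + b) d = ip a d + ip b d" and ip_sym: "ip a b = ip b a"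
    and ip_self: "a \<in> R \<Longrightarrow> ip a a = 2"
    and R_minus: "a \<in> R \<Longrightarrow> - a \<in> R"
    and R_add: "a \<in> R \<Longrightarrow> b \<in> R \<Longrightarrow> ip a b = -1 \<Longrightarrow> a + b \<in> R"
    and ip_ge: "a \<in> R \<Longrightarrow> b \<in> R \<Longrightarrow> ip a b \<ge> -2"
    and ip_opp: "a \<in> R \<Longrightarrow> b \<in> R \<Longrightarrow> ip a b = -2 \<Longrightarrow> b = - a"
    and eps_add: "eps (a + b) d = eps a d * eps b d" "eps d (a + b) = eps d a * eps d b"
    and eps_sq: "eps a b * eps a b = 1"
    and eps_comm: "a \<in> R \<Longrightarrow> b \<in> R \<Longrightarrow> ip a b = 0 \<Longrightarrow> eps a b = eps b a"
    and eps_anticomm: "a \<in> R \<Longrightarrow> b \<in> R \<Longrightarrow> ip a b = -1 \<Longrightarrow> eps a b = - eps b a"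
    and eps_self: "a \<in> R \<Longrightarrow> eps a a = -1"
    and subspace_H: "subspace H"
    and br_HH: "x \<in> H \<Longrightarrow> y \<in> H \<Longrightarrow> br x y = 0"
    and br_H_e: "x \<in> H \<Longrightarrow> a \<in> R \<Longrightarrow> br x (e a) = scale (w a x) (e a)"
    and br_e_H: "x \<in> H \<Longrightarrow> a \<in> R \<Longrightarrow> br (e a) x = scale (- w a x) (e a)"
    and w_add: "x \<in> H \<Longrightarrow> y \<in> H \<Longrightarrow> w a (x + y) = w a x + w a y"
    and w_scale: "x \<in> H \<Longrightarrow> w a (scale c x) = c * w a x"
    and w_outside: "x \<notin> H \<Longrightarrow> w a x = 0"
    and w_add_root: "w (a + b) x = w a x + w b x"
    and k_in_H: "a \<in> R \<Longrightarrow> k a \<in> H"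
    and k_add: "k (a + b) = k a + k b"
    and w_k: "a \<in> R \<Longrightarrow> b \<in> R \<Longrightarrow> w b (k a) = of_int (ip a b)"
    and br_e_e: "a \<in> R \<Longrightarrow> b \<in> R \<Longrightarrow> ip a b = -1 \<Longrightarrow> br (e a) (e b) = scale (eps a b) (e (a + b))"
    and br_e_opp: "a \<in> R \<Longrightarrow> br (e a) (e (- a)) = - k a"
    and br_e_0: "a \<in> R \<Longrightarrow> b \<in> R \<Longrightarrow> ip a b \<ge> 0 \<Longrightarrow> br (e a) (e b) = 0"
    and crd_add: "crd a (x + y) = crd a x + crd a y"
    and crd_scale: "crd a (scale c x) = c * crd a x"
    and crd_e: "a \<in> R \<Longrightarrow> b \<in> R \<Longrightarrow> crd a (e b) = (if a = b then 1 else 0)"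
    and crd_H: "a \<in> R \<Longrightarrow> x \<in> H \<Longrightarrow> crd a x = 0"
    and inj_s: "inj_on s {1..l}" and s_in_R: "i \<in> {1..l} \<Longrightarrow> s i \<in> R"
    and span_k_s: "span (k ` s ` {1..l}) = H"
    and nondeg: "(\<And>j. j \<in> {1..l} \<Longrightarrow> (\<Sum>i\<in>{1..l}. (m i :: complex) * of_int (ip (s i) (s j))) = 0)
      \<Longrightarrow> i \<in> {1..l} \<Longrightarrow> m i = 0"
    and s_base: "a \<in> R \<Longrightarrow> \<exists>n :: nat \<Rightarrow> int.
      (\<forall>x. w a x = (\<Sum>i\<in>{1..l}. of_int (n i) * w (s i) x)) \<and>
      ((\<forall>i\<in>{1..l}. n i \<ge> 0) \<or> (\<forall>i\<in>{1..l}. n i \<le> 0))"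
    and irreducible: "P \<subseteq> R \<Longrightarrow> P \<noteq> {} \<Longrightarrow>
      (\<And>a b. a \<in> P \<Longrightarrow> b \<in> R \<Longrightarrow> ip a b \<noteq> 0 \<Longrightarrow> b \<in> P) \<Longrightarrow> P = R"
begin

definition gens :: "'a set" where
  "gens = H \<union> e ` R"

text \<open>The locale fixes no carrier: \<open>br\<close> is bilinear on the whole ambient space,
  whereas skew-symmetry and the Jacobi identity are derived on this span.\<close>

definition L :: "'a set" where
  "L = span gens"

lemma br_0 [simp]: "br 0 x = 0" "br x 0 = 0"
  using br_scale(1)[of 0 x x] br_scale(2)[of x 0 x] by simp_all

lemma br_minus [simp]: "br (- x) y = - br x y" "br x (- y) = - br x y"
  using br_add(1)[of x "- x" y] br_add(2)[of x y "- y"] by (simp_all add: eq_neg_iff_add_eq_0 add.commute)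

lemma br_sum: "br x (sum f A) = (\<Sum>a\<in>A. br x (f a))"
  by (induction A rule: infinite_finite_induct) (simp_all add: br_add)

lemma crd_0 [simp]: "crd a 0 = 0"
  using crd_scale[of a 0 0] by simp

lemma crd_sum: "crd a (sum f A) = (\<Sum>b\<in>A. crd a (f b))"
  by (induction A rule: infinite_finite_induct) (simp_all add: crd_add)

lemma ip_add_right: "ip c (a + b) = ip c a + ip c b"
  using ip_add[of a b c] by (simp add: ip_sym)

lemma ip_minus [simp]: "ip (- a) b = - ip a b" "ip b (- a) = - ip b a"
proof -
  have "ip 0 b = 0" using ip_add[of 0 0 b] by simp
  with ip_add[of a "- a" b] show "ip (- a) b = - ip a b" by simp
  thus "ip b (- a) = - ip b a" by (simp add: ip_sym)
qed

lemma ip_le: "a \<in> R \<Longrightarrow> b \<in> R \<Longrightarrow> ip a b \<le> 2"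
  using ip_ge[OF R_minus, of a b] by simp

lemma ip_eq2: "a \<in> R \<Longrightarrow> b \<in> R \<Longrightarrow> ip a b = 2 \<Longrightarrow> a = b"
  using ip_opp[OF R_minus, of a b] by simp

lemma eps_0 [simp]: "eps 0 a = 1" "eps a 0 = 1"
  using eps_add(1)[of 0 0 a] eps_add(2)[of a 0 0] eps_sq[of 0 a] eps_sq[of a 0] by simp_all

lemma eps_minus [simp]: "eps (- a) b = eps a b" "eps b (- a) = eps b a"
proof -
  have "eps a b * (eps a b * eps (- a) b) = eps a b" using eps_add(1)[of a "- a" b] by simp
  thus "eps (- a) b = eps a b" by (simp add: eps_sq flip: mult.assoc)
  have "eps b a * (eps b a * eps b (- a)) = eps b a" using eps_add(2)[of b a "- a"] by simp
  thus "eps b (- a) = eps b a" by (simp add: eps_sq flip: mult.assoc)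
qed

lemma ip_diff: "ip c (a - b) = ip c a - ip c b"
  using ip_add_right[of c a "- b"] by simp

lemma eps_diff: "eps c (a - b) = eps c a * eps c b"
  using eps_add(2)[of c a "- b"] by simp

lemma k_minus: "k (- a) = - k a"
proof -
  have "k 0 = 0" using k_add[of 0 0] by simp
  with k_add[of a "- a"] show ?thesis by (simp add: eq_neg_iff_add_eq_0 add.commute)
qed

lemma w_minus: "w (- a) = (\<lambda>x. - w a x)"
proof
  fix x
  have "w 0 x = 0" using w_add_root[of 0 0 x] by simp
  with w_add_root[of a "- a" x] show "w (- a) x = - w a x" by (simp add: eq_neg_iff_add_eq_0 add.commute)
qed

lemma br_k_e: "a \<in> R \<Longrightarrow> b \<in> R \<Longrightarrow> br (k a) (e b) = scale (of_int (ip a b)) (e b)"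
  and br_e_k: "a \<in> R \<Longrightarrow> b \<in> R \<Longrightarrow> br (e b) (k a) = scale (- of_int (ip a b)) (e b)"
  by (simp_all add: br_H_e br_e_H k_in_H w_k)

text \<open>For (a, b) = -2 this is oddness of \<open>k\<close>, for -1 it is anticommutation of
  \<open>eps\<close>, and otherwise both sides vanish.\<close>

lemma br_e_swap: "a \<in> R \<Longrightarrow> b \<in> R \<Longrightarrow> br (e a) (e b) = - br (e b) (e a)"
proof -
  assume R: "a \<in> R" "b \<in> R"
  consider "ip a b \<ge> 0" | "ip a b = -1" | "ip a b = -2" using ip_ge[OF R] by linarith
  thus ?thesis
  proof cases
    case 1
    thus ?thesis using br_e_0[of a b] br_e_0[of b a] R by (simp add: ip_sym)
  next
    case 2
    thus ?thesis using br_e_e[of a b] br_e_e[of b a] R eps_anticomm[of a b]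
      by (simp add: ip_sym[of b a] add.commute)
  next
    case 3
    thus ?thesis using ip_opp[OF R] br_e_opp[of a] br_e_opp[of "- a"] R R_minus[of a]
      by (simp add: k_minus)
  qed
qed

lemma br_swap:
  assumes "x \<in> L" "y \<in> L"
  shows "br x y = - br y x"
proof -
  have gen: "br x y + br y x = 0" if "x \<in> gens" "y \<in> gens" for x y
    using that by (auto simp: gens_def br_HH br_H_e br_e_H add_eq_0_iff intro: br_e_swap)
  have 1: "br x y + br y x = 0" if x: "x \<in> gens" and "y \<in> L" for x y
    using that(2) unfolding L_def
  proof (induction rule: span_induct_alt)
    case (step c z y)
    have "br x (scale c z + y) + br (scale c z + y) x = scale c (br x z + br z x) + (br x y + br y x)"
      by (simp only: br_add br_scale scale_right_distrib ac_simps)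
    with gen[OF x step(1)] step(2) show ?case by simp
  qed simp
  from assms(1) have "br x y + br y x = 0" unfolding L_def
  proof (induction rule: span_induct_alt)
    case (step c z x)
    have "br (scale c z + x) y + br y (scale c z + x) = scale c (br z y + br y z) + (br x y + br y x)"
      by (simp only: br_add br_scale scale_right_distrib ac_simps)
    with 1[OF step(1) assms(2)] step(2) show ?case by simp
  qed simp
  thus ?thesis by (simp add: eq_neg_iff_add_eq_0)
qed

section \<open>The Jacobi identity on root vectors and on their span\<close>

definition jacobiator :: "'a \<Rightarrow> 'a \<Rightarrow> 'a \<Rightarrow> 'a" where
  "jacobiator x y z = br x (br y z) + br y (br z x) + br z (br x y)"

lemma jacobiator_cyclic: "jacobiator x y z = jacobiator y z x"
  by (simp add: jacobiator_def ac_simps)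

text \<open>The bracket of \<open>e b\<close> and \<open>e (- b)\<close> acts on \<open>e a\<close>
  by (a, b) up to sign, and this must be balanced by the paths a -> a + b -> a and a -> a - b -> a.
  If (a, b) is -1 or 1, exactly one of the two paths survives, and \<open>eps b b = -1\<close> gives
  it the right sign; if (a, b) = 0, none does.\<close>

lemma jacobiator_opp:
  assumes R: "a \<in> R" "b \<in> R"
  shows "jacobiator (e a) (e b) (e (- b)) = 0"
proof -
  note Rm = R_minus[OF R(1)] R_minus[OF R(2)]
  have opp: "br (e a) (br (e b) (e (- b))) = scale (of_int (ip a b)) (e a)"
    using R by (simp add: br_e_opp br_e_k ip_sym)
  consider "ip a b = 0" | "ip a b = -1" | "ip a b = 1" | "ip a b = -2" | "ip a b = 2"
    using ip_ge[OF R] ip_le[OF R] by linarith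
  thus ?thesis
  proof cases
    case 1
    thus ?thesis using R Rm br_e_0[of a b] br_e_0[of "- b" a] opp
      by (simp add: jacobiator_def ip_sym)
  next
    case 2
    have "br (e (- b)) (br (e a) (e b)) = scale (eps a b * eps b a * eps b b) (e a)"
      using R Rm 2 R_add[of a b] br_e_e[of a b] br_e_e[of "- b" "a + b"]
      by (simp add: br_scale ip_add_right ip_self ip_sym[of b a] eps_add mult.assoc)
    also have "eps a b * eps b a * eps b b = 1"
      using eps_anticomm[OF R 2] eps_self[OF R(2)] eps_sq[of b a] by simp
    finally show ?thesis using R Rm 2 br_e_0[of "- b" a] opp by (simp add: jacobiator_def ip_sym[of b a])
  next
    case 3
    have "br (e b) (br (e (- b)) (e a)) = scale (eps b a * eps b a * eps b b) (e a)"
      using R Rm 3 R_add[of "- b" a] br_e_e[of "- b" a] br_e_e[of b "- b + a"]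
      by (simp add: br_scale ip_diff ip_self ip_sym[of b a] eps_diff mult.assoc)
    also have "eps b a * eps b a * eps b b = -1"
      using eps_self[OF R(2)] eps_sq[of b a] by simp
    finally show ?thesis using R Rm 3 br_e_0[of a b] opp by (simp add: jacobiator_def)
  next
    case 4
    hence a: "a = - b" using ip_opp[OF R] by simp
    show ?thesis using br_e_swap[of b "- b"] R Rm br_e_0[of "- b" "- b"]
      by (simp add: jacobiator_def a ip_self)
  next
    case 5
    hence a: "a = b" using ip_eq2[OF R] by simp
    show ?thesis using br_e_swap[of b "- b"] R Rm br_e_0[of b b]
      by (simp add: jacobiator_def a ip_self)
  qed
qed

text \<open>If (b, c) = -1, then (a, b + c) = -2 forces a + b + c = 0; the three terms are coroots
  with a common sign, and these coroots add up to zero. If (b, c) = 0, the two surviving terms are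
  multiples of \<open>e (a + b + c)\<close> with opposite signs. If (b, c) is positive, every term
  vanishes.\<close>

lemma jacobiator_chain:
  assumes R: "a \<in> R" "b \<in> R" "c \<in> R" and ab: "ip a b = -1" and ac: "ip a c = -1"
    and bc: "ip b c \<noteq> -2"
  shows "jacobiator (e a) (e b) (e c) = 0"
proof -
  have sym: "ip b a = -1" "ip c a = -1" "ip c b = ip b c" using ab ac ip_sym by simp_all
  have sums: "a + b \<in> R" "c + a \<in> R" using R_add R ab sym by blast+
  consider "ip b c = -1" | "ip b c = 0" | "ip b c \<ge> 1" using ip_ge[of b c] R bc by linarith
  thus ?thesis
  proof cases
    case 1
    have "b + c \<in> R" using R_add R 1 by blast
    hence "b + c = - a" using ip_opp[of a "b + c"] R ab ac by (simp add: ip_add_right)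
    hence c: "c = - (a + b)" by (metis add.commute add_diff_cancel_left' diff_conv_add_uminus minus_add)
    have "br (e b) (e c) = scale (eps a b) (e (- a))"
      using br_e_e[of b c] R 1 eps_self[of b] eps_anticomm[OF R(1,2) ab]
      by (simp add: \<open>b + c = - a\<close>) (simp add: c eps_add del: minus_add_distrib)
    moreover have "br (e c) (e a) = scale (eps a b) (e (- b))"
      using br_e_e[of c a] R sym eps_self[of a] eps_anticomm[OF R(1,2) ab]
      by (simp add: c eps_add del: minus_add_distrib)
    moreover have "br (e a) (e b) = scale (eps a b) (e (- c))"
      using br_e_e[of a b] R ab by (simp add: c del: minus_add_distrib)
    ultimately have "jacobiator (e a) (e b) (e c) = scale (eps a b) (- (k a + k b + k c))"
      using R by (simp add: jacobiator_def br_scale br_e_opp scale_right_distrib scale_right_diff_distrib)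
    also have "k a + k b + k c = 0" by (simp add: c k_minus k_add del: minus_add_distrib)
    finally show ?thesis by simp
  next
    case 2
    have "br (e b) (br (e c) (e a)) = scale (eps c a * (eps b c * eps b a)) (e (a + b + c))"
      using R sums 2 sym br_e_e[of c a] br_e_e[of b "c + a"]
      by (simp add: br_scale ip_add_right eps_add ac_simps)
    moreover have "br (e c) (br (e a) (e b)) = scale (eps a b * (eps c a * eps c b)) (e (a + b + c))"
      using R sums 2 sym ab br_e_e[of a b] br_e_e[of c "a + b"]
      by (simp add: br_scale ip_add_right eps_add ac_simps)
    ultimately show ?thesis
      using br_e_0[of b c] R 2 eps_comm[of b c] eps_anticomm[OF R(1,2) ab]
      by (simp add: jacobiator_def flip: scale_left_distrib)
  next
    case 3
    thus ?thesis using R sums sym ab br_e_e[of a b] br_e_e[of c a] br_e_0[of b c]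
        br_e_0[of b "c + a"] br_e_0[of c "a + b"]
      by (simp add: jacobiator_def br_scale ip_add_right)
  qed
qed

text \<open>Disposes of the triples without opposite pairs in which at most one pair has product -1,
  and of most values of the square of \<open>ad (e (- a))\<close> in the proof of
  simplicity.\<close>

lemma br_br_e_0:
  assumes "a \<in> R" "b \<in> R" "c \<in> R" "ip b c \<noteq> -2" "ip b c = -1 \<Longrightarrow> ip a b + ip a c \<ge> 0"
  shows "br (e a) (br (e b) (e c)) = 0"
proof (cases "ip b c = -1")
  case True
  thus ?thesis using assms R_add[of b c] br_e_e[of b c] br_e_0[of a "b + c"]
    by (simp add: br_scale ip_add_right)
next
  case False
  hence "ip b c \<ge> 0" using ip_ge[of b c] assms by linarith
  thus ?thesis using assms br_e_0 by simp
qed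

lemma jacobiator_eee:
  assumes R: "a \<in> R" "b \<in> R" "c \<in> R"
  shows "jacobiator (e a) (e b) (e c) = 0"
proof -
  \<comment> \<open>Three cases of an opposite pair; three cases where two pairs have product -1,
    settled by \<open>jacobiator_chain\<close> after a cyclic shift; and a last case with at most
    one product -1, where each term vanishes separately.\<close>
  consider "ip b c = -2" | "ip c a = -2" | "ip a b = -2"
    | "ip a b \<noteq> -2" "ip b c \<noteq> -2" "ip c a \<noteq> -2" "ip a b = -1" "ip c a = -1"
    | "ip a b \<noteq> -2" "ip b c \<noteq> -2" "ip c a \<noteq> -2" "ip b c = -1" "ip a b = -1"
    | "ip a b \<noteq> -2" "ip b c \<noteq> -2" "ip c a \<noteq> -2" "ip c a = -1" "ip b c = -1"
    | "ip a b \<noteq> -2" "ip b c \<noteq> -2" "ip c a \<noteq> -2"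
      "ip b c = -1 \<longrightarrow> ip a b \<ge> 0 \<and> ip c a \<ge> 0" "ip c a = -1 \<longrightarrow> ip a b \<ge> 0 \<and> ip b c \<ge> 0"
      "ip a b = -1 \<longrightarrow> ip b c \<ge> 0 \<and> ip c a \<ge> 0"
    using ip_ge[of a b] ip_ge[of b c] ip_ge[of c a] R by linarith
  thus ?thesis
  proof cases
    case 1
    thus ?thesis using jacobiator_opp[of a b] ip_opp[of b c] R by simp
  next
    case 2
    hence "jacobiator (e b) (e c) (e a) = 0" using jacobiator_opp[of b c] ip_opp[of c a] R by simp
    thus ?thesis by (metis jacobiator_cyclic)
  next
    case 3
    hence "jacobiator (e c) (e a) (e b) = 0" using jacobiator_opp[of c a] ip_opp[of a b] R by simp
    thus ?thesis by (metis jacobiator_cyclic)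
  next
    case 4
    thus ?thesis using jacobiator_chain[of a b c] R by (simp add: ip_sym)
  next
    case 5
    hence "jacobiator (e b) (e c) (e a) = 0" using jacobiator_chain[of b c a] R by (simp add: ip_sym)
    thus ?thesis by (metis jacobiator_cyclic)
  next
    case 6
    hence "jacobiator (e c) (e a) (e b) = 0" using jacobiator_chain[of c a b] R by (simp add: ip_sym)
    thus ?thesis by (metis jacobiator_cyclic)
  next
    case 7
    hence "ip b c = -1 \<Longrightarrow> ip a b + ip a c \<ge> 0" "ip c a = -1 \<Longrightarrow> ip b c + ip b a \<ge> 0"
      "ip a b = -1 \<Longrightarrow> ip c a + ip c b \<ge> 0"
      by (auto simp: ip_sym[of c a] ip_sym[of b a] ip_sym[of c b])
    with 7 show ?thesis using R by (simp add: jacobiator_def br_br_e_0)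
  qed
qed

text \<open>The bracket has weight a + b even where it vanishes or lies in \<open>H\<close>. In this
  uniform form it is the Jacobi identity for one element of \<open>H\<close> and two root
  vectors.\<close>

lemma w_br_weight:
  assumes "x \<in> H" "a \<in> R" "b \<in> R"
  shows "br x (br (e a) (e b)) = scale (w a x + w b x) (br (e a) (e b))"
proof -
  consider "ip a b \<ge> 0" | "ip a b = -1" | "ip a b = -2" using ip_ge[of a b] assms by linarith
  thus ?thesis
  proof cases
    case 1
    thus ?thesis using assms by (simp add: br_e_0)
  next
    case 2
    thus ?thesis using assms by (simp add: br_e_e R_add br_scale br_H_e w_add_root mult.commute)
  next
    case 3
    hence "b = - a" using assms ip_opp by simp
    thus ?thesis using assms by (simp add: br_e_opp br_HH k_in_H w_minus)
  qed
qed

lemma jacobiator_gen: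
  assumes "x \<in> gens" "y \<in> gens" "z \<in> gens"
  shows "jacobiator x y z = 0"
proof -
  have hhe: "jacobiator x y (e a) = 0" if "x \<in> H" "y \<in> H" "a \<in> R" for x y a
    using that by (simp add: jacobiator_def br_HH br_H_e br_e_H br_scale mult.commute)
  have hee: "jacobiator x (e a) (e b) = 0" if "x \<in> H" "a \<in> R" "b \<in> R" for x a b
    using that br_e_swap[of b a]
    by (simp add: jacobiator_def w_br_weight br_H_e br_e_H br_scale scale_left_distrib)
  show ?thesis
    using assms unfolding gens_def
  proof (elim UnE imageE; hypsubst?)
    assume "x \<in> H" "y \<in> H" "z \<in> H" thus ?thesis by (simp add: jacobiator_def br_HH)
  next
    fix a assume "x \<in> H" "y \<in> H" "a \<in> R" thus "jacobiator x y (e a) = 0" by (rule hhe)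
  next
    fix a assume "x \<in> H" "z \<in> H" "a \<in> R" thus "jacobiator x (e a) z = 0"
      using hhe[of z x a] jacobiator_cyclic by metis
  next
    fix a b assume "x \<in> H" "a \<in> R" "b \<in> R" thus "jacobiator x (e a) (e b) = 0" by (simp add: hee)
  next
    fix a assume "y \<in> H" "z \<in> H" "a \<in> R" thus "jacobiator (e a) y z = 0"
      using hhe[of y z a] jacobiator_cyclic by metis
  next
    fix a b assume "y \<in> H" "a \<in> R" "b \<in> R" thus "jacobiator (e a) y (e b) = 0"
      using hee[of y b a] jacobiator_cyclic by metis
  next
    fix a b assume "z \<in> H" "a \<in> R" "b \<in> R" thus "jacobiator (e a) (e b) z = 0"
      using hee[of z a b] jacobiator_cyclic by metis
  next
    fix a b c assume "a \<in> R" "b \<in> R" "c \<in> R" thus "jacobiator (e a) (e b) (e c) = 0" by (rule jacobiator_eee)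
  qed
qed

text \<open>Linearity in the first slot is enough, because cyclic invariance brings each of the
  three arguments there.\<close>

lemma jacobiator_linear:
  "jacobiator (scale c x + y) z t = scale c (jacobiator x z t) + jacobiator y z t" "jacobiator 0 z t = 0"
  by (simp_all add: jacobiator_def br_add br_scale scale_right_distrib ac_simps)

lemma jacobiator_zero:
  assumes "x \<in> L" "y \<in> L" "z \<in> L"
  shows "jacobiator x y z = 0"
proof -
  have 1: "jacobiator x y z = 0" if "x \<in> L" "y \<in> gens" "z \<in> gens" for x y z
    using that(1) unfolding L_def
    by (induction rule: span_induct_alt) (simp_all add: jacobiator_linear jacobiator_gen that)
  have 2: "jacobiator x y z = 0" if x: "x \<in> L" "y \<in> L" "z \<in> gens" for x y z
  proof -
    from x(2) have "jacobiator y z x = 0" unfolding L_def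
      by (induction rule: span_induct_alt)
        (simp_all add: jacobiator_linear, metis 1[OF x(1) _ x(3)] jacobiator_cyclic scale_zero_right add_0)
    thus ?thesis by (simp add: jacobiator_cyclic[of x])
  qed
  from assms(3) have "jacobiator z x y = 0" unfolding L_def
    by (induction rule: span_induct_alt)
      (simp_all add: jacobiator_linear, metis 2[OF assms(1,2)] jacobiator_cyclic scale_zero_right add_0)
  thus ?thesis by (simp add: jacobiator_cyclic[of z])
qed

section \<open>The span as a finite-dimensional Lie algebra\<close>

lemma subspace_L: "subspace L"
  by (simp add: L_def)

lemma H_le_L: "H \<subseteq> L" and e_in_L: "a \<in> R \<Longrightarrow> e a \<in> L"
  by (auto simp: L_def gens_def intro: span_base)

lemma br_e_e_in_L: "a \<in> R \<Longrightarrow> b \<in> R \<Longrightarrow> br (e a) (e b) \<in> L"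
proof -
  assume R: "a \<in> R" "b \<in> R"
  consider "ip a b \<ge> 0" | "ip a b = -1" | "ip a b = -2" using ip_ge[of a b] R by linarith
  thus ?thesis
  proof cases
    case 1
    thus ?thesis using R subspace_L by (simp add: br_e_0 subspace_0)
  next
    case 2
    thus ?thesis using R subspace_L e_in_L R_add by (simp add: br_e_e subspace_scale)
  next
    case 3
    hence "b = - a" using R ip_opp by simp
    thus ?thesis using R subspace_L H_le_L k_in_H by (auto simp: br_e_opp intro: subspace_neg)
  qed
qed

lemma br_in_L: "x \<in> L \<Longrightarrow> y \<in> L \<Longrightarrow> br x y \<in> L"
proof -
  assume x: "x \<in> L" and y: "y \<in> L"
  have gen: "br x y \<in> L" if "x \<in> gens" "y \<in> gens" for x y
    using that subspace_L e_in_L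
    by (auto simp: gens_def br_HH br_H_e br_e_H subspace_0 intro!: subspace_scale subspace_neg br_e_e_in_L)
  have 1: "br x y \<in> L" if x: "x \<in> gens" and "y \<in> L" for x y
    using that(2) unfolding L_def
    by (induction rule: span_induct_alt)
      (use gen[OF x] in \<open>auto simp: br_add br_scale span_zero L_def intro!: span_add span_scale\<close>)
  from x show ?thesis unfolding L_def
    by (induction rule: span_induct_alt)
      (use 1[OF _ y] in \<open>auto simp: br_add br_scale span_zero L_def intro!: span_add span_scale\<close>)
qed

lemma L_eq_span: "L = span (k ` s ` {1..l} \<union> e ` R)"
  unfolding L_def gens_def span_Un span_k_s using subspace_H by (simp add: span_eq_iff[THEN iffD2])

lemma findim: "findim_lie_algebra scale L br"
proof unfold_locales
  show "\<exists>B. finite B \<and> span B = L"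
    using finite_R by (intro exI[of _ "k ` s ` {1..l} \<union> e ` R"]) (simp add: L_eq_span)
  fix x assume "x \<in> L"
  hence "br x x = - br x x" by (intro br_swap)
  hence "br x x + br x x = 0" by (metis add.right_inverse)
  hence "scale 2 (br x x) = 0" using scale_left_distrib[of 1 1 "br x x"] by simp
  thus "br x x = 0" by (simp add: scale_eq_0_iff)
next
  fix x y z assume "x \<in> L" "y \<in> L" "z \<in> L"
  thus "br x (br y z) + br y (br z x) + br z (br x y) = 0" using jacobiator_zero jacobiator_def by simp
qed (simp_all add: subspace_L br_in_L br_add br_scale)

sublocale lie: findim_lie_algebra scale L br
  by (rule findim)


section \<open>The root space decomposition\<close>

text \<open>The \<open>H\<close>-component in the root space decomposition. The splitting
  \<open>decomp\<close> is valid for every x by construction; the content is that this part lies in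
  \<open>H\<close> when x is in \<open>L\<close>.\<close>

definition H_part :: "'a \<Rightarrow> 'a" where
  "H_part x = x - (\<Sum>a\<in>R. scale (crd a x) (e a))"

lemma H_part_in_H:
  assumes "x \<in> L"
  shows "H_part x \<in> H"
proof -
  have gen: "H_part x \<in> H" if "x \<in> gens" for x
  proof -
    have "(\<Sum>b\<in>R. scale (crd b (e a)) (e b)) = e a" if "a \<in> R" for a
    proof -
      have "(\<Sum>b\<in>R. scale (crd b (e a)) (e b)) = (\<Sum>b\<in>R. if b = a then e b else 0)"
        using that by (intro sum.cong) (auto simp: crd_e)
      thus ?thesis using that finite_R by simp
    qed
    with that show ?thesis using subspace_H
      by (auto simp: gens_def H_part_def crd_H subspace_0)
  qed
  from assms show ?thesis unfolding L_def
  proof (induction rule: span_induct_alt)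
    case base
    show ?case using subspace_H by (simp add: H_part_def subspace_0)
  next
    case (step c x y)
    have "H_part (scale c x + y) = scale c (H_part x) + H_part y"
      by (simp add: H_part_def crd_add crd_scale scale_left_distrib sum.distrib scale_right_diff_distrib
          scale_sum_right)
    thus ?case using gen[OF step(1)] step(2) subspace_H by (simp add: subspace_add subspace_scale)
  qed
qed

lemma decomp: "x = H_part x + (\<Sum>a\<in>R. scale (crd a x) (e a))"
  by (simp add: H_part_def)

lemma br_H:
  assumes "h \<in> H" "x \<in> L"
  shows "br h x = (\<Sum>a\<in>R. scale (w a h * crd a x) (e a))"
proof -
  have "br h x = br h (H_part x) + (\<Sum>a\<in>R. br h (scale (crd a x) (e a)))"
    by (subst decomp[of x]) (simp add: br_add br_sum)
  also have "\<dots> = (\<Sum>a\<in>R. scale (w a h * crd a x) (e a))"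
    using assms H_part_in_H by (simp add: br_HH br_scale br_H_e mult.commute)
  finally show ?thesis .
qed

lemma crd_comb: "b \<in> R \<Longrightarrow> crd b (\<Sum>a\<in>R. scale (f a) (e a)) = f b"
proof -
  assume b: "b \<in> R"
  have "crd b (\<Sum>a\<in>R. scale (f a) (e a)) = (\<Sum>a\<in>R. if a = b then f a else 0)"
    unfolding crd_sum using b by (intro sum.cong) (auto simp: crd_scale crd_e)
  thus ?thesis using b finite_R by simp
qed

lemma crd_br_H: "h \<in> H \<Longrightarrow> x \<in> L \<Longrightarrow> b \<in> R \<Longrightarrow> crd b (br h x) = w b h * crd b x"
  by (simp add: br_H crd_comb)

lemma H_eqI: "x \<in> L \<Longrightarrow> (\<And>a. a \<in> R \<Longrightarrow> crd a x = 0) \<Longrightarrow> x \<in> H"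
  using H_part_in_H[of x] by (simp add: H_part_def)

lemma e_nonzero: "a \<in> R \<Longrightarrow> e a \<noteq> 0"
  using crd_e[of a a] by auto

lemma k_nonzero: "a \<in> R \<Longrightarrow> k a \<noteq> 0"
proof
  assume "a \<in> R" "k a = 0"
  moreover have "w a 0 = 0" using w_scale[of 0 a 0] subspace_0[OF subspace_H] by simp
  ultimately show False using w_k[of a a] by (simp add: ip_self)
qed

lemma w_inj: "inj_on w R"
proof (rule inj_onI)
  fix a b assume R: "a \<in> R" "b \<in> R" and "w a = w b"
  hence "w b (k a) = 2" using w_k[of a a] by (simp add: ip_self)
  thus "a = b" using R ip_eq2 w_k[of a b] by (metis of_int_eq_iff of_int_numeral)
qed

lemma inj_k_s: "inj_on (\<lambda>i. k (s i)) {1..l}"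
proof (rule inj_onI)
  fix i j assume ij: "i \<in> {1..l}" "j \<in> {1..l}" "k (s i) = k (s j)"
  hence "ip (s i) (s j) = 2"
    using w_k[of "s i" "s j"] w_k[of "s j" "s j"] s_in_R[of i] s_in_R[of j]
    by (metis ip_self of_int_eq_iff)
  thus "i = j" using ip_eq2 s_in_R ij inj_onD[OF inj_s] by blast
qed

lemma subalgebra_H: "lie.subalgebra H"
  unfolding lie.subalgebra_def using subspace_H H_le_L by (auto simp: br_HH subspace_0)

text \<open>\<open>H\<close> is abelian, so one step of the descending series reaches zero. If x
  normalizes \<open>H\<close>, then [k a, x] lies in \<open>H\<close>, and its coordinate along
  \<open>e a\<close>, which is twice that of x, must vanish for every root a.\<close>

lemma cartan_H: "lie.cartan_subalgebra H"
  unfolding lie.cartan_subalgebra_def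
proof (intro conjI)
  have "{br x y |x y. x \<in> H \<and> y \<in> H} = {0}"
    using subspace_0[OF subspace_H] by (auto simp: br_HH intro!: exI[of _ 0])
  hence "(lie.br_sets H ^^ 1) H = {0}" by (simp add: lie.br_sets_def)
  thus "lie.nilpotent H" unfolding lie.nilpotent_def by blast
  show "{x \<in> L. \<forall>h\<in>H. br x h \<in> H} = H"
  proof (intro equalityI subsetI)
    fix x assume "x \<in> {x \<in> L. \<forall>h\<in>H. br x h \<in> H}"
    hence x: "x \<in> L" and br: "\<And>h. h \<in> H \<Longrightarrow> br x h \<in> H" by auto
    show "x \<in> H"
    proof (rule H_eqI[OF x])
      fix a assume a: "a \<in> R"
      have "br (k a) x \<in> H"
        using br[OF k_in_H[OF a]] br_swap[OF x, of "k a"] k_in_H[OF a] H_le_L subspace_neg[OF subspace_H]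
        by (metis add.inverse_inverse subsetD)
      thus "crd a x = 0" using crd_br_H[OF k_in_H[OF a] x a] a by (simp add: crd_H w_k ip_self)
    qed
  next
    fix x assume "x \<in> H"
    thus "x \<in> {x \<in> L. \<forall>h\<in>H. br x h \<in> H}"
      using H_le_L subspace_0[OF subspace_H] by (auto simp: br_HH)
  qed
qed (rule subalgebra_H)

lemma w_in_dual: "w a \<in> lie.dual H"
  by (auto simp: lie.dual_def w_add w_scale w_outside)

text \<open>The single element \<open>k a\<close> separates a from all other roots and from
  \<open>H\<close>: its eigenvalue on \<open>e b\<close> is (a, b), which equals 2 only for b = a,
  and it kills \<open>H\<close>.\<close>

lemma root_space_w:
  assumes a: "a \<in> R"
  shows "lie.root_space H (w a) = range (\<lambda>c. scale c (e a))"
proof (intro equalityI subsetI)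
  fix x assume "x \<in> lie.root_space H (w a)"
  hence x: "x \<in> L" and br: "\<And>h. h \<in> H \<Longrightarrow> br h x = scale (w a h) x"
    by (auto simp: lie.root_space_def)
  have k2: "w a (k a) = 2" using a by (simp add: w_k ip_self)
  have "crd b x = 0" if b: "b \<in> R" "b \<noteq> a" for b
  proof -
    have "w b (k a) * crd b x = 2 * crd b x"
      using crd_br_H[OF k_in_H[OF a] x b(1)] br[OF k_in_H[OF a]] k2 by (simp add: crd_scale)
    moreover have "w b (k a) \<noteq> 2" using w_k[OF a b(1)] ip_eq2[OF a b(1)] b(2)
      by (metis of_int_eq_iff of_int_numeral)
    ultimately show ?thesis by simp
  qed
  hence "(\<Sum>b\<in>R. scale (f b * crd b x) (e b)) = (\<Sum>b\<in>R. if b = a then scale (f b * crd b x) (e b) else 0)" for f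
    by (intro sum.cong) auto
  hence "br (k a) x = scale (2 * crd a x) (e a)"
    using a finite_R k2 by (simp add: br_H[OF k_in_H[OF a] x])
  hence "scale 2 x = scale 2 (scale (crd a x) (e a))" using br[OF k_in_H[OF a]] k2 by simp
  hence "x = scale (crd a x) (e a)" by (rule scale_left_imp_eq[of 2, rotated]) simp
  thus "x \<in> range (\<lambda>c. scale c (e a))" by blast
next
  fix x assume "x \<in> range (\<lambda>c. scale c (e a))"
  thus "x \<in> lie.root_space H (w a)"
    using a e_in_L subspace_L
    by (auto simp: lie.root_space_def br_scale br_H_e mult.commute subspace_scale)
qed

text \<open>A root vector of a nonzero functional has a nonzero coordinate at some a in
  \<open>R\<close>, since otherwise all of \<open>H\<close> kills it; comparing that coordinate
  shows that the functional agrees with \<open>w a\<close> on \<open>H\<close>. Off \<open>H\<close>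
  both are zero by convention.\<close>

lemma roots_eq: "lie.roots H = w ` R"
proof (intro equalityI subsetI)
  fix \<alpha> assume "\<alpha> \<in> lie.roots H"
  hence \<alpha>: "\<alpha> \<in> lie.dual H" "\<alpha> \<noteq> (\<lambda>_. 0)" "lie.root_space H \<alpha> \<noteq> {0}" by (auto simp: lie.roots_def)
  have "0 \<in> lie.root_space H \<alpha>" by (simp add: lie.root_space_def subspace_L subspace_0)
  with \<alpha>(3) obtain x where x: "x \<in> lie.root_space H \<alpha>" "x \<noteq> 0" by auto
  hence xL: "x \<in> L" and br: "\<And>h. h \<in> H \<Longrightarrow> br h x = scale (\<alpha> h) x" by (auto simp: lie.root_space_def)
  obtain h where h: "\<alpha> h \<noteq> 0" using \<alpha>(2) by auto
  have outside: "\<alpha> y = 0" if "y \<notin> H" for y using \<alpha>(1) that by (simp add: lie.dual_def)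
  hence hH: "h \<in> H" using h by auto
  have eq: "w a y * crd a x = \<alpha> y * crd a x" if "y \<in> H" "a \<in> R" for y a
    using crd_br_H[OF that(1) xL that(2)] br[OF that(1)] by (auto simp: crd_scale)
  have "\<exists>a\<in>R. crd a x \<noteq> 0"
  proof (rule ccontr)
    assume "\<not> ?thesis"
    hence "br h x = 0" by (simp add: br_H[OF hH xL])
    with br[OF hH] h x(2) show False by simp
  qed
  then obtain a where a: "a \<in> R" "crd a x \<noteq> 0" by blast
  have "\<alpha> y = w a y" for y
    using eq[of y a] a outside[of y] w_outside[of y a] by (cases "y \<in> H") auto
  thus "\<alpha> \<in> w ` R" using a by (auto simp: fun_eq_iff)
next
  fix \<alpha> assume "\<alpha> \<in> w ` R"
  then obtain a where a: "a \<in> R" "\<alpha> = w a" by blast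
  have "w a (k a) \<noteq> 0" using a by (simp add: w_k ip_self)
  hence "\<alpha> \<noteq> (\<lambda>_. 0)" using a by auto
  moreover have "e a \<in> lie.root_space H \<alpha>"
    unfolding a(2) root_space_w[OF a(1)] by (rule range_eqI[of _ _ 1]) simp
  hence "lie.root_space H \<alpha> \<noteq> {0}" using e_nonzero[OF a(1)] by auto
  ultimately show "\<alpha> \<in> lie.roots H" using a w_in_dual by (simp add: lie.roots_def)
qed

text \<open>The brackets of the two root lines fill the line through \<open>k a\<close>, whatever
  sign [e a, e (- a)] carries, and \<open>k a\<close> is the only point of this line where
  \<open>w a\<close> has the value 2.\<close>

lemma coroot_w:
  assumes a: "a \<in> R"
  shows "lie.coroot H (w a) = k a"
proof -
  define S where "S = lie.br_sets (lie.root_space H (w a)) (lie.root_space H (\<lambda>x. - w a x))"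
  have S_eq: "S = span {k a}"
  proof -
    have "S = span {br x y |x y. x \<in> range (\<lambda>c. scale c (e a)) \<and> y \<in> range (\<lambda>c. scale c (e (- a)))}"
      by (simp add: S_def lie.br_sets_def root_space_w[OF a] flip: w_minus)
        (simp add: root_space_w[OF R_minus[OF a]])
    also have "{br x y |x y. x \<in> range (\<lambda>c. scale c (e a)) \<and> y \<in> range (\<lambda>c. scale c (e (- a)))}
        = span {k a}"
    proof (intro equalityI subsetI)
      fix z assume "z \<in> span {k a}"
      then obtain c where "z = scale c (k a)" by (auto simp: span_singleton)
      hence "z = br (scale (- c) (e a)) (scale 1 (e (- a)))" using a by (simp add: br_scale br_e_opp)
      thus "z \<in> {br x y |x y. x \<in> range (\<lambda>c. scale c (e a)) \<and> y \<in> range (\<lambda>c. scale c (e (- a)))}"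
        by blast
    next
      fix z assume "z \<in> {br x y |x y. x \<in> range (\<lambda>c. scale c (e a)) \<and> y \<in> range (\<lambda>c. scale c (e (- a)))}"
      then obtain c d where "z = br (scale c (e a)) (scale d (e (- a)))" by blast
      hence "z = scale (- (c * d)) (k a)" using a by (simp add: br_scale br_e_opp mult.commute)
      thus "z \<in> span {k a}" by (simp add: span_scale span_base del: scale_minus_left)
    qed
    finally show ?thesis by (simp add: span_span)
  qed
  have "(THE h. h \<in> S \<and> w a h = 2) = k a"
  proof (rule the_equality)
    fix h assume h: "h \<in> S \<and> w a h = 2"
    then obtain c where "h = scale c (k a)" unfolding S_eq by (auto simp: span_singleton)
    moreover from this have "c = 1" using h a by (simp add: w_scale k_in_H w_k ip_self)
    ultimately show "h = k a" by simp
  qed (use a in \<open>simp add: S_eq span_base w_k ip_self\<close>)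
  thus ?thesis by (simp add: lie.coroot_def S_def)
qed

section \<open>The base, the Cartan matrix and simplicity\<close>

lemma s_base_independent:
  assumes "\<And>x. (\<Sum>i\<in>{1..l}. m i * w (s i) x) = 0" "i \<in> {1..l}"
  shows "m i = 0"
proof (rule nondeg[OF _ assms(2)])
  fix j assume j: "j \<in> {1..l}"
  have "(\<Sum>i\<in>{1..l}. m i * of_int (ip (s i) (s j))) = (\<Sum>i\<in>{1..l}. m i * w (s i) (k (s j)))"
    using j s_in_R by (intro sum.cong) (auto simp: w_k ip_sym)
  thus "(\<Sum>i\<in>{1..l}. m i * of_int (ip (s i) (s j))) = 0" using assms(1) by simp
qed

lemma inj_w_s: "inj_on (\<lambda>i. w (s i)) {1..l}"
  using inj_s s_in_R w_inj unfolding inj_on_def by blast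

lemma root_base_s: "lie.root_base H ((\<lambda>i. w (s i)) ` {1..l})"
  unfolding lie.root_base_def roots_eq
proof (intro conjI)
  note reindex = sum.reindex[OF inj_w_s, unfolded o_def]
  show "\<forall>c. (\<forall>h. (\<Sum>\<alpha>\<in>(\<lambda>i. w (s i)) ` {1..l}. c \<alpha> * \<alpha> h) = 0) \<longrightarrow>
      (\<forall>\<alpha>\<in>(\<lambda>i. w (s i)) ` {1..l}. c \<alpha> = 0)"
  proof (intro allI impI ballI)
    fix c \<alpha> assume "\<forall>h. (\<Sum>\<alpha>\<in>(\<lambda>i. w (s i)) ` {1..l}. c \<alpha> * \<alpha> h) = 0"
      and \<alpha>: "\<alpha> \<in> (\<lambda>i. w (s i)) ` {1..l}"
    hence "(\<Sum>i\<in>{1..l}. c (w (s i)) * w (s i) h) = 0" for h by (simp only: reindex)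
    thus "c \<alpha> = 0" using s_base_independent[of "\<lambda>i. c (w (s i))"] \<alpha> by blast
  qed
  show "\<forall>\<beta>\<in>w ` R. \<exists>n :: ('a \<Rightarrow> complex) \<Rightarrow> int.
      (\<forall>h. \<beta> h = (\<Sum>\<alpha>\<in>(\<lambda>i. w (s i)) ` {1..l}. of_int (n \<alpha>) * \<alpha> h)) \<and>
      ((\<forall>\<alpha>\<in>(\<lambda>i. w (s i)) ` {1..l}. n \<alpha> \<ge> 0) \<or> (\<forall>\<alpha>\<in>(\<lambda>i. w (s i)) ` {1..l}. n \<alpha> \<le> 0))"
  proof
    fix \<beta> assume "\<beta> \<in> w ` R"
    then obtain n :: "nat \<Rightarrow> int" where
      n: "\<forall>x. \<beta> x = (\<Sum>i\<in>{1..l}. of_int (n i) * w (s i) x)"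
        "(\<forall>i\<in>{1..l}. n i \<ge> 0) \<or> (\<forall>i\<in>{1..l}. n i \<le> 0)"
      using s_base by blast
    show "\<exists>n :: ('a \<Rightarrow> complex) \<Rightarrow> int.
      (\<forall>h. \<beta> h = (\<Sum>\<alpha>\<in>(\<lambda>i. w (s i)) ` {1..l}. of_int (n \<alpha>) * \<alpha> h)) \<and>
      ((\<forall>\<alpha>\<in>(\<lambda>i. w (s i)) ` {1..l}. n \<alpha> \<ge> 0) \<or> (\<forall>\<alpha>\<in>(\<lambda>i. w (s i)) ` {1..l}. n \<alpha> \<le> 0))"
      \<comment> \<open>The coefficients \<open>n\<close> are indexed by positions, but
        \<open>root_base\<close> wants them indexed by functionals; injectivity of
        \<open>\<lambda>i. w (s i)\<close> allows the translation.\<close>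
      by (rule exI[of _ "n \<circ> the_inv_into {1..l} (\<lambda>i. w (s i))"])
        (use n in \<open>simp add: reindex the_inv_into_f_f[OF inj_w_s] del: One_nat_def\<close>)
  qed
qed (use s_in_R in auto)

theorem has_cartan_matrix:
  assumes "\<And>i j. i \<in> {1..l} \<Longrightarrow> j \<in> {1..l} \<Longrightarrow> ip (s i) (s j) = C i j"
  shows "lie.has_cartan_matrix l C"
  unfolding lie.has_cartan_matrix_def
proof (intro exI conjI ballI)
  fix i j assume "i \<in> {1..l}" "j \<in> {1..l}"
  thus "w (s i) (lie.coroot H (w (s j))) = of_int (C i j)"
    using assms s_in_R by (simp add: coroot_w w_k ip_sym)
qed (rule cartan_H inj_w_s root_base_s)+

text \<open>A nonzero ideal contains some \<open>e a\<close>: either an element with a nonzero root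
  coordinate is reduced to one by a squared adjoint action, or an element of \<open>H\<close> is
  bracketed with a root vector whose root does not vanish on it. From \<open>e a\<close> one gets
  \<open>k a\<close>, then \<open>e b\<close> for every b not orthogonal to a, and irreducibility
  spreads this to all roots.\<close>

theorem simple: "lie.simple_lie_algebra"
  unfolding lie.simple_lie_algebra_def
proof (intro conjI allI impI)
  obtain a where a: "a \<in> R" using R_nonempty by blast
  have "br (e a) (e (- a)) \<in> lie.br_sets L L"
    unfolding lie.br_sets_def using a R_minus e_in_L by (blast intro: span_base)
  thus "lie.br_sets L L \<noteq> {0}" using a k_nonzero by (auto simp: br_e_opp)
next
  fix I assume "lie.lie_ideal I"
  hence sub: "subspace I" and IL: "I \<subseteq> L" and ideal: "\<And>x y. x \<in> L \<Longrightarrow> y \<in> I \<Longrightarrow> br x y \<in> I"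
    by (auto simp: lie.lie_ideal_def)
  have unscale: "x \<in> I" if "scale c x \<in> I" "c \<noteq> 0" for c x
    using subspace_scale[OF sub that(1), of "inverse c"] that(2) by simp
  show "I = {0} \<or> I = L"
  proof (cases "I = {0}")
    case False
    then obtain x where x: "x \<in> I" "x \<noteq> 0" using subspace_0[OF sub] by auto
    hence xL: "x \<in> L" using IL by auto
    have "\<exists>a\<in>R. e a \<in> I"
    proof (cases "\<exists>a\<in>R. crd a x \<noteq> 0")
      case True
      then obtain a where a: "a \<in> R" "crd a x \<noteq> 0" by blast
      note am = R_minus[OF a(1)]
      \<comment> \<open>The square of \<open>ad (e (- a))\<close> isolates the component of \<open>x\<close> along \<open>e a\<close>.\<close>
      have ad: "br (e (- a)) (br (e (- a)) (e b)) = (if b = a then scale 2 (e (- a)) else 0)"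
        if b: "b \<in> R" for b
      proof (cases "b = a")
        case True
        thus ?thesis using a am br_e_opp[of "- a"] by (simp add: k_minus br_e_k ip_self)
      next
        case False
        have "ip b a \<noteq> 2" using ip_eq2[of b a] b a False by auto
        moreover have "ip b a \<le> 2" using ip_le a b by simp
        ultimately have "ip b a \<le> 1" by linarith
        thus ?thesis using False br_br_e_0[of "- a" "- a" b] am b a by (simp add: ip_self ip_sym)
      qed
      have "br (e (- a)) (br (e (- a)) (H_part x)) = 0"
        using H_part_in_H[OF xL] am br_e_0[of "- a" "- a"] a by (simp add: br_e_H br_scale ip_self)
      hence "br (e (- a)) (br (e (- a)) x)
          = (\<Sum>b\<in>R. scale (crd b x) (br (e (- a)) (br (e (- a)) (e b))))"
        by (subst decomp[of x]) (simp add: br_add br_sum br_scale)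
      also have "\<dots> = (\<Sum>b\<in>R. if b = a then scale (2 * crd a x) (e (- a)) else 0)"
        by (intro sum.cong) (auto simp: ad)
      also have "\<dots> = scale (2 * crd a x) (e (- a))" using a finite_R by simp
      finally have "e (- a) \<in> I"
        using ideal[OF e_in_L[OF am] ideal[OF e_in_L[OF am] x(1)]] unscale[of "2 * crd a x"] a(2)
        by simp
      thus ?thesis using am by blast
    next
      case False
      hence xH: "x \<in> H" using H_eqI[OF xL] by blast
      have "\<exists>a\<in>R. w a x \<noteq> 0"
      proof (rule ccontr)
        assume no: "\<not> ?thesis"
        have "x \<in> span ((\<lambda>i. k (s i)) ` {1..l})" using xH span_k_s by (simp add: image_image)
        then obtain u where "x = (\<Sum>v\<in>(\<lambda>i. k (s i)) ` {1..l}. scale (u v) v)"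
          by (auto simp: span_finite)
        hence m: "x = (\<Sum>i\<in>{1..l}. scale (m i) (k (s i)))" if "m = (\<lambda>i. u (k (s i)))" for m
          using that by (simp add: sum.reindex[OF inj_k_s] del: One_nat_def)
        define m where "m i = u (k (s i))" for i
        note m = m[of m, OF ext[OF m_def]]
        \<comment> \<open>\<open>w b\<close> is additive on \<open>H\<close> only, so the induction
          over index sets must also know that the partial sums stay in \<open>H\<close>.\<close>
        have wsum: "w b (\<Sum>i\<in>A. scale (m i) (k (s i))) = (\<Sum>i\<in>A. m i * of_int (ip (s i) b))"
          if b: "b \<in> R" and "A \<subseteq> {1..l}" for A b
        proof -
          from that(2) have "finite A" by (rule finite_subset) simp
          thus ?thesis using that(2)
          proof induction
            case empty
            show ?case using w_scale[of 0 b 0] subspace_0[OF subspace_H] by simp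
          next
            case (insert i A)
            have "(\<Sum>i\<in>A. scale (m i) (k (s i))) \<in> H"
              using insert.prems s_in_R k_in_H by (intro subspace_sum subspace_scale subspace_H) auto
            thus ?case using insert s_in_R[of i] b k_in_H[of "s i"] subspace_scale[OF subspace_H]
              by (simp add: w_add w_scale w_k)
          qed
        qed
        have "m i = 0" if "i \<in> {1..l}" for i
        proof (rule nondeg[OF _ that])
          fix j assume "j \<in> {1..l}"
          hence j: "s j \<in> R" by (rule s_in_R)
          hence "w (s j) x = 0" using no by blast
          thus "(\<Sum>i\<in>{1..l}. m i * of_int (ip (s i) (s j))) = 0"
            unfolding m using wsum[OF j order_refl] by simp
        qed
        hence "x = 0" unfolding m by simp
        with x(2) show False by simp
      qed
      then obtain a where a: "a \<in> R" "w a x \<noteq> 0" by blast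
      have "br (e a) x \<in> I" using ideal e_in_L a x by simp
      thus ?thesis using a xH unscale[of "- w a x" "e a"] by (auto simp: br_e_H)
    qed
    then obtain a where a: "a \<in> R" "e a \<in> I" by blast
    have kI: "k b \<in> I" if "b \<in> R" "e b \<in> I" for b
      using ideal[OF e_in_L[OF R_minus[OF that(1)]] that(2)] br_e_opp[OF R_minus[OF that(1)]]
      by (simp add: k_minus)
    have eI: "e c \<in> I" if "b \<in> R" "e b \<in> I" "c \<in> R" "ip b c \<noteq> 0" for b c
      using ideal[OF e_in_L[OF that(3)] kI[OF that(1,2)]] that unscale[of "- of_int (ip b c)" "e c"]
      by (auto simp: br_e_k)
    have "{b \<in> R. e b \<in> I} = R"
    proof (rule irreducible)
      show "{b \<in> R. e b \<in> I} \<noteq> {}" using a by blast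
      show "b \<in> {b \<in> R. e b \<in> I}" if "c \<in> {b \<in> R. e b \<in> I}" "b \<in> R" "ip c b \<noteq> 0" for b c
        using eI[of c b] that by blast
    qed blast
    hence eR: "e b \<in> I" if "b \<in> R" for b using that by blast
    have "L \<subseteq> I" unfolding L_eq_span
      by (rule span_minimal[OF _ sub]) (use eR kI s_in_R in auto)
    thus ?thesis using IL by blast
  qed simp
qed

section \<open>The Chevalley basis\<close>

lemma independent_basis:
  assumes f: "\<And>a. a \<in> R \<Longrightarrow> \<eta> a \<noteq> 0"
  shows "independent (k ` s ` {1..l} \<union> (\<lambda>a. scale (\<eta> a) (e a)) ` R)" (is "independent (?K \<union> ?E)")
proof (rule independent_if_scalars_zero)
  show "finite (?K \<union> ?E)" using finite_R by simp
  have KH: "?K \<subseteq> H" using s_in_R k_in_H by auto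
  have crdE: "crd a (scale (\<eta> b) (e b)) = (if a = b then \<eta> b else 0)" if "a \<in> R" "b \<in> R" for a b
    using that by (simp add: crd_scale crd_e)
  have inj_e: "inj_on (\<lambda>a. scale (\<eta> a) (e a)) R"
  proof (rule inj_onI)
    fix a b assume R: "a \<in> R" "b \<in> R" "scale (\<eta> a) (e a) = scale (\<eta> b) (e b)"
    have "(if a = a then \<eta> a else 0) = (if a = b then \<eta> b else 0)"
      using crdE[OF R(1,1)] crdE[OF R(1,2)] unfolding R(3) by (rule trans[OF sym])
    thus "a = b" using f[OF R(1)] by (simp split: if_splits)
  qed
  have disj: "?K \<inter> ?E = {}"
  proof (rule equals0I)
    fix x assume x: "x \<in> ?K \<inter> ?E"
    then obtain b where b: "b \<in> R" "x = scale (\<eta> b) (e b)" by blast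
    have "x \<in> H" using x KH by blast
    thus False using crd_H[OF b(1), of x] crdE[OF b(1,1)] f[OF b(1)] b(2) by simp
  qed
  fix u x assume zero: "(\<Sum>x\<in>?K \<union> ?E. scale (u x) x) = 0" and x: "x \<in> ?K \<union> ?E"
  have K: "(\<Sum>x\<in>?K. scale (u x) x) = (\<Sum>i\<in>{1..l}. scale (u (k (s i))) (k (s i)))"
    by (simp add: image_image sum.reindex[OF inj_k_s] del: One_nat_def)
  have E: "(\<Sum>x\<in>?E. scale (u x) x)
      = (\<Sum>a\<in>R. scale (u (scale (\<eta> a) (e a)) * \<eta> a) (e a))"
    by (simp add: sum.reindex[OF inj_e])
  have sum0: "(\<Sum>x\<in>?K. scale (u x) x) + (\<Sum>x\<in>?E. scale (u x) x) = 0"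
    using zero disj finite_R by (simp add: sum.union_disjoint)
  have KsumH: "(\<Sum>x\<in>?K. scale (u x) x) \<in> H"
    using KH by (intro subspace_sum[OF subspace_H] subspace_scale[OF subspace_H]) auto
  have uE: "u (scale (\<eta> a) (e a)) = 0" if a: "a \<in> R" for a
  proof -
    have "crd a ((\<Sum>x\<in>?K. scale (u x) x) + (\<Sum>x\<in>?E. scale (u x) x)) = 0" by (simp only: sum0 crd_0)
    hence "u (scale (\<eta> a) (e a)) * \<eta> a = 0"
      unfolding crd_add crd_H[OF a KsumH] E crd_comb[OF a] by simp
    thus ?thesis using f[OF a] by simp
  qed
  have K0: "(\<Sum>i\<in>{1..l}. scale (u (k (s i))) (k (s i))) = 0"
    using sum0 unfolding E K by (simp add: uE)
  have uK: "u (k (s i)) = 0" if "i \<in> {1..l}" for i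
  proof (rule nondeg[OF _ that])
    fix j assume j: "j \<in> {1..l}"
    \<comment> \<open>With the root part gone, bracketing the relation among coroots with a simple
      root vector turns it into a linear system whose matrix is that of \<open>ip\<close> on the
      simple roots.\<close>
    have "br (\<Sum>i\<in>{1..l}. scale (u (k (s i))) (k (s i))) (e (s j)) = 0" by (simp only: K0 br_0)
    moreover have "br (sum g A) y = (\<Sum>i\<in>A. br (g i) y)" for g :: "nat \<Rightarrow> 'a" and A y
      by (induction A rule: infinite_finite_induct) (simp_all add: br_add)
    ultimately have "scale (\<Sum>i\<in>{1..l}. u (k (s i)) * of_int (ip (s i) (s j))) (e (s j)) = 0"
      using j s_in_R by (simp add: br_scale br_k_e scale_sum_left)
    thus "(\<Sum>i\<in>{1..l}. u (k (s i)) * of_int (ip (s i) (s j))) = 0"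
      using e_nonzero[OF s_in_R[OF j]] by (simp only: scale_eq_0_iff) simp
  qed
  show "u x = 0" using x uE uK by auto
qed

text \<open>As \<open>\<eta> a * \<eta> (- a) = -1\<close>, the rescaling turns [e a, e (- a)] = -k
  a into +k a. The structure constant becomes
  \<open>\<eta> a * \<eta> b * eps a b * \<eta> (a + b)\<close>; passing to -a and -b leaves
  \<open>eps\<close> fixed and changes three signs, which is the relation c(-a, -b) = -c(a,
  b).\<close>

theorem chevalley_basis:
  assumes \<eta>: "\<And>a. a \<in> R \<Longrightarrow> \<eta> a * \<eta> a = 1" and \<eta>_minus: "\<And>a. a \<in> R \<Longrightarrow> \<eta> (- a) = - \<eta> a"
  shows "lie.chevalley_basis (k ` s ` {1..l} \<union> (\<lambda>a. scale (\<eta> a) (e a)) ` R)"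
  unfolding lie.chevalley_basis_def
proof (intro conjI exI)
  let ?f = "\<lambda>a. scale (\<eta> a) (e a)"
  let ?e = "\<lambda>\<alpha>. ?f (the_inv_into R w \<alpha>)"
  have \<eta>0: "\<eta> a \<noteq> 0" if "a \<in> R" for a using \<eta>[OF that] by auto
  have ew: "?e (w a) = ?f a" if "a \<in> R" for a using that by (simp add: the_inv_into_f_f[OF w_inj])
  have ewm: "?e (\<lambda>h. - w a h) = ?f (- a)" if "a \<in> R" for a
    using ew[OF R_minus[OF that]] by (simp only: w_minus)
  show "independent (k ` s ` {1..l} \<union> ?f ` R)" using \<eta>0 by (rule independent_basis)
  show "span (k ` s ` {1..l} \<union> ?f ` R) = L"
  proof (intro equalityI)
    show "span (k ` s ` {1..l} \<union> ?f ` R) \<subseteq> L"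
      unfolding L_eq_span by (rule span_minimal) (auto intro: span_base span_scale[OF span_base])
    have "e a \<in> span (k ` s ` {1..l} \<union> ?f ` R)" if "a \<in> R" for a
    proof -
      have "scale (\<eta> a) (?f a) \<in> span (k ` s ` {1..l} \<union> ?f ` R)"
        using that by (intro span_scale span_base) auto
      thus ?thesis using \<eta>[OF that] by simp
    qed
    thus "L \<subseteq> span (k ` s ` {1..l} \<union> ?f ` R)"
      unfolding L_eq_span by (intro span_minimal) (auto intro: span_base)
  qed
  show "lie.cartan_subalgebra H" by (rule cartan_H)
  show "lie.root_base H ((\<lambda>i. w (s i)) ` {1..l})" by (rule root_base_s)
  have "lie.coroot H ` (\<lambda>i. w (s i)) ` {1..l} = k ` s ` {1..l}"
    using s_in_R by (simp add: image_image coroot_w)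
  moreover have "?e ` lie.roots H = ?f ` R" unfolding roots_eq image_image using ew by auto
  ultimately show "k ` s ` {1..l} \<union> ?f ` R = lie.coroot H ` (\<lambda>i. w (s i)) ` {1..l} \<union> ?e ` lie.roots H"
    by simp
  show "\<forall>\<alpha>\<in>lie.roots H. ?e \<alpha> \<in> lie.root_space H \<alpha> - {0}"
    using \<eta>0 by (auto simp: roots_eq the_inv_into_f_f[OF w_inj] root_space_w e_nonzero)
  show "\<forall>\<alpha>\<in>lie.roots H. br (?e \<alpha>) (?e (\<lambda>h. - \<alpha> h)) = lie.coroot H \<alpha>"
    unfolding roots_eq
  proof (safe)
    fix a assume a: "a \<in> R"
    show "br (?e (w a)) (?e (\<lambda>h. - w a h)) = lie.coroot H (w a)"
      using a \<eta>[OF a] by (simp only: ew ewm) (simp add: br_scale br_e_opp \<eta>_minus coroot_w)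
  qed
  show "\<forall>\<alpha>\<in>lie.roots H. \<forall>\<beta>\<in>lie.roots H. (\<lambda>h. \<alpha> h + \<beta> h) \<in> lie.roots H \<longrightarrow>
           (\<exists>c. br (?e \<alpha>) (?e \<beta>) = scale c (?e (\<lambda>h. \<alpha> h + \<beta> h)) \<and>
                br (?e (\<lambda>h. - \<alpha> h)) (?e (\<lambda>h. - \<beta> h)) = scale (- c) (?e (\<lambda>h. - (\<alpha> h + \<beta> h))))"
    unfolding roots_eq
  proof (safe)
    fix a b d assume R: "a \<in> R" "b \<in> R" "d \<in> R" and wd: "(\<lambda>h. w a h + w b h) = w d"
    \<comment> \<open>That a + b is a root is known only for the functionals. Evaluating at the
      coroots of d, a and b gives 2 = (d, a) + (d, b) = 4 + 2 (a, b).\<close>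
    have "ip a b = -1"
    proof -
      have "w a (k d) + w b (k d) = w d (k d)" "w a (k a) + w b (k a) = w d (k a)"
        "w a (k b) + w b (k b) = w d (k b)"
        by (rule fun_cong[OF wd])+
      hence "of_int (ip d a + ip d b) = (of_int 2 :: complex)"
        "of_int (2 + ip a b) = (of_int (ip a d) :: complex)"
        "of_int (ip b a + 2) = (of_int (ip b d) :: complex)"
        using R by (simp_all add: w_k ip_self)
      hence "ip d a + ip d b = 2" "2 + ip a b = ip a d" "ip b a + 2 = ip b d"
        by (simp_all only: of_int_eq_iff)
      thus ?thesis by (simp add: ip_sym)
    qed
    hence ab: "a + b \<in> R" using R R_add by simp
    have "w d = w (a + b)" using wd w_add_root by (auto simp: fun_eq_iff)
    hence d: "d = a + b" using inj_onD[OF w_inj] R ab by blast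
    let ?c = "\<eta> a * \<eta> b * eps a b * \<eta> d"
    have dd: "\<eta> d * (\<eta> d * z) = z" for z using \<eta>[OF R(3)] by (simp flip: mult.assoc)
    have "br (?f a) (?f b) = scale ?c (?f d)"
      using R \<open>ip a b = -1\<close> by (simp add: br_scale br_e_e d[symmetric] ac_simps dd)
    moreover have "br (?f (- a)) (?f (- b)) = scale (- ?c) (?f (- d))"
    proof -
      have "- a + - b = - d" by (simp add: d)
      hence "br (e (- a)) (e (- b)) = scale (eps a b) (e (- d))"
        using br_e_e[of "- a" "- b"] R R_minus \<open>ip a b = -1\<close> by (simp only: ip_minus eps_minus)
      thus ?thesis using R by (simp add: br_scale \<eta>_minus ac_simps dd)
    qed
    ultimately show "\<exists>c. br (?e (w a)) (?e (w b)) = scale c (?e (\<lambda>h. w a h + w b h)) \<and>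
        br (?e (\<lambda>h. - w a h)) (?e (\<lambda>h. - w b h)) = scale (- c) (?e (\<lambda>h. - (w a h + w b h)))"
      using R by (intro exI[of _ ?c]) (simp only: ew ewm fun_cong[OF wd])
  qed
qed

end

section \<open>Products and contractions of ordered monomials\<close>

lemma Delta1_props:
  "clinear (Delta1 v)" "Delta1 v ext_one = 0" "Delta1 v (gen u) = dot v u *s ext_one"
  "Delta1 v (gen u \<and>\<^sub>e y) = dot v u *s y - gen u \<and>\<^sub>e Delta1 v y"
proof -
  have anti: "antiderivation (Delta1 v)" and u: "Delta1 v (gen u) = dot v u *s ext_one" for u
    using Delta1[of v] by (simp_all add: is_contraction_def)
  show "clinear (Delta1 v)" "Delta1 v ext_one = 0" "Delta1 v (gen u) = dot v u *s ext_one"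
    using anti one_deg u by (auto simp: antiderivation_def)
  have "Delta1 v (gen u \<and>\<^sub>e y) = Delta1 v (gen u) \<and>\<^sub>e y + (-1) ^ 1 *s (gen u \<and>\<^sub>e Delta1 v y)"
    using anti gen_deg[of u] unfolding antiderivation_def by blast
  thus "Delta1 v (gen u \<and>\<^sub>e y) = dot v u *s y - gen u \<and>\<^sub>e Delta1 v y"
    by (simp add: u wedge_simps wedge_one_left)
qed

lemma Delta_props:
  fixes a b x :: "'n::{finite,linorder} ext" and v :: "complex ^ ('n::{finite,linorder})"
  shows
  "clinear (Delta a)" "clinear (\<lambda>a. Delta a x)" "Delta ext_one x = x"
  "Delta (a \<and>\<^sub>e b) x = Delta a (Delta b x)" "Delta (gen v) = Delta1 v"
  using Delta[where 'a = 'n] unfolding extends_Delta1_def by (simp_all add: fun_eq_iff)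

lemmas Delta_simps =
  clinear_add[OF Delta_props(1)] clinear_scale[OF Delta_props(1)] clinear_0[OF Delta_props(1)]
  clinear_add[OF Delta_props(2)] clinear_scale[OF Delta_props(2)] clinear_0[OF Delta_props(2)]

lemma clinear_Delta1_left: "clinear (\<lambda>v. Delta1 v x)"
  using clinear_comp[OF Delta_props(2) clinear_gen] by (simp add: Delta_props(5))

lemmas Delta1_simps =
  clinear_add[OF Delta1_props(1)] clinear_scale[OF Delta1_props(1)] clinear_0[OF Delta1_props(1)]
  clinear_add[OF clinear_Delta1_left] clinear_scale[OF clinear_Delta1_left]
  clinear_0[OF clinear_Delta1_left]

lemma wedge_minus: "(- x) \<and>\<^sub>e y = - (x \<and>\<^sub>e y)" "x \<and>\<^sub>e (- y) = - (x \<and>\<^sub>e y)"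
  using wedge_simps(1)[of x "- x" y] wedge_simps(3)[of x y "- y"]
  by (simp_all add: wedge_simps eq_neg_iff_add_eq_0 add.commute)

lemma matrix_vector_axis: "A *v axis j (1::complex) = (\<chi> i. A $ i $ j)"
proof -
  have "(\<Sum>l\<in>UNIV. A $ i $ l * axis j 1 $ l) = (\<Sum>l\<in>UNIV. if l = j then A $ i $ j else 0)" for i
    by (intro sum.cong) (auto simp: axis_def)
  thus ?thesis by (simp add: matrix_vector_mult_def vec_eq_iff)
qed

lemma dot_axis_axis: "dot (axis i 1) (axis j 1) = (if i = j then 1 else 0)"
  by (simp add: dot_axis) (simp add: axis_def)

text \<open>The sum is a derivation because moving the odd factor \<open>gen u\<close> past
  \<open>gen (axis i 1)\<close> costs a sign, which cancels the sign of the antiderivation. Both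
  sides then obey the same recursion on generators.\<close>

lemma Der_eq_sum: "Der A x = (\<Sum>j\<in>UNIV. gen (A *v axis j 1) \<and>\<^sub>e Delta1 (axis j 1) x)"
proof (rule clinear_ext_gen[where f = "Der A"])
  have der: "clinear (Der A)" "Der A (x \<and>\<^sub>e y) = Der A x \<and>\<^sub>e y + x \<and>\<^sub>e Der A y" for x y
    using Der(1)[of A] by (simp_all add: derivation_def)
  show "clinear (Der A)" by (rule der)
  show "clinear (\<lambda>x. \<Sum>j\<in>UNIV. gen (A *v axis j 1) \<and>\<^sub>e Delta1 (axis j 1) x)"
    by (rule clinearI) (simp_all add: Delta1_simps wedge_simps sum.distrib vec.scale_sum_right)
  show "Der A ext_one = (\<Sum>j\<in>UNIV. gen (A *v axis j 1) \<and>\<^sub>e Delta1 (axis j 1) ext_one)"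
    using der(2)[of ext_one ext_one]
    by (simp add: wedge_one_left wedge_one_right Delta1_props(2) wedge_simps)
  fix i :: 'a and y
  assume y: "Der A y = (\<Sum>j\<in>UNIV. gen (A *v axis j 1) \<and>\<^sub>e Delta1 (axis j 1) y)"
  have swap: "gen u \<and>\<^sub>e (gen (axis i 1) \<and>\<^sub>e z) = - (gen (axis i 1) \<and>\<^sub>e (gen u \<and>\<^sub>e z))" for u z
    using wedge_gen_swap[of u "axis i 1"] by (simp flip: wedge_assoc add: wedge_minus)

  have sub: "u \<and>\<^sub>e (y - z) = u \<and>\<^sub>e y - u \<and>\<^sub>e z" for u y z :: "'a ext"
    using wedge_simps(3)[of u y "- z"] by (simp add: wedge_minus)
  have "(\<Sum>j\<in>UNIV. gen (A *v axis j 1) \<and>\<^sub>e Delta1 (axis j 1) (gen (axis i 1) \<and>\<^sub>e y))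
      = (\<Sum>j\<in>UNIV. (if j = i then gen (A *v axis j 1) \<and>\<^sub>e y else 0)
          + gen (axis i 1) \<and>\<^sub>e (gen (A *v axis j 1) \<and>\<^sub>e Delta1 (axis j 1) y))"
    by (intro sum.cong) (auto simp: Delta1_props dot_axis_axis sub wedge_simps wedge_minus swap)
  also have "\<dots> = gen (A *v axis i 1) \<and>\<^sub>e y + gen (axis i 1) \<and>\<^sub>e Der A y"
    by (simp add: sum.distrib y clinear_sum[OF clinear_wedge_right])
  finally show "Der A (gen (axis i 1) \<and>\<^sub>e y)
      = (\<Sum>j\<in>UNIV. gen (A *v axis j 1) \<and>\<^sub>e Delta1 (axis j 1) (gen (axis i 1) \<and>\<^sub>e y))"
    by (simp add: der Der(2))
qed

lemma axis_eq_gen_wedge: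
  "i \<in> S \<Longrightarrow> axis S 1 = ext_sign {i} (S - {i}) *s (gen (axis i 1) \<and>\<^sub>e axis (S - {i}) 1)"
  by (simp add: gen_axis wedge_axis insert_absorb)

text \<open>The factor i is moved to the front of the monomial, at the cost of the displayed sign;
  the remaining factors are annihilated, which is the auxiliary fact \<open>notin\<close>.\<close>

lemma Delta1_axis:
  "Delta1 (axis i 1) (axis S 1) = (if i \<in> S then ext_sign {i} (S - {i}) *s axis (S - {i}) 1 else 0)"
proof -
  have notin: "Delta1 (axis i 1) (axis S 1) = 0" if "i \<notin> S" for S
    using finite[of S] that
  proof (induction S rule: finite_induct)
    case empty
    show ?case using Delta1_props(2)[of "axis i 1"] by (simp add: ext_one_def)
  next
    case (insert j S)
    have "axis (insert j S) 1 = ext_sign {j} S *s (gen (axis j 1) \<and>\<^sub>e axis S 1)"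
      using axis_eq_gen_wedge[of j "insert j S"] insert.hyps by simp
    with insert show ?case by (simp add: Delta1_simps Delta1_props dot_axis_axis wedge_simps)
  qed
  show ?thesis
  proof (cases "i \<in> S")
    case True
    thus ?thesis
      by (subst axis_eq_gen_wedge[OF True])
        (simp add: Delta1_simps Delta1_props dot_axis_axis notin wedge_simps)
  qed (simp add: notin)
qed

text \<open>\<open>Delta\<close> turns products into compositions, so the last factor acts first.
  Contraction by the reversed monomial therefore undoes left multiplication by
  \<open>axis S 1\<close>, and \<open>(-1) ^ (card S choose 2)\<close> is the sign of the
  reversal.\<close>

lemma Delta_axis:
  "Delta (axis S 1) (axis T 1) =
    (if S \<subseteq> T then ((-1) ^ (card S choose 2) * ext_sign S (T - S)) *s axis (T - S) 1 else 0)"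
  using finite[of S]
proof (induction S rule: finite_induct)
  case empty
  show ?case using Delta_props(3) by (simp add: ext_one_def binomial_eq_0)
next
  case (insert i S)
  have ax: "axis (insert i S) 1 = ext_sign {i} S *s (gen (axis i 1) \<and>\<^sub>e axis S 1)"
    using axis_eq_gen_wedge[of i "insert i S"] insert.hyps by simp
  show ?case
  proof (cases "insert i S \<subseteq> T")
    case True
    define T' where "T' = T - insert i S"
    have T: "T - S = insert i T'" "i \<notin> T'" "T - S - {i} = T'"
      using True insert.hyps by (auto simp: T'_def)
    have s1: "ext_sign S (insert i T') = ext_sign S {i} * ext_sign S T'"
      using ext_sign_Un_right[of "{i}" T' S] T by simp
    have s2: "ext_sign (insert i S) T' = ext_sign {i} T' * ext_sign S T'"
      using ext_sign_Un_left[of "{i}" S T'] insert.hyps by simp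
    have s3: "ext_sign {i} S * ext_sign S {i} = (-1) ^ card S"
      using ext_sign_swap[of "{i}" S] insert.hyps by simp
    have s4: "card (insert i S) choose 2 = (card S choose 2) + card S"
      using insert.hyps by (simp add: numeral_2_eq_2)
    have "Delta (axis (insert i S) 1) (axis T 1)
        = (ext_sign {i} S * ((-1) ^ (card S choose 2) * (ext_sign S {i} * ext_sign S T')) * ext_sign {i} T')
            *s axis T' 1"
      using True T insert.IH by (simp add: ax Delta_simps Delta_props Delta1_simps Delta1_axis s1)
    also have "ext_sign {i} S * ((-1) ^ (card S choose 2) * (ext_sign S {i} * ext_sign S T')) * ext_sign {i} T'
        = (ext_sign {i} S * ext_sign S {i}) * (-1) ^ (card S choose 2) * (ext_sign {i} T' * ext_sign S T')"
      by (simp only: ac_simps)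
    also have "\<dots> = (-1) ^ (card (insert i S) choose 2) * ext_sign (insert i S) T'"
      unfolding s2 s3 s4 power_add by (simp only: ac_simps)
    finally show ?thesis using True by (simp add: T'_def)
  next
    case False
    thus ?thesis using insert.IH
      by (auto simp add: ax Delta_simps Delta_props Delta1_simps Delta1_axis)
  qed
qed

lemma foldr_wedge: "foldr (\<lambda>i x. gen (axis i 1) \<and>\<^sub>e x) l x = foldr (\<lambda>i x. gen (axis i 1) \<and>\<^sub>e x) l ext_one \<and>\<^sub>e x"
  by (induction l) (simp_all add: wedge_one_left wedge_assoc)

lemma v_plus_eq: "v_plus S = axis S 1"
  unfolding v_plus_def by (rule ext_basis_eq_prod[symmetric])

lemma v_minus_eq: "v_minus S = (-1) ^ (card S choose 2) *s axis S 1"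
proof -
  have "foldr (\<lambda>i x. gen (axis i 1) \<and>\<^sub>e x) (rev l) ext_one = (-1) ^ (length l choose 2) *s axis (set l) 1"
    if "sorted l" "distinct l" for l :: "6 list"
    using that
  proof (induction l)
    case (Cons i l)
    have "{(s, t). s \<in> {i} \<and> t \<in> set l \<and> t < s} = {}" using Cons.prems by auto
    hence "ext_sign {i} (set l) = 1" by (simp only: ext_sign_def) simp
    hence sign: "ext_sign (set l) {i} = (-1) ^ length l"
      using ext_sign_swap[of "{i}" "set l"] Cons.prems by (simp add: distinct_card)
    have "foldr (\<lambda>i x. gen (axis i 1) \<and>\<^sub>e x) (rev (i # l)) ext_one
        = foldr (\<lambda>i x. gen (axis i 1) \<and>\<^sub>e x) (rev l) ext_one \<and>\<^sub>e axis {i} 1"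
      using foldr_wedge[of "rev l" "gen (axis i 1)"] by (simp add: wedge_one_right gen_axis)
    also have "\<dots> = (-1) ^ ((length l choose 2) + length l) *s axis (set (i # l)) 1"
      using Cons by (simp add: wedge_simps wedge_axis sign power_add)
    also have "(length l choose 2) + length l = length (i # l) choose 2"
      by (simp add: numeral_2_eq_2)
    finally show ?case .
  qed (simp add: ext_one_def binomial_eq_0)
  from this[of "sorted_list_of_set S"] show ?thesis by (simp add: v_minus_def)
qed

text \<open>Column s removes s from S and contracts \<open>axis T 1\<close> by the rest. An entry
  survives only if exchanging s for t turns S into T, where t = s is allowed.\<close>

lemma E_op_axis:
  "E_op (axis T 1) (axis S 1) $ t $ s =
    (if s \<in> S \<and> S - {s} \<subseteq> T \<and> T - (S - {s}) = {t}
     then ext_sign {s} (S - {s}) * (-1) ^ (card (S - {s}) choose 2) * ext_sign (S - {s}) {t} else 0)"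
proof -
  have "E_op (axis T 1) (axis S 1) $ t $ s = Delta (Delta1 (axis s 1) (axis S 1)) (axis T 1) $ {t}"
    by (simp add: E_op_def matrix_def vec_part_def Delta_props(5))
  also have "\<dots> = (if s \<in> S \<and> S - {s} \<subseteq> T \<and> T - (S - {s}) = {t}
     then ext_sign {s} (S - {s}) * (-1) ^ (card (S - {s}) choose 2) * ext_sign (S - {s}) {t} else 0)"
    by (simp add: Delta1_axis Delta_simps Delta_axis) (auto simp: axis_def)
  finally show ?thesis .
qed

lemma E_op_linear:
  "E_op (x + y) a = E_op x a + E_op y a" "E_op (c *s x) a = mscale c (E_op x a)"
  "E_op x (a + b) = E_op x a + E_op x b" "E_op x (c *s a) = mscale c (E_op x a)"
  "E_op 0 a = 0" "E_op x 0 = 0"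
  by (simp_all add: E_op_def matrix_def vec_part_def Delta_simps mscale_def vec_eq_iff)

lemma clinear_Der: "clinear (Der A)"
  using Der(1)[of A] by (simp add: derivation_def)

lemma Der_linear:
  "Der (A + B) x = Der A x + Der B x" "Der 0 x = 0"
  by (simp_all add: Der_eq_sum matrix_vector_mult_add_rdistrib clinear_add[OF clinear_gen]
      clinear_0[OF clinear_gen] wedge_simps sum.distrib)

lemma Der_mscale: "Der (mscale c A) x = c *s Der A x"
proof -
  have "mscale c A *v v = c *s (A *v v)" for v
    by (simp add: mscale_def matrix_vector_mult_def vec_eq_iff sum_distrib_left ac_simps)
  thus ?thesis
    by (simp add: Der_eq_sum clinear_scale[OF clinear_gen] wedge_simps vec.scale_sum_right)
qed

lemma Der_minus: "Der (- A) x = - Der A x"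
  using Der_linear(1)[of A "- A" x] by (simp add: Der_linear(2) eq_neg_iff_add_eq_0 add.commute)

lemmas Der_simps = Der_linear Der_mscale Der_minus
  clinear_add[OF clinear_Der] clinear_scale[OF clinear_Der] clinear_0[OF clinear_Der]

lemma Der_munit: "Der (munit i j) x = gen (axis i 1) \<and>\<^sub>e Delta1 (axis j 1) x"
proof -
  have "munit i j *v axis l 1 = (if l = j then axis i 1 else 0)" for l
    unfolding matrix_vector_axis by (auto simp: munit_def vec_eq_iff axis_def)
  hence "Der (munit i j) x = (\<Sum>l\<in>UNIV. if l = j then gen (axis i 1) \<and>\<^sub>e Delta1 (axis j 1) x else 0)"
    unfolding Der_eq_sum by (intro sum.cong) (auto simp: clinear_0[OF clinear_gen] wedge_simps)
  thus ?thesis by simp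
qed

lemma Der_diag_axis:
  "Der (\<chi> i j. if i = j then d $ i else 0) (axis S 1) = (\<Sum>i\<in>S. d $ i) *s axis S 1"
proof -
  have "(\<chi> i j. if i = j then d $ i else 0) *v axis j 1 = (d $ j) *s axis j 1" for j
    unfolding matrix_vector_axis by (simp add: vec_eq_iff axis_def)
  hence "Der (\<chi> i j. if i = j then d $ i else 0) (axis S 1)
      = (\<Sum>j\<in>UNIV. if j \<in> S then (d $ j) *s axis S 1 else 0)"
    unfolding Der_eq_sum
    by (intro sum.cong) (auto simp: Delta1_axis wedge_simps clinear_scale[OF clinear_gen] gen_axis
        wedge_axis insert_absorb)
  also have "\<dots> = (\<Sum>j\<in>S. (d $ j) *s axis S 1)" by (simp add: sum.If_cases)
  finally show ?thesis by (simp add: vec.scale_sum_left)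
qed

lemma scalar_Delta_comm: "scalar_part (Delta x y) = scalar_part (Delta y x)"
proof -
  \<comment> \<open>The scalar is placed along \<open>ext_one\<close> because
    \<open>clinear_ext\<close> compares maps with values in a coordinate space.\<close>
  define f where "f x y = scalar_part (Delta x y) *s ext_one" for x y :: "'a ext"
  have lin: "clinear (f x)" "clinear (\<lambda>x. f x y)" for x y
    by (rule clinearI; simp add: f_def scalar_part_def Delta_simps vec.scale_left_distrib)+
  have 1: "f (axis S 1) (axis T 1) = f (axis T 1) (axis S 1)" for S T
    proof -
    have "scalar_part (Delta (axis S 1) (axis T 1)) = (if S = T then (-1) ^ (card S choose 2) else 0)" for S T :: "'a set"
    proof (cases "S \<subseteq> T \<and> T - S = {}")
      case True
      hence "T = S" by blast
      thus ?thesis by (simp add: scalar_part_def Delta_axis axis_def[of "{}"])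
    next
      case False
      thus ?thesis by (auto simp: scalar_part_def Delta_axis axis_def[of "T - S"])
    qed
    thus ?thesis by (simp add: f_def)
  qed
  have 2: "f (axis S 1) y = f y (axis S 1)" for S y
    by (rule clinear_ext[OF lin(1) lin(2)]) (rule 1)
  have "f x y = f y x"
    by (rule clinear_ext[OF lin(2) lin(1)]) (rule 2)
  hence "f x y $ {} = f y x $ {}" by simp
  thus ?thesis by (simp add: f_def ext_one_def axis_def)
qed

text \<open>Gives skew-symmetry of the products of 3-forms in degrees 1 and -1, the only ones that
  \<open>ebr\<close> does not antisymmetrize explicitly besides the commutator of matrices.\<close>

lemma wedge_anticomm:
  assumes "x \<in> ext_deg k" "y \<in> ext_deg l" "odd k" "odd l"
  shows "x \<and>\<^sub>e y = - (y \<and>\<^sub>e x)"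
proof -
  have "(x \<and>\<^sub>e y) $ U = - (y \<and>\<^sub>e x) $ U" for U
  proof -
    have "(\<Sum>S\<in>Pow U. ext_sign S (U - S) * (y $ S) * (x $ (U - S)))
        = (\<Sum>S\<in>Pow U. ext_sign (U - S) S * (y $ (U - S)) * (x $ S))"
      by (rule sum.reindex_bij_witness[of _ "\<lambda>S. U - S" "\<lambda>S. U - S"]) (auto simp: double_diff)
    also have "\<dots> = - (\<Sum>S\<in>Pow U. ext_sign S (U - S) * (x $ S) * (y $ (U - S)))"
      unfolding sum_negf[symmetric]
    proof (rule sum.cong[OF refl])
      fix S assume "S \<in> Pow U"
      show "ext_sign (U - S) S * (y $ (U - S)) * (x $ S) = - (ext_sign S (U - S) * (x $ S) * (y $ (U - S)))"
      proof (cases "x $ S = 0 \<or> y $ (U - S) = 0")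
        case False
        hence "card S = k" "card (U - S) = l" using assms by (auto simp: ext_deg_def)
        hence "ext_sign S (U - S) * ext_sign (U - S) S = -1"
          using ext_sign_swap[of S "U - S"] assms by (simp add: Diff_disjoint)
        hence "ext_sign S (U - S) * (ext_sign S (U - S) * ext_sign (U - S) S) = - ext_sign S (U - S)"
          by simp
        hence "ext_sign (U - S) S = - ext_sign S (U - S)" by (simp flip: mult.assoc)
        thus ?thesis by simp
      qed auto
    qed
    finally show ?thesis by (simp add: wedge_def)
  qed
  thus ?thesis by (simp add: vec_eq_iff)
qed

section \<open>The root lattice\<close>

type_synonym lat = "(int ^ 6) \<times> int"

text \<open>Up to sign this is the intersection form on the Picard lattice of a cubic surface, blown
  up from the plane in six points. The condition that the entries add up to 3k is orthogonality to
  the canonical class, and the vectors of norm 2 there are the classical model of the root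
  system.\<close>

definition ip :: "lat \<Rightarrow> lat \<Rightarrow> int" where
  "ip a b = (\<Sum>i\<in>UNIV. fst a $ i * fst b $ i) - snd a * snd b"

definition E6_roots :: "lat set" where
  "E6_roots = {a. (\<Sum>i\<in>UNIV. fst a $ i) = 3 * snd a \<and> ip a a = 2}"

definition inversions :: "lat \<Rightarrow> lat \<Rightarrow> int" where
  "inversions a b = (\<Sum>i\<in>UNIV. \<Sum>j\<in>UNIV. if j < i then fst a $ i * fst b $ j else 0)"

definition eps :: "lat \<Rightarrow> lat \<Rightarrow> complex" where
  "eps a b = (if even (inversions a b) then 1 else -1)"

definition ind :: "6 set \<Rightarrow> int ^ 6" where
  "ind S = (\<chi> i. if i \<in> S then 1 else 0)"

definition diff_root :: "6 \<Rightarrow> 6 \<Rightarrow> lat" where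
  "diff_root i j = (ind {i} - ind {j}, 0)"

definition set_root :: "6 set \<Rightarrow> lat" where
  "set_root S = (ind S, 1)"

definition top_root :: lat where
  "top_root = (ind UNIV, 2)"

lemma ip_add: "ip (a + b) d = ip a d + ip b d"
  by (simp add: ip_def algebra_simps sum.distrib)

lemma ip_sym: "ip a b = ip b a"
  by (simp add: ip_def mult.commute)

lemma ip_minus: "ip (- a) b = - ip a b" "ip a (- b) = - ip a b"
  by (simp_all add: ip_def sum_negf)

lemma ip_norm_add: "ip (a + b) (a + b) = ip a a + 2 * ip a b + ip b b"
  by (simp add: ip_def algebra_simps sum.distrib sum_distrib_left)

text \<open>The entries are compared with their mean k/2. The result is that the norm
  \<open>ip\<close> of a vector of degree k on the hyperplane is at least half of the square of k,
  hence positive definiteness.\<close>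

lemma norm_bound:
  fixes c :: "int ^ 6"
  assumes "(\<Sum>i\<in>UNIV. c $ i) = 3 * k"
  shows "3 * k\<^sup>2 \<le> 2 * (\<Sum>i\<in>UNIV. c $ i * c $ i)"
proof -
  have "0 \<le> (\<Sum>i\<in>UNIV. (2 * c $ i - k)\<^sup>2)" by (simp add: sum_nonneg)
  also have "\<dots> = (\<Sum>i\<in>UNIV. 4 * (c $ i * c $ i) - 4 * k * c $ i + k\<^sup>2)"
    by (simp add: power2_eq_square algebra_simps)
  also have "\<dots> = 4 * (\<Sum>i\<in>UNIV. c $ i * c $ i) - 4 * k * (\<Sum>i\<in>UNIV. c $ i) + 6 * k\<^sup>2"
    by (simp add: sum.distrib sum_subtractf sum_distrib_left)
  finally show ?thesis using assms by (simp add: power2_eq_square algebra_simps)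
qed

lemma ip_pos:
  assumes "(\<Sum>i\<in>UNIV. fst a $ i) = 3 * snd a"
  shows "ip a a \<ge> 0" "ip a a = 0 \<Longrightarrow> a = 0"
proof -
  have 1: "3 * (snd a)\<^sup>2 \<le> 2 * (\<Sum>i\<in>UNIV. fst a $ i * fst a $ i)"
    by (rule norm_bound[OF assms])
  moreover have sq: "(snd a)\<^sup>2 \<ge> 0" by simp
  moreover have ip: "ip a a = (\<Sum>i\<in>UNIV. fst a $ i * fst a $ i) - (snd a)\<^sup>2" by (simp add: ip_def power2_eq_square)
  ultimately show "ip a a \<ge> 0" by linarith
  assume "ip a a = 0"
  hence 2: "(\<Sum>i\<in>UNIV. fst a $ i * fst a $ i) = 0" "(snd a)\<^sup>2 = 0" using 1 sq ip by linarith+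
  hence "\<forall>i\<in>UNIV. fst a $ i * fst a $ i = 0" by (subst (asm) sum_nonneg_eq_0_iff) auto
  with 2 show "a = 0" by (simp add: prod_eq_iff vec_eq_iff)
qed

lemma roots_sum: "a \<in> E6_roots \<Longrightarrow> (\<Sum>i\<in>UNIV. fst a $ i) = 3 * snd a"
  and roots_norm: "a \<in> E6_roots \<Longrightarrow> ip a a = 2"
  by (simp_all add: E6_roots_def)

lemma roots_minus: "a \<in> E6_roots \<Longrightarrow> - a \<in> E6_roots"
  by (simp add: E6_roots_def ip_minus sum_negf)

lemma roots_add: "a \<in> E6_roots \<Longrightarrow> b \<in> E6_roots \<Longrightarrow> ip a b = -1 \<Longrightarrow> a + b \<in> E6_roots"
  by (simp add: E6_roots_def ip_norm_add sum.distrib)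

text \<open>The vector a + b has norm 4 + 2 (a, b), which is nonnegative and vanishes only for a + b
  = 0.\<close>

lemma ip_ge:
  assumes "a \<in> E6_roots" "b \<in> E6_roots"
  shows "ip a b \<ge> -2" "ip a b = -2 \<Longrightarrow> b = - a"
proof -
  have sum: "(\<Sum>i\<in>UNIV. fst (a + b) $ i) = 3 * snd (a + b)"
    using assms by (simp add: roots_sum sum.distrib)
  have n: "ip (a + b) (a + b) = 4 + 2 * ip a b"
    using assms by (simp add: ip_norm_add roots_norm)
  with ip_pos(1)[OF sum] show "ip a b \<ge> -2" by linarith
  assume "ip a b = -2"
  hence "a + b = 0" using ip_pos(2)[OF sum] n by simp
  thus "b = - a" by (simp add: eq_neg_iff_add_eq_0 add.commute)
qed

lemma inversions_add:
  "inversions (a + b) c = inversions a c + inversions b c"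
  "inversions c (a + b) = inversions c a + inversions c b"
  by (auto simp: inversions_def algebra_simps simp flip: sum.distrib intro!: sum.cong)

lemma inversions_swap:
  "inversions a b + inversions b a
    = (\<Sum>i\<in>UNIV. fst a $ i) * (\<Sum>i\<in>UNIV. fst b $ i) - (\<Sum>i\<in>UNIV. fst a $ i * fst b $ i)"
proof -
  have "inversions b a = (\<Sum>i\<in>UNIV. \<Sum>j\<in>UNIV. if i < j then fst a $ i * fst b $ j else 0)"
    unfolding inversions_def by (subst sum.swap) (intro sum.cong, auto)
  hence "inversions a b + inversions b a + (\<Sum>i\<in>UNIV. fst a $ i * fst b $ i)
      = (\<Sum>i\<in>UNIV. (\<Sum>j\<in>UNIV. (if j < i then fst a $ i * fst b $ j else 0)
          + (if i < j then fst a $ i * fst b $ j else 0)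
          + (if j = i then fst a $ i * fst b $ j else 0)))"
    by (simp add: inversions_def sum.distrib)
  also have "\<dots> = (\<Sum>i\<in>UNIV. (\<Sum>j\<in>UNIV. fst a $ i * fst b $ j))"
    by (intro sum.cong) auto
  also have "\<dots> = (\<Sum>i\<in>UNIV. fst a $ i) * (\<Sum>i\<in>UNIV. fst b $ i)"
    by (simp add: sum_product)
  finally show ?thesis by linarith
qed

text \<open>The entries of a and b add up to 3k and 3l, so the product of the sums is 9kl, from
  which the dot product (a, b) + kl is subtracted. As 8 is even, the parity is that of (a,
  b).\<close>

lemma inversions_swap_roots:
  "a \<in> E6_roots \<Longrightarrow> b \<in> E6_roots \<Longrightarrow> inversions a b + inversions b a = 8 * (snd a * snd b) - ip a b"
  by (simp add: inversions_swap roots_sum ip_def)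

lemma eps_add: "eps (a + b) d = eps a d * eps b d" "eps d (a + b) = eps d a * eps d b"
  by (auto simp: eps_def inversions_add)

lemma eps_sq: "eps a b * eps a b = 1"
  by (simp add: eps_def)

lemma eps_comm: "a \<in> E6_roots \<Longrightarrow> b \<in> E6_roots \<Longrightarrow> ip a b = 0 \<Longrightarrow> eps a b = eps b a"
proof -
  assume "a \<in> E6_roots" "b \<in> E6_roots" "ip a b = 0"
  hence "even (inversions a b + inversions b a)" by (simp add: inversions_swap_roots)
  thus ?thesis by (auto simp: eps_def)
qed

lemma eps_anticomm: "a \<in> E6_roots \<Longrightarrow> b \<in> E6_roots \<Longrightarrow> ip a b = -1 \<Longrightarrow> eps a b = - eps b a"
proof -
  assume "a \<in> E6_roots" "b \<in> E6_roots" "ip a b = -1"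
  hence "odd (inversions a b + inversions b a)" by (simp add: inversions_swap_roots)
  thus ?thesis by (auto simp: eps_def)
qed

text \<open>Parity of the symmetrized count says nothing about \<open>inversions a a\<close>. The
  exact value 8k^2 - 2 of its double does: half of it is odd because 8 is divisible by 4.\<close>

lemma eps_self: "a \<in> E6_roots \<Longrightarrow> eps a a = -1"
proof -
  assume "a \<in> E6_roots"
  hence "2 * inversions a a = 2 * (4 * (snd a * snd a) - 1)"
    using inversions_swap_roots[of a a] by (simp add: roots_norm)
  hence "inversions a a = 4 * (snd a * snd a) - 1" by simp
  thus ?thesis by (simp add: eps_def)
qed

lemma eps_minus: "eps (- a) b = eps a b" "eps a (- b) = eps a b"
proof -
  have "inversions (- a) b = - inversions a b" "inversions a (- b) = - inversions a b"
    by (auto simp: inversions_def simp flip: sum_negf intro!: sum.cong)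
  thus "eps (- a) b = eps a b" "eps a (- b) = eps a b" by (simp_all add: eps_def)
qed

text \<open>The link between the lattice and the exterior algebra: on vectors with entries 0 and 1
  the weighted count of inversions is the exponent in \<open>ext_sign\<close>.\<close>

lemma eps_ind: "eps (ind S, m) (ind T, n) = ext_sign S T"
proof -
  have "inversions (ind S, m) (ind T, n)
      = (\<Sum>i\<in>UNIV. \<Sum>j\<in>UNIV. if (i, j) \<in> {(s, t). s \<in> S \<and> t \<in> T \<and> t < s} then 1 else 0)"
    unfolding inversions_def by (intro sum.cong) (auto simp: ind_def)
  also have "\<dots> = (\<Sum>p\<in>UNIV. if p \<in> {(s, t). s \<in> S \<and> t \<in> T \<and> t < s} then 1 else 0)"
    by (simp only: sum.cartesian_product UNIV_Times_UNIV case_prod_eta) (simp add: case_prod_unfold)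
  also have "\<dots> = int (card {(s, t). s \<in> S \<and> t \<in> T \<and> t < s})"
    by (simp add: sum.If_cases)
  finally show ?thesis by (simp add: eps_def ext_sign_def minus_one_power_iff)
qed

lemma eps_diff_root:
  "eps (diff_root i j) b = eps (ind {i}, 0) b * eps (ind {j}, 0) b"
  "eps b (diff_root i j) = eps b (ind {i}, 0) * eps b (ind {j}, 0)"
proof -
  have d: "diff_root i j = (ind {i}, 0) + - (ind {j}, 0)" by (simp add: diff_root_def)
  show "eps (diff_root i j) b = eps (ind {i}, 0) b * eps (ind {j}, 0) b"
    "eps b (diff_root i j) = eps b (ind {i}, 0) * eps b (ind {j}, 0)"
    unfolding d eps_add eps_minus by simp_all
qed

lemma sum_ind: "(\<Sum>i\<in>UNIV. ind S $ i * f i) = (\<Sum>i\<in>S. f i)" "(\<Sum>i\<in>UNIV. ind S $ i) = int (card S)"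
proof -
  have "(\<Sum>i\<in>UNIV. ind S $ i * f i) = (\<Sum>i\<in>UNIV. if i \<in> S then f i else 0)" for f
    by (intro sum.cong) (auto simp: ind_def)
  thus *: "(\<Sum>i\<in>UNIV. ind S $ i * f i) = (\<Sum>i\<in>S. f i)" for f by (simp add: sum.If_cases)
  show "(\<Sum>i\<in>UNIV. ind S $ i) = int (card S)" using *[of "\<lambda>_. 1"] by simp
qed

lemma ip_set_root: "ip (set_root S) b = (\<Sum>i\<in>S. fst b $ i) - snd b"
  by (simp add: ip_def set_root_def sum_ind)

lemma ip_top_root: "ip top_root b = (\<Sum>i\<in>UNIV. fst b $ i) - 2 * snd b"
  by (simp add: ip_def top_root_def sum_ind)

lemma ip_diff_root: "ip (diff_root i j) b = fst b $ i - fst b $ j"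
  by (simp add: ip_def diff_root_def left_diff_distrib sum_subtractf sum_ind)

lemma sum_ind_Int: "(\<Sum>i\<in>S. ind T $ i) = int (card (S \<inter> T))"
  by (simp add: ind_def sum.If_cases)

lemma set_root_in: "card S = 3 \<Longrightarrow> set_root S \<in> E6_roots"
  by (simp add: E6_roots_def ip_set_root) (simp add: set_root_def sum_ind sum_ind_Int)

lemma top_root_in: "top_root \<in> E6_roots"
  by (simp add: E6_roots_def ip_top_root) (simp add: top_root_def sum_ind)

lemma diff_root_in: "i \<noteq> j \<Longrightarrow> diff_root i j \<in> E6_roots"
  by (simp add: E6_roots_def ip_diff_root) (simp add: diff_root_def sum_subtractf sum_ind, simp add: ind_def)

lemma diff_root_minus: "- diff_root i j = diff_root j i"
  by (simp add: diff_root_def)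

text \<open>The norm bound gives k \<le> 2. For k = 0 the squares of the entries add up to 2 and the
  entries to 0, so there is one 1 and one -1. For k = 1 the sum of the nonnegative integers c (c -
  1) is zero, so the entries are 0 or 1; for k = 2 the sum of the squares of c - 1 is zero.\<close>

lemma root_cases_nonneg:
  assumes a: "a \<in> E6_roots" and "snd a \<ge> 0"
  shows "(\<exists>i j. i \<noteq> j \<and> a = diff_root i j) \<or> (\<exists>S. card S = 3 \<and> a = set_root S) \<or> a = top_root"
proof -
  obtain c k where ck: "a = (c, k)" by (cases a)
  have sum: "(\<Sum>i\<in>UNIV. c $ i) = 3 * k" and norm: "(\<Sum>i\<in>UNIV. c $ i * c $ i) = 2 + k * k"
    using roots_sum[OF a] roots_norm[OF a] by (simp_all add: ck ip_def)
  have "k\<^sup>2 \<le> 2\<^sup>2" using norm_bound[OF sum] norm by (simp add: power2_eq_square)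
  hence "k \<le> 2" by (rule power2_le_imp_le) simp
  then consider "k = 0" | "k = 1" | "k = 2" using assms(2) by (simp add: ck) linarith
  thus ?thesis
  proof cases
    case 1
    have "c $ i * c $ i \<le> 2" for i
      using member_le_sum[of i UNIV "\<lambda>i. c $ i * c $ i"] norm 1 by simp
    have v: "c $ i = -1 \<or> c $ i = 0 \<or> c $ i = 1" for i
    proof -
      have "\<bar>c $ i\<bar>\<^sup>2 < 2\<^sup>2" using \<open>\<And>i. c $ i * c $ i \<le> 2\<close>[of i] by (simp add: power2_eq_square)
      hence "\<bar>c $ i\<bar> < 2" by (rule power2_less_imp_less) simp
      thus ?thesis by arith
    qed
    define P N where "P = {i. c $ i = 1}" and "N = {i. c $ i = -1}"
    have c: "c = ind P - ind N" using v by (auto simp: vec_eq_iff ind_def P_def N_def)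
    have "int (card P) - int (card N) = 0" using sum 1 by (simp add: c sum_subtractf sum_ind)
    moreover have "(\<Sum>i\<in>UNIV. c $ i * c $ i) = (\<Sum>i\<in>UNIV. ind P $ i + ind N $ i)"
    proof (rule sum.cong[OF refl])
      show "c $ i * c $ i = ind P $ i + ind N $ i" for i
        using v[of i] by (auto simp: ind_def P_def N_def)
    qed
    hence "int (card P) + int (card N) = 2" using norm 1 by (simp add: sum.distrib sum_ind)
    ultimately have "card P = 1" "card N = 1" by linarith+
    then obtain i j where ij: "P = {i}" "N = {j}" by (auto simp: card_1_singleton_iff)
    hence "c $ i = 1" "c $ j = -1" unfolding P_def N_def by blast+
    hence "i \<noteq> j" by auto
    thus ?thesis using ck c 1 ij by (auto simp: diff_root_def)
  next
    case 2
    have "(\<Sum>i\<in>UNIV. c $ i * (c $ i - 1)) = 0" using sum norm 2 by (simp add: right_diff_distrib sum_subtractf)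
    moreover have "x * (x - 1) \<ge> 0" for x :: int by (cases "x \<ge> 1") (auto intro: mult_nonpos_nonpos)
    ultimately have "\<forall>i\<in>UNIV. c $ i * (c $ i - 1) = 0" by (subst (asm) sum_nonneg_eq_0_iff) auto
    hence v: "c $ i = 0 \<or> c $ i = 1" for i by auto
    define S where "S = {i. c $ i = 1}"
    have c: "c = ind S" using v by (auto simp: vec_eq_iff ind_def S_def)
    have "card S = 3" using sum 2 by (simp add: c sum_ind)
    thus ?thesis using ck c 2 by (auto simp: set_root_def)
  next
    case 3
    have "(\<Sum>i\<in>UNIV. (c $ i - 1) * (c $ i - 1)) = (\<Sum>i\<in>UNIV. c $ i * c $ i - 2 * c $ i + 1)"
      by (intro sum.cong) (auto simp: algebra_simps)
    also have "\<dots> = 0" using sum norm 3 by (simp add: sum.distrib sum_subtractf flip: sum_distrib_left)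
    finally have "\<forall>i\<in>UNIV. (c $ i - 1) * (c $ i - 1) = 0" by (subst (asm) sum_nonneg_eq_0_iff) auto
    hence "c = ind UNIV" by (simp add: vec_eq_iff ind_def)
    thus ?thesis using ck 3 by (simp add: top_root_def)
  qed
qed

lemma root_cases [consumes 1, case_names diff set minus_set top minus_top]:
  assumes "a \<in> E6_roots"
  obtains i j where "i \<noteq> j" "a = diff_root i j"
    | S where "card S = 3" "a = set_root S"
    | S where "card S = 3" "a = - set_root S"
    | "a = top_root" | "a = - top_root"
proof (cases "snd a \<ge> 0")
  case True
  from root_cases_nonneg[OF assms this] show ?thesis
    by (elim disjE exE conjE) (rule that, assumption+)+
next
  case False
  hence "(\<exists>i j. i \<noteq> j \<and> - a = diff_root i j) \<or> (\<exists>S. card S = 3 \<and> - a = set_root S) \<or> - a = top_root"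
    using root_cases_nonneg[OF roots_minus[OF assms]] by simp
  hence "(\<exists>i j. j \<noteq> i \<and> a = diff_root j i) \<or> (\<exists>S. card S = 3 \<and> a = - set_root S) \<or> a = - top_root"
    by (metis add.inverse_inverse diff_root_minus)
  thus ?thesis by (elim disjE exE conjE) (rule that, assumption+)+
qed

lemma finite_roots: "finite E6_roots"
proof (rule finite_subset)
  show "E6_roots \<subseteq> (\<lambda>(i, j). diff_root i j) ` UNIV \<union> range set_root \<union> uminus ` range set_root
      \<union> {top_root, - top_root}"
    by (rule subsetI, erule root_cases) (auto simp: image_iff)
qed simp

text \<open>Since (\<open>top_root\<close>, a) is the degree of a, the top root is linked to every
  root of nonzero degree. A root e_i - e_j of degree 0 is linked to e_S for any triple S that
  contains i but not j.\<close>

lemma roots_irreducible: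
  assumes "P \<subseteq> E6_roots" "P \<noteq> {}"
    and closed: "\<And>a b. a \<in> P \<Longrightarrow> b \<in> E6_roots \<Longrightarrow> ip a b \<noteq> 0 \<Longrightarrow> b \<in> P"
  shows "P = E6_roots"
proof -
  have top: "ip top_root a = snd a" if "a \<in> E6_roots" for a
    using that by (simp add: ip_top_root roots_sum)
  have adj: "\<exists>b\<in>E6_roots. ip a b \<noteq> 0 \<and> snd b \<noteq> 0" if a: "a \<in> E6_roots" for a
    using a
  proof (cases rule: root_cases)
    case (diff i j)
    obtain T where T: "T \<subseteq> UNIV - {i, j}" "card T = 2"
      using obtain_subset_with_card_n[of 2 "UNIV - {i, j}"] diff by (auto simp: card_Diff_subset)
    have "card (insert i T) = 3" using T by (subst card_insert_disjoint) auto
    moreover have "ip a (set_root (insert i T)) = 1"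
      using T diff by (auto simp: ip_diff_root set_root_def ind_def)
    ultimately show ?thesis using set_root_in
      by (intro bexI[of _ "set_root (insert i T)"]) (auto simp: set_root_def)
  qed (use a in \<open>auto intro!: bexI[of _ a] simp: roots_norm\<close>,
      (auto simp: set_root_def top_root_def)?)
  obtain a where a: "a \<in> P" using assms(2) by blast
  obtain b where b: "b \<in> E6_roots" "ip a b \<noteq> 0" "snd b \<noteq> 0" using adj a assms(1) by blast
  have "b \<in> P" using closed a b by blast
  hence topP: "top_root \<in> P" using closed[of b top_root] top[OF b(1)] b(3) top_root_in by (simp add: ip_sym)
  have "c \<in> P" if c: "c \<in> E6_roots" for c
  proof -
    obtain b where b: "b \<in> E6_roots" "ip c b \<noteq> 0" "snd b \<noteq> 0" using adj c by blast
    have "b \<in> P" using closed[OF topP b(1)] top[OF b(1)] b(3) by simp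
    thus ?thesis using closed[of b c] c b(2) by (simp add: ip_sym)
  qed
  with assms(1) show ?thesis by blast
qed

section \<open>The bracket on root elements\<close>

lemma elt_eq_iff:
  "X = Y \<longleftrightarrow> neg2 X = neg2 Y \<and> neg1 X = neg1 Y \<and> endS X = endS Y \<and> h0c X = h0c Y \<and>
    pos1 X = pos1 Y \<and> pos2 X = pos2 Y"
  using elt.expand by blast

lemmas elt_op_defs = zero_elt_def plus_elt_def minus_elt_def uminus_elt_def escale_def

lemma elt_sel [simp]:
  "neg2 0 = 0" "neg1 0 = 0" "endS 0 = 0" "h0c 0 = 0" "pos1 0 = 0" "pos2 0 = 0"
  "neg2 (X + Y) = neg2 X + neg2 Y" "neg1 (X + Y) = neg1 X + neg1 Y" "endS (X + Y) = endS X + endS Y"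
  "h0c (X + Y) = h0c X + h0c Y" "pos1 (X + Y) = pos1 X + pos1 Y" "pos2 (X + Y) = pos2 X + pos2 Y"
  "neg2 (X - Y) = neg2 X - neg2 Y" "neg1 (X - Y) = neg1 X - neg1 Y" "endS (X - Y) = endS X - endS Y"
  "h0c (X - Y) = h0c X - h0c Y" "pos1 (X - Y) = pos1 X - pos1 Y" "pos2 (X - Y) = pos2 X - pos2 Y"
  "neg2 (- X) = - neg2 X" "neg1 (- X) = - neg1 X" "endS (- X) = - endS X"
  "h0c (- X) = - h0c X" "pos1 (- X) = - pos1 X" "pos2 (- X) = - pos2 X"
  "neg2 (escale c X) = c *s neg2 X" "neg1 (escale c X) = c *s neg1 X"
  "endS (escale c X) = pscale c (endS X)" "h0c (escale c X) = c * h0c X"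
  "pos1 (escale c X) = c *s pos1 X" "pos2 (escale c X) = c *s pos2 X"
  by (simp_all add: elt_op_defs)

lemma mscale_simps:
  "mscale c (A + B) = mscale c A + mscale c B" "mscale c (A - B) = mscale c A - mscale c B"
  "mscale c (- A) = - mscale c A" "mscale c 0 = 0" "mscale 0 A = 0" "mscale 1 A = A"
  "mscale (c + d) A = mscale c A + mscale d A" "mscale (c - d) A = mscale c A - mscale d A"
  "mscale (- c) A = - mscale c A" "mscale c (mscale d A) = mscale (c * d) A"
  "transpose (mscale c A) = mscale c (transpose A)"
  by (simp_all add: mscale_def vec_eq_iff algebra_simps transpose_def)

lemma mscale_mult: "mscale c A ** B = mscale c (A ** B)" "A ** mscale c B = mscale c (A ** B)"
  by (simp_all add: mscale_def vec_eq_iff matrix_matrix_mult_def sum_distrib_left ac_simps)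

lemma matrix_mult_simps:
  fixes A B C :: mat6
  shows "(A + B) ** C = A ** C + B ** C" "A ** (B + C) = A ** B + A ** C"
    "(- A) ** B = - (A ** B)" "A ** (- B) = - (A ** B)" "0 ** A = 0" "A ** 0 = 0"
  by (simp_all add: vec_eq_iff matrix_matrix_mult_def algebra_simps sum.distrib sum_negf)

lemma ebr_sel:
  "neg2 (ebr X Y) = Der (fst (endS X)) (neg2 Y) - (2 * h0c X) *s neg2 Y
    - (Der (fst (endS Y)) (neg2 X) - (2 * h0c Y) *s neg2 X) + neg1 X \<and>\<^sub>e neg1 Y"
  "neg1 (ebr X Y) = Der (fst (endS X)) (neg1 Y) - h0c X *s neg1 Y + Delta (pos1 X) (neg2 Y)
    - (Der (fst (endS Y)) (neg1 X) - h0c Y *s neg1 X + Delta (pos1 Y) (neg2 X))"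
  "fst (endS (ebr X Y)) = E_op (neg1 X) (pos1 Y) - E_op (neg1 Y) (pos1 X)
    + mscale (scalar_part (Delta (neg2 X) (pos2 Y)) - scalar_part (Delta (neg2 Y) (pos2 X))) (mat 1)
    + (fst (endS X) ** fst (endS Y) - fst (endS Y) ** fst (endS X))"
  "snd (endS (ebr X Y)) = - E_op (pos1 Y) (neg1 X) + E_op (pos1 X) (neg1 Y)
    - mscale (scalar_part (Delta (neg2 X) (pos2 Y)) - scalar_part (Delta (neg2 Y) (pos2 X))) (mat 1)
    + (snd (endS X) ** snd (endS Y) - snd (endS Y) ** snd (endS X))"
  "h0c (ebr X Y) = scalar_part (Delta (neg1 X) (pos1 Y)) - scalar_part (Delta (neg1 Y) (pos1 X))
    + 2 * (scalar_part (Delta (neg2 X) (pos2 Y)) - scalar_part (Delta (neg2 Y) (pos2 X)))"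
  "pos1 (ebr X Y) = Der (snd (endS X)) (pos1 Y) + h0c X *s pos1 Y + Delta (neg1 X) (pos2 Y)
    - (Der (snd (endS Y)) (pos1 X) + h0c Y *s pos1 X + Delta (neg1 Y) (pos2 X))"
  "pos2 (ebr X Y) = Der (snd (endS X)) (pos2 Y) + (2 * h0c X) *s pos2 Y
    - (Der (snd (endS Y)) (pos2 X) + (2 * h0c Y) *s pos2 X) + pos1 X \<and>\<^sub>e pos1 Y"
  by (simp_all add: ebr_def mixed_product_def Let_def act_neg_def act_pos_def E_pair_def lieS_bracket_def
      h_M_def pscale_def mscale_simps algebra_simps)

lemma scalar_part_simps:
  "scalar_part 0 = 0" "scalar_part (x + y) = scalar_part x + scalar_part y"
  "scalar_part (c *s x) = c * scalar_part x" "scalar_part (- x) = - scalar_part x"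
  by (simp_all add: scalar_part_def)

lemmas bilinear_simps = Delta_simps Der_simps E_op_linear wedge_simps mscale_simps mscale_mult
  matrix_mult_simps scalar_part_simps

lemma ebr_add: "ebr (X + Y) Z = ebr X Z + ebr Y Z" "ebr X (Y + Z) = ebr X Y + ebr X Z"
  by (simp_all add: elt_eq_iff prod_eq_iff ebr_sel bilinear_simps algebra_simps vec.scale_left_distrib
      vec.scale_right_distrib)

lemma ebr_scale: "ebr (escale c X) Y = escale c (ebr X Y)" "ebr X (escale c Y) = escale c (ebr X Y)"
  by (simp_all add: elt_eq_iff prod_eq_iff ebr_sel bilinear_simps algebra_simps pscale_def
      vec.scale_right_distrib vec.scale_right_diff_distrib flip: mscale_simps(8))

interpretation elt_space: vector_space escale
  by (rule vector_space_escale)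

lemma ebr_minus: "ebr (- X) Y = - ebr X Y" "ebr X (- Y) = - ebr X Y"
  using ebr_scale(1)[of "-1" X Y] ebr_scale(2)[of X "-1" Y] by simp_all

text \<open>All contributions are skew by construction except the exterior products in degrees 2 and
  -2, and these anticommute for factors of odd degree; hence the assumptions on the components of
  degrees 1 and -1.\<close>

lemma ebr_swap:
  assumes "neg1 X \<in> ext_deg 3" "pos1 X \<in> ext_deg 3" "neg1 Y \<in> ext_deg 3" "pos1 Y \<in> ext_deg 3"
  shows "ebr Y X = - ebr X Y"
  using wedge_anticomm[OF assms(1,3)] wedge_anticomm[OF assms(2,4)]
  by (simp add: elt_eq_iff prod_eq_iff ebr_sel mscale_simps algebra_simps)

text \<open>An automorphism sending \<open>root_elt a\<close> to \<open>root_elt (- a)\<close>; it halves the number of products to compute.\<close>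

definition flip_elt :: "elt \<Rightarrow> elt" where
  "flip_elt X = Elt (pos2 X) (pos1 X) (snd (endS X), fst (endS X)) (- h0c X) (neg1 X) (neg2 X)"

text \<open>The two modules and their actions coincide here, so the bracket is symmetric under
  exchanging the signs, with \<open>h_M\<close> and \<open>h_zero\<close> changing sign. The
  coefficient of \<open>h_zero\<close> needs the symmetry of the scalar contraction.\<close>

lemma flip_elt_ebr: "ebr (flip_elt X) (flip_elt Y) = flip_elt (ebr X Y)"
  by (simp add: elt_eq_iff prod_eq_iff ebr_sel flip_elt_def mscale_simps scalar_Delta_comm algebra_simps)

lemma flip_elt_simps:
  "flip_elt (escale c X) = escale c (flip_elt X)" "flip_elt (- X) = - flip_elt X" "flip_elt 0 = 0"
  "flip_elt (flip_elt X) = X"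
  by (simp_all add: elt_eq_iff prod_eq_iff flip_elt_def pscale_def)

definition diag_mat :: "complex ^ 6 \<Rightarrow> mat6" where
  "diag_mat d = (\<chi> i j. if i = j then d $ i else 0)"

text \<open>The coefficient of \<open>h_zero\<close> is the one forced by the trace condition of
  \<open>E_alg\<close>, so these are the elements of \<open>E_alg\<close> whose only part is a
  diagonal one in degree 0.\<close>

definition h_elt :: "complex ^ 6 \<Rightarrow> elt" where
  "h_elt d = Elt 0 0 (- diag_mat d, diag_mat d) (- (\<Sum>i\<in>UNIV. d $ i) / 3) 0 0"

definition coroot_elt :: "lat \<Rightarrow> elt" where
  "coroot_elt a = h_elt (\<chi> i. of_int (fst a $ i))"

text \<open>Plain matrix units satisfy [E_ij, E_jl] = E_il for i \<noteq> l, without a sign. The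
  factor \<open>ext_sign {p} {q}\<close> is the rescaling under which this product acquires the
  structure constant \<open>eps\<close>.\<close>

definition root_mat :: "lat \<Rightarrow> mat6" where
  "root_mat a = (\<chi> p q. if fst a $ p = 1 \<and> fst a $ q = -1 then ext_sign {p} {q} else 0)"

text \<open>
  Since \<open>v_minus S = - axis S 1\<close> for \<open>|S| = 3\<close> and \<open>|S| = 6\<close>, the sign changes that make \<open>eps\<close> the
  structure constants turn the elements of nonzero degree into plain monomials.
\<close>

definition root_elt :: "lat \<Rightarrow> elt" where
  "root_elt a =
    (if snd a = 0 then Elt 0 0 (- transpose (root_mat a), root_mat a) 0 0 0
     else if snd a = 1 then Elt 0 0 0 0 (axis {i. fst a $ i = 1} 1) 0
     else if snd a = 2 then Elt 0 0 0 0 0 (axis UNIV 1)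
     else if snd a = -1 then Elt 0 (axis {i. fst a $ i = -1} 1) 0 0 0 0
     else Elt (axis UNIV 1) 0 0 0 0 0)"

lemma root_mat_diff: "i \<noteq> j \<Longrightarrow> root_mat (diff_root i j) = mscale (ext_sign {i} {j}) (munit i j)"
  by (auto simp: root_mat_def diff_root_def ind_def mscale_def munit_def vec_eq_iff)

lemma root_elt_diff: "i \<noteq> j \<Longrightarrow> root_elt (diff_root i j) = escale (ext_sign {i} {j}) (iota_plus (munit i j))"
  by (simp add: root_elt_def root_mat_diff)
    (simp add: diff_root_def iota_plus_def escale_def pscale_def adj_eq_transpose mscale_simps)

lemma root_elt_set: "root_elt (set_root S) = Elt 0 0 0 0 (axis S 1) 0"
  "root_elt (- set_root S) = Elt 0 (axis S 1) 0 0 0 0"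
  by (simp_all add: root_elt_def set_root_def ind_def)

lemma root_elt_top: "root_elt top_root = Elt 0 0 0 0 0 (axis UNIV 1)"
  "root_elt (- top_root) = Elt (axis UNIV 1) 0 0 0 0 0"
  by (simp_all add: root_elt_def top_root_def)

lemma ext_sign_singletons: "i \<noteq> j \<Longrightarrow> ext_sign {i} {j} = - ext_sign {j} {i}"
proof -
  assume "i \<noteq> j"
  hence "ext_sign {i} {j} * ext_sign {j} {i} = -1" using ext_sign_swap[of "{i}" "{j}"] by simp
  hence "ext_sign {i} {j} * (ext_sign {j} {i} * ext_sign {j} {i}) = - ext_sign {j} {i}"
    by (simp only: mult.assoc[symmetric]) simp
  thus ?thesis by simp
qed

lemma transpose_munit: "transpose (munit i j) = munit j i"
  by (auto simp: transpose_def munit_def vec_eq_iff)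

lemma flip_root_elt: "a \<in> E6_roots \<Longrightarrow> flip_elt (root_elt a) = root_elt (- a)"
proof (cases rule: root_cases)
  fix i j assume "i \<noteq> j" "a = diff_root i j"
  thus ?thesis
    using ext_sign_singletons[of i j]
    by (simp add: diff_root_minus root_elt_diff flip_elt_simps)
      (simp add: flip_elt_def iota_plus_def adj_eq_transpose transpose_munit elt_eq_iff prod_eq_iff pscale_def mscale_simps)
qed (auto simp: root_elt_set root_elt_top flip_elt_def zero_prod_def)

lemma coroot_elt_minus: "coroot_elt (- a) = - coroot_elt a"
  by (simp add: coroot_elt_def h_elt_def elt_eq_iff prod_eq_iff diag_mat_def vec_eq_iff sum_negf)

lemma flip_coroot_elt: "flip_elt (coroot_elt a) = coroot_elt (- a)"
  by (simp add: coroot_elt_def h_elt_def flip_elt_def elt_eq_iff prod_eq_iff diag_mat_def vec_eq_iff sum_negf)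

text \<open>One predicate for the three kinds of product lets the exchange of the factors and the
  passage to negatives be proved once. For roots the clauses exhaust all pairs, since (a, b) = -2
  forces b = -a.\<close>

definition product_rule :: "lat \<Rightarrow> lat \<Rightarrow> bool" where
  "product_rule a b \<longleftrightarrow>
    (ip a b = -1 \<longrightarrow> ebr (root_elt a) (root_elt b) = escale (eps a b) (root_elt (a + b))) \<and>
    (b = - a \<longrightarrow> ebr (root_elt a) (root_elt b) = - coroot_elt a) \<and>
    (ip a b \<ge> 0 \<longrightarrow> ebr (root_elt a) (root_elt b) = 0)"

lemma root_elt_deg:
  assumes "a \<in> E6_roots"
  shows "neg2 (root_elt a) \<in> ext_deg 6" "neg1 (root_elt a) \<in> ext_deg 3"
    "pos1 (root_elt a) \<in> ext_deg 3" "pos2 (root_elt a) \<in> ext_deg 6"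
proof -
  have 0: "0 \<in> ext_deg k" for k by (simp add: ext_deg_def)
  have 6: "axis (UNIV :: 6 set) 1 \<in> ext_deg 6" using axis_deg[of "UNIV :: 6 set"] by simp
  have 3: "axis S 1 \<in> ext_deg 3" if "card S = 3" for S :: "6 set" using axis_deg[of S] that by simp
  show "neg2 (root_elt a) \<in> ext_deg 6" "neg1 (root_elt a) \<in> ext_deg 3"
    "pos1 (root_elt a) \<in> ext_deg 3" "pos2 (root_elt a) \<in> ext_deg 6"
    using assms by (cases rule: root_cases;
      simp add: root_elt_diff root_elt_set root_elt_top 0 3 6; simp add: iota_plus_def 0)+
qed

lemma product_rule_sym:
  assumes "a \<in> E6_roots" "b \<in> E6_roots" "product_rule a b"
  shows "product_rule b a"
proof -
  have swap: "ebr (root_elt b) (root_elt a) = - ebr (root_elt a) (root_elt b)"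
    using assms root_elt_deg by (intro ebr_swap) auto
  show ?thesis
    using assms(3) eps_anticomm[OF assms(1,2)] unfolding product_rule_def swap
    by (auto simp: ip_sym[of b a] add.commute[of b a] coroot_elt_minus)
qed

text \<open>\<open>flip_elt\<close> replaces both roots by their negatives, and \<open>eps\<close>
  does not change.\<close>

lemma product_rule_minus:
  assumes "a \<in> E6_roots" "b \<in> E6_roots" "product_rule a b"
  shows "product_rule (- a) (- b)"
proof -
  have flip: "ebr (root_elt (- a)) (root_elt (- b)) = flip_elt (ebr (root_elt a) (root_elt b))"
    using assms by (simp add: flip_elt_ebr flip: flip_root_elt)
  have "flip_elt (root_elt (a + b)) = root_elt (- a + - b)" if "ip a b = -1"
    using flip_root_elt[OF roots_add[OF assms(1,2) that]] by simp
  thus ?thesis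
    using assms(3) unfolding product_rule_def flip
    by (auto simp: ip_minus eps_minus flip_elt_simps flip_coroot_elt coroot_elt_minus)
qed

section \<open>Brackets of explicit root elements\<close>

lemma transpose_diff: "transpose (A - B) = transpose A - transpose B"
  by (simp add: transpose_def vec_eq_iff)

lemma ebr_iota: "ebr (iota_plus A) (iota_plus B) = iota_plus (A ** B - B ** A)"
  by (simp add: iota_plus_def adj_eq_transpose elt_eq_iff prod_eq_iff ebr_sel bilinear_simps
      matrix_transpose_mul transpose_diff)

lemma munit_mult: "munit i j ** munit k l = (if j = k then munit i l else 0)"
proof -
  have "(munit i j ** munit k l) $ p $ q = (\<Sum>r\<in>UNIV. if r = j then (if p = i \<and> j = k \<and> q = l then 1 else 0) else 0)" for p q
    unfolding munit_def matrix_matrix_mult_def vec_lambda_beta by (intro sum.cong) auto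
  thus ?thesis by (auto simp: vec_eq_iff munit_def)
qed

lemma iota_linear: "iota_plus 0 = 0" "iota_plus (- A) = - iota_plus A"
  "iota_plus (mscale c A) = escale c (iota_plus A)"
  by (simp_all add: iota_plus_def adj_eq_transpose elt_eq_iff prod_eq_iff transpose_def vec_eq_iff
      pscale_def mscale_def)

lemma iota_add: "iota_plus (A + B) = iota_plus A + iota_plus B"
  by (simp add: iota_plus_def adj_eq_transpose elt_eq_iff prod_eq_iff transpose_def vec_eq_iff)

lemma coroot_elt_diff: "coroot_elt (diff_root i j) = iota_plus (munit i i - munit j j)"
proof -
  have "diag_mat (\<chi> l. of_int (fst (diff_root i j) $ l)) = munit i i - munit j j"
    by (auto simp: diag_mat_def diff_root_def ind_def munit_def vec_eq_iff)
  moreover have "transpose (munit i i - munit j j) = munit i i - munit j j"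
    by (auto simp: transpose_def munit_def vec_eq_iff)
  moreover have "(\<Sum>l\<in>UNIV. of_int (fst (diff_root i j) $ l) :: complex) = of_int (\<Sum>l\<in>UNIV. fst (diff_root i j) $ l)"
    by simp
  hence "(\<Sum>l\<in>UNIV. of_int (fst (diff_root i j) $ l) :: complex) = 0"
    by (simp only:) (simp add: diff_root_def sum_subtractf sum_ind)
  ultimately show ?thesis
    by (simp add: coroot_elt_def h_elt_def iota_plus_def adj_eq_transpose)
qed

lemma eps_diff_diff:
  "eps (diff_root i j) (diff_root k l) =
    ext_sign {i} {k} * ext_sign {i} {l} * ext_sign {j} {k} * ext_sign {j} {l}"
  by (simp add: eps_diff_root eps_ind)

lemma ext_sign_self [simp]: "ext_sign {i} {i} = 1"
proof -
  have "{(s, t). s \<in> {i} \<and> t \<in> {i} \<and> t < s} = {}" by auto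
  thus ?thesis by (simp only: ext_sign_def) simp
qed

text \<open>The commutator of matrix units has the terms E_il for j = k and -E_kj for l = i. The
  four cases say which of them occur; when both do, the product of the two signs is -1 and yields
  minus the coroot.\<close>

lemma product_rule_diff_diff:
  assumes ij: "i \<noteq> j" and kl: "k \<noteq> l"
  shows "product_rule (diff_root i j) (diff_root k l)"
proof -
  have br: "ebr (root_elt (diff_root i j)) (root_elt (diff_root k l))
      = escale (ext_sign {i} {j} * ext_sign {k} {l})
          (iota_plus ((if j = k then munit i l else 0) - (if l = i then munit k j else 0)))"
    using ij kl by (simp add: root_elt_diff ebr_scale ebr_iota munit_mult)
  have ip: "ip (diff_root i j) (diff_root k l) =
      (if i = k then 1 else 0) - (if i = l then 1 else 0) - (if j = k then 1 else 0) + (if j = l then 1 else 0)"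
    unfolding ip_diff_root by (simp add: diff_root_def ind_def)
  consider "j = k" "l = i" | "j = k" "l \<noteq> i" | "j \<noteq> k" "l = i" | "j \<noteq> k" "l \<noteq> i" by blast
  thus ?thesis
  proof cases
    case 1
    thus ?thesis
      using ij ext_sign_singletons[OF ij] unfolding product_rule_def br ip
      by (auto simp: coroot_elt_diff diff_root_minus elt_eq_iff)
  next
    case 2
    have "diff_root i j + diff_root k l = diff_root i l" "diff_root k l \<noteq> - diff_root i j"
      using 2 ij kl by (auto simp: diff_root_def ind_def vec_eq_iff)
    thus ?thesis using 2 ij kl unfolding product_rule_def br ip
      by (auto simp: eps_diff_diff root_elt_diff ac_simps)
  next
    case 3
    have "diff_root i j + diff_root k l = diff_root k j" "diff_root k l \<noteq> - diff_root i j"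
      using 3 ij kl by (auto simp: diff_root_def ind_def vec_eq_iff)
    thus ?thesis using 3 ij kl ext_sign_singletons[of i k] ext_sign_singletons[of j k]
      ext_sign_singletons[of j i] unfolding product_rule_def br ip
      by (auto simp: eps_diff_diff root_elt_diff iota_linear)
  next
    case 4
    hence "diff_root k l \<noteq> - diff_root i j" using ij kl
      by (auto simp: diff_root_def ind_def vec_eq_iff)
    thus ?thesis using 4 ij kl unfolding product_rule_def br ip by (auto simp: iota_linear)
  qed
qed

lemma snd_root [simp]: "snd (diff_root i j) = 0" "snd (set_root S) = 1" "snd top_root = 2"
  by (simp_all add: diff_root_def set_root_def top_root_def)

lemma root_eq_minusD: "b = - a \<Longrightarrow> snd b = - snd (a :: lat)"
  by simp

text \<open>The inversions are the pairs t < s in S. This is also the sign of reversing a monomial,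
  so \<open>eps\<close> absorbs the sign that \<open>Delta_axis\<close> carries.\<close>

lemma ext_sign_same: "ext_sign S S = (-1) ^ (card S choose 2)"
  using finite[of S]
proof (induction S rule: finite_induct)
  case (insert i S)
  have "ext_sign ({i} \<union> S) ({i} \<union> S)
      = (ext_sign {i} {i} * ext_sign {i} S) * (ext_sign S {i} * ext_sign S S)"
    using insert.hyps by (simp only: ext_sign_Un_left ext_sign_Un_right Int_insert_left Int_empty_left if_False)
      (simp only: ac_simps)
  also have "\<dots> = (ext_sign {i} S * ext_sign S {i}) * ext_sign S S" by simp
  also have "\<dots> = (-1) ^ card S * (-1) ^ (card S choose 2)"
    using insert ext_sign_swap[of "{i}" S] by simp
  also have "\<dots> = (-1) ^ (card (insert i S) choose 2)"
    using insert.hyps by (simp add: numeral_2_eq_2 power_add)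
  finally show ?case by simp
qed (simp add: binomial_eq_0)

lemma ebr_iota_pos:
  "ebr (iota_plus A) (Elt 0 0 0 0 x y) = Elt 0 0 0 0 (Der A x) (Der A y)"
  by (simp add: iota_plus_def elt_eq_iff prod_eq_iff ebr_sel bilinear_simps)

text \<open>E_ij replaces the factor j by i. The result is nonzero exactly if j is in S and i is
  not, and this is the condition (a, b) = -1.\<close>

lemma product_rule_diff_set:
  assumes ij: "i \<noteq> j" and S: "card S = 3"
  shows "product_rule (diff_root i j) (set_root S)"
proof -
  have ip: "ip (diff_root i j) (set_root S) = (if i \<in> S then 1 else 0) - (if j \<in> S then 1 else 0)"
    by (simp add: ip_diff_root set_root_def ind_def)
  have der: "Der (munit i j) (axis S 1) = (if j \<in> S \<and> i \<notin> S
      then (ext_sign {j} (S - {j}) * ext_sign {i} (S - {j})) *s axis (insert i (S - {j})) 1 else 0)"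
    using ij by (auto simp: Der_munit Delta1_axis wedge_simps gen_axis wedge_axis)
  have br: "ebr (root_elt (diff_root i j)) (root_elt (set_root S))
      = escale (ext_sign {i} {j}) (Elt 0 0 0 0 (Der (munit i j) (axis S 1)) 0)"
    using ij by (simp add: root_elt_diff root_elt_set ebr_scale ebr_iota_pos Der_simps)
  have ne: "set_root S \<noteq> - diff_root i j" by (auto dest: root_eq_minusD)
  show ?thesis
  proof (cases "j \<in> S \<and> i \<notin> S")
    case True
    define P where "P = S - {j}"
    have SP: "S = {j} \<union> P" "{j} \<inter> P = {}" using True by (auto simp: P_def)
    have sum: "diff_root i j + set_root S = set_root (insert i P)"
      using True ij by (auto simp: diff_root_def set_root_def ind_def vec_eq_iff P_def)
    have "eps (diff_root i j) (set_root S) = ext_sign {i} S * ext_sign {j} S"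
      by (simp add: eps_diff_root set_root_def eps_ind)
    also have "\<dots> = ext_sign {i} {j} * (ext_sign {j} P * ext_sign {i} P)"
      unfolding SP(1) ext_sign_Un_right[OF SP(2)] by (simp add: ac_simps)
    finally have eps: "eps (diff_root i j) (set_root S) = ext_sign {i} {j} * (ext_sign {j} P * ext_sign {i} P)" .
    have "ebr (root_elt (diff_root i j)) (root_elt (set_root S))
        = escale (eps (diff_root i j) (set_root S)) (root_elt (diff_root i j + set_root S))"
      unfolding br unfolding der eps sum root_elt_set using True
      by (simp add: escale_def pscale_def mscale_simps P_def zero_prod_def)
    thus ?thesis using True ne by (simp add: product_rule_def ip)
  next
    case False
    thus ?thesis using ne unfolding product_rule_def br der ip by (auto simp: elt_eq_iff prod_eq_iff pscale_def mscale_simps)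
  qed
qed

lemma product_rule_diff_top:
  assumes ij: "i \<noteq> j"
  shows "product_rule (diff_root i j) top_root"
proof -
  have "Der (munit i j) (axis UNIV 1) = 0"
    using ij by (auto simp: Der_munit Delta1_axis wedge_simps gen_axis wedge_axis)
  hence "ebr (root_elt (diff_root i j)) (root_elt top_root) = 0"
    using ij by (simp add: root_elt_diff root_elt_top ebr_scale ebr_iota_pos Der_simps elt_eq_iff
        prod_eq_iff pscale_def mscale_simps)
  moreover have "ip (diff_root i j) top_root = 0" by (simp add: ip_diff_root top_root_def ind_def)
  moreover have "top_root \<noteq> - diff_root i j" by (auto dest: root_eq_minusD)
  ultimately show ?thesis by (simp add: product_rule_def)
qed

lemma ip_set_set: "ip (set_root S) (set_root T) = int (card (S \<inter> T)) - 1"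
  by (simp add: ip_set_root) (simp add: set_root_def sum_ind_Int)

text \<open>The product of the roots is |S \<inter> T| - 1, so the value -1 means disjoint triples;
  these are complementary and multiply to the volume form up to \<open>ext_sign S T\<close>.\<close>

lemma product_rule_set_set:
  assumes S: "card S = 3" and T: "card T = 3"
  shows "product_rule (set_root S) (set_root T)"
proof -
  have br: "ebr (root_elt (set_root S)) (root_elt (set_root T)) = Elt 0 0 0 0 0 (axis S 1 \<and>\<^sub>e axis T 1)"
    by (simp add: root_elt_set elt_eq_iff prod_eq_iff ebr_sel bilinear_simps)
  have ne: "set_root T \<noteq> - set_root S" by (auto dest: root_eq_minusD)
  show ?thesis
  proof (cases "S \<inter> T = {}")
    case True
    have "card (S \<union> T) = card (UNIV :: 6 set)" using True S T by (simp add: card_Un_disjoint)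
    hence U: "S \<union> T = UNIV" by (intro card_subset_eq) auto
    have "x \<in> S \<or> x \<in> T" "\<not> (x \<in> S \<and> x \<in> T)" for x using True U by blast+
    hence sum: "set_root S + set_root T = top_root"
      by (auto simp: set_root_def top_root_def ind_def vec_eq_iff)
    moreover have "eps (set_root S) (set_root T) = ext_sign S T" by (simp add: set_root_def eps_ind)
    ultimately show ?thesis using True U ne
      unfolding product_rule_def br ip_set_set sum root_elt_top
      by (simp add: wedge_axis escale_def pscale_def mscale_simps zero_prod_def)
  next
    case False
    hence "card (S \<inter> T) \<noteq> 0" by simp
    thus ?thesis using False ne unfolding product_rule_def br ip_set_set by (auto simp: wedge_axis elt_eq_iff)
  qed
qed

lemma product_rule_top: "product_rule top_root top_root" "card S = 3 \<Longrightarrow> product_rule (set_root S) top_root"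
proof -
  have "ebr (root_elt top_root) (root_elt top_root) = 0" "ebr (root_elt (set_root S)) (root_elt top_root) = 0"
    by (simp_all add: root_elt_set root_elt_top elt_eq_iff prod_eq_iff ebr_sel bilinear_simps)
  moreover have "top_root \<noteq> - top_root" "top_root \<noteq> - set_root S"
    by (auto dest: root_eq_minusD)
  moreover have "ip top_root top_root = 2" using roots_norm[OF top_root_in] .
  moreover have "card S = 3 \<Longrightarrow> ip (set_root S) top_root = 1"
    by (simp add: ip_set_root) (simp add: top_root_def ind_def)
  ultimately show "product_rule top_root top_root" "card S = 3 \<Longrightarrow> product_rule (set_root S) top_root"
    by (simp_all add: product_rule_def)
qed

text \<open>\<open>ext_sign S UNIV\<close> splits along S and its complement; the factor
  \<open>ext_sign S S\<close> is the reversal sign of the contraction, and the other factor is the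
  sign of removing S.\<close>

lemma product_rule_set_minus_top:
  assumes S: "card S = 3"
  shows "product_rule (set_root S) (- top_root)"
proof -
  have U: "S \<union> (UNIV - S) = UNIV" "S \<inter> (UNIV - S) = {}" by auto
  have "eps (set_root S) (- top_root) = ext_sign S (S \<union> (UNIV - S))"
    unfolding U eps_minus set_root_def top_root_def eps_ind ..
  also have "\<dots> = ext_sign S S * ext_sign S (UNIV - S)" by (rule ext_sign_Un_right[OF U(2)])
  finally have eps: "eps (set_root S) (- top_root) = (-1) ^ (card S choose 2) * ext_sign S (UNIV - S)"
    by (simp add: ext_sign_same)
  have "set_root S + - top_root = - set_root (UNIV - S)"
    by (auto simp: set_root_def top_root_def ind_def vec_eq_iff)
  moreover have "ebr (root_elt (set_root S)) (root_elt (- top_root)) = Elt 0 (Delta (axis S 1) (axis UNIV 1)) 0 0 0 0"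
    by (simp add: root_elt_set root_elt_top elt_eq_iff prod_eq_iff ebr_sel bilinear_simps)
  moreover have "ip (set_root S) (- top_root) = -1"
    using S by (simp add: ip_minus ip_set_root) (simp add: top_root_def ind_def)
  moreover have "- top_root \<noteq> - set_root S" by (auto dest: arg_cong[of _ _ snd])
  ultimately show ?thesis
    unfolding product_rule_def eps
    by (simp only: root_elt_set) (simp add: Delta_axis escale_def pscale_def mscale_simps prod_eq_iff)
qed

lemma choose_2: "3 choose 2 = (3 :: nat)" "6 choose 2 = (15 :: nat)"
  by (simp_all add: numeral_eq_Suc)

text \<open>The two volume forms contract to -1, as reversing six factors has sign (-1)^15. Hence
  the bracket is \<open>h_M\<close> minus twice \<open>h_zero\<close>, which is the coroot of
  \<open>top_root\<close>, the coefficient -2 being -6/3.\<close>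

lemma product_rule_minus_top_top: "product_rule (- top_root) top_root"
proof -
  have c: "scalar_part (Delta (axis (UNIV :: 6 set) 1) (axis UNIV 1)) = -1"
    by (simp add: Delta_axis scalar_part_simps choose_2) (simp add: scalar_part_def axis_def)
  have "diag_mat 1 = mat 1" by (simp add: diag_mat_def mat_def vec_eq_iff)
  moreover have "(\<chi> i. of_int (fst top_root $ i)) = (1 :: complex ^ 6)"
    by (simp add: top_root_def ind_def vec_eq_iff)
  ultimately have "ebr (root_elt (- top_root)) (root_elt top_root) = - coroot_elt (- top_root)"
    unfolding coroot_elt_minus by (simp add: coroot_elt_def h_elt_def root_elt_top elt_eq_iff
        prod_eq_iff ebr_sel bilinear_simps c)
  thus ?thesis by (simp add: product_rule_def ip_minus roots_norm[OF top_root_in])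
qed

lemma ext_sign_comm_even:
  assumes "A \<inter> B = {}" "even (card A * card B)"
  shows "ext_sign A B = ext_sign B A"
proof -
  have "ext_sign A B * (ext_sign B A * ext_sign B A) = ext_sign B A"
    using ext_sign_swap[OF assms(1)] assms(2) by (simp only: mult.assoc[symmetric]) simp
  thus ?thesis by simp
qed

text \<open>Here (a, b) = 1 - |S \<inter> T|. For S = T the operators are diagonal, for |S \<inter>
  T| = 2 they exchange one index for another, and for smaller intersections they vanish, because two
  elements of S would have to lie in T.\<close>

lemma product_rule_minus_set_set:
  assumes S: "card S = 3" and T: "card T = 3"
  shows "product_rule (- set_root S) (set_root T)"
proof -
  have br: "ebr (root_elt (- set_root S)) (root_elt (set_root T))
      = Elt 0 0 (E_op (axis S 1) (axis T 1), - E_op (axis T 1) (axis S 1))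
          (scalar_part (Delta (axis S 1) (axis T 1))) 0 0"
    by (simp add: root_elt_set elt_eq_iff prod_eq_iff ebr_sel bilinear_simps)
  have ip: "ip (- set_root S) (set_root T) = 1 - int (card (S \<inter> T))"
    by (simp add: ip_minus ip_set_set)
  have scalar: "scalar_part (Delta (axis S 1) (axis T 1)) = (if S = T then -1 else 0)"
  proof (cases "S \<subseteq> T")
    case True
    hence "S = T" using S T by (intro card_subset_eq) auto
    thus ?thesis by (simp add: Delta_axis S choose_2) (simp add: scalar_part_def T choose_2 axis_def)
  next
    case False
    thus ?thesis by (auto simp: Delta_axis scalar_part_def)
  qed
  have eq_iff: "set_root T = - (- set_root S) \<longleftrightarrow> S = T"
    by (auto simp: set_root_def ind_def vec_eq_iff split: if_splits)
  consider "S = T" | "S \<noteq> T" "card (S \<inter> T) = 2" | "S \<noteq> T" "card (S \<inter> T) \<le> 1"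
  proof (cases "card (S \<inter> T) \<le> 2")
    case False
    hence "card (S \<inter> T) \<ge> card S" using S by simp
    hence "S \<inter> T = S" by (intro card_seteq) auto
    hence "S = T" using S T by (intro card_subset_eq) auto
    thus ?thesis using that by blast
  qed (use that in linarith)
  thus ?thesis
  proof cases
    case 1
    have "E_op (axis S 1) (axis S 1) $ t $ s = - diag_mat (\<chi> i. of_int (fst (set_root S) $ i)) $ t $ s" for s t
    proof (cases "s \<in> S")
      case True
      hence "S - (S - {s}) = {s}" "card (S - {s}) = 2" using S by auto
      moreover have "ext_sign {s} (S - {s}) * ext_sign (S - {s}) {s} = 1"
        using ext_sign_swap[of "{s}" "S - {s}"] \<open>card (S - {s}) = 2\<close> by simp
      ultimately show ?thesis using True
        by (auto simp: E_op_axis diag_mat_def set_root_def ind_def)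
    qed (simp add: E_op_axis diag_mat_def set_root_def ind_def)
    hence "E_op (axis S 1) (axis S 1) = - diag_mat (\<chi> i. of_int (fst (set_root S) $ i))"
      by (simp add: vec_eq_iff)
    moreover have "(\<Sum>i\<in>UNIV. of_int (fst (set_root S) $ i) :: complex) = of_int (\<Sum>i\<in>UNIV. fst (set_root S) $ i)"
      by simp
    hence "(\<Sum>i\<in>UNIV. of_int (fst (set_root S) $ i) :: complex) = 3"
      by (simp only:) (simp add: set_root_def sum_ind S)
    ultimately have "ebr (root_elt (- set_root S)) (root_elt (set_root T)) = - coroot_elt (- set_root S)"
      unfolding br scalar coroot_elt_minus using 1 by (simp add: coroot_elt_def h_elt_def)
    thus ?thesis unfolding product_rule_def ip using 1 S by simp
  next
    case 2
    define P where "P = S \<inter> T"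
    have P: "card P = 2" using 2 by (simp add: P_def)
    have "card (S - P) = 1" "card (T - P) = 1"
      using S T P card_Diff_subset[of P S] card_Diff_subset[of P T] by (auto simp: P_def)
    then obtain s0 t0 where st: "S - P = {s0}" "T - P = {t0}" by (auto simp: card_1_singleton_iff)
    have Seq: "S = insert s0 P" "s0 \<notin> P" and Teq: "T = insert t0 P" "t0 \<notin> P" and ne: "s0 \<noteq> t0"
      using st by (auto simp: P_def)
    \<comment> \<open>Kept general in S and T because the bracket needs it twice, with the roles
      exchanged between the two components of \<open>endS\<close>.\<close>
    have Eop: "E_op (axis T 1) (axis S 1) = mscale (- (ext_sign {s0} P * ext_sign P {t0})) (munit t0 s0)"
      if Seq: "S = insert s0 P" "s0 \<notin> P" and Teq: "T = insert t0 P" "t0 \<notin> P" and ne: "s0 \<noteq> t0"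
      for S T s0 t0
    proof -
      have "E_op (axis T 1) (axis S 1) $ t $ s
          = mscale (- (ext_sign {s0} P * ext_sign P {t0})) (munit t0 s0) $ t $ s" for s t
      proof (cases "s = s0")
        case True
        have "S - {s} = P" "T - P = {t0}" using Seq Teq True by auto
        thus ?thesis using Seq Teq True P by (auto simp: E_op_axis mscale_def munit_def)
      next
        case False
        hence "\<not> S - {s} \<subseteq> T" using Seq Teq ne by auto
        thus ?thesis using False by (auto simp: E_op_axis mscale_def munit_def)
      qed
      thus ?thesis by (simp add: vec_eq_iff)
    qed
    \<comment> \<open>No sign arises since P has the even cardinality 2. This makes the two
      components negative transposes of each other.\<close>
    have comm: "ext_sign {x} P = ext_sign P {x}" if "x \<notin> P" for x
      using that P by (intro ext_sign_comm_even) auto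
    have "ext_sign ({s0} \<union> P) ({t0} \<union> P)
        = (ext_sign {s0} {t0} * ext_sign {s0} P) * (ext_sign P {t0} * ext_sign P P)"
    proof -
      have "{s0} \<inter> P = {}" "{t0} \<inter> P = {}" using Seq(2) Teq(2) by auto
      thus ?thesis by (simp only: ext_sign_Un_left ext_sign_Un_right ac_simps)
    qed
    hence "eps (- set_root S) (set_root T) = - (ext_sign {s0} {t0} * ext_sign {s0} P * ext_sign P {t0})"
      unfolding eps_minus using P by (simp add: set_root_def eps_ind ext_sign_same Seq(1) Teq(1))
    hence eps: "eps (- set_root S) (set_root T) * ext_sign {t0} {s0} = ext_sign {s0} P * ext_sign P {t0}"
      using ext_sign_singletons[OF ne] by (simp add: mult.assoc mult.left_commute)
    have sum: "- set_root S + set_root T = diff_root t0 s0"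
      using Seq Teq ne by (auto simp: set_root_def diff_root_def ind_def vec_eq_iff)
    have "ebr (root_elt (- set_root S)) (root_elt (set_root T))
        = escale (eps (- set_root S) (set_root T)) (root_elt (- set_root S + set_root T))"
      unfolding br scalar sum root_elt_diff[OF ne[symmetric]] Eop[OF Seq Teq ne] Eop[OF Teq Seq ne[symmetric]]
      using 2 comm Seq(2) Teq(2)
      by (simp add: eps elt_eq_iff iota_plus_def adj_eq_transpose transpose_munit prod_eq_iff pscale_def
          mscale_simps mult.commute)
    thus ?thesis using 2 eq_iff unfolding product_rule_def ip by simp
  next
    case 3
    have "E_op (axis T 1) (axis S 1) = 0" if "card (S \<inter> T) \<le> 1" "card S = 3" for S T
    proof -
      have "\<not> S - {s} \<subseteq> T" if "s \<in> S" for s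
      proof
        assume "S - {s} \<subseteq> T"
        hence "card (S - {s}) \<le> card (S \<inter> T)" by (intro card_mono) auto
        thus False using \<open>card (S \<inter> T) \<le> 1\<close> \<open>card S = 3\<close> that by simp
      qed
      thus ?thesis by (auto simp: vec_eq_iff E_op_axis)
    qed
    from this[of S T] this[of T S] have "ebr (root_elt (- set_root S)) (root_elt (set_root T)) = 0"
      unfolding br scalar using 3 S T by (simp add: Int_commute zero_elt_def prod_eq_iff)
    thus ?thesis using 3 eq_iff unfolding product_rule_def ip by simp
  qed
qed

text \<open>The explicit brackets treat the pairs (a, b) and (-a, b) for degrees 0 \<le> deg a \<le>
  deg b. Exchanging the factors and negating both roots reaches all other pairs.\<close>

lemma product_rule_roots:
  assumes "a \<in> E6_roots" "b \<in> E6_roots"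
  shows "product_rule a b"
proof -
  note mem = diff_root_in set_root_in top_root_in
  have nonneg: "product_rule a b" if "a \<in> E6_roots" "b \<in> E6_roots" "snd a \<ge> 0" "snd b \<ge> snd a" for a b
    using root_cases_nonneg[OF that(1,3)] root_cases_nonneg[OF that(2)] that(3,4)
    by (auto intro: product_rule_diff_diff product_rule_diff_set product_rule_diff_top product_rule_set_set product_rule_top)
  have pos_neg: "product_rule (- a) b" if "a \<in> E6_roots" "b \<in> E6_roots" "snd a \<ge> 0" "snd b \<ge> snd a" for a b
  proof (cases "snd a = 0")
    case True
    hence "product_rule (- a) b" if "snd (- a) \<ge> 0" using nonneg[of "- a" b] \<open>a \<in> E6_roots\<close> \<open>b \<in> E6_roots\<close>
        \<open>snd b \<ge> snd a\<close> roots_minus by simp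
    thus ?thesis using True by simp
  next
    case False
    have "product_rule (- set_root S) top_root" if "card S = 3" for S
      using product_rule_minus[OF _ _ product_rule_set_minus_top[OF that]] mem that roots_minus by simp
    thus ?thesis
      using root_cases_nonneg[OF that(1,3)] root_cases_nonneg[OF that(2)] that(3,4) False
      by (auto intro: product_rule_minus_set_set product_rule_minus_top_top)
  qed
  have neg: "product_rule (- a) b" if "a \<in> E6_roots" "b \<in> E6_roots" "snd a \<ge> 0" "snd b \<ge> 0" for a b
  proof (cases "snd b \<ge> snd a")
    case True
    thus ?thesis using pos_neg that by blast
  next
    case False
    hence "product_rule (- b) a" using pos_neg that by simp
    hence "product_rule (- a) b" using product_rule_minus[of "- b" a] product_rule_sym[of "- (- b)" "- a"] that roots_minus by simp
    thus ?thesis .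
  qed
  have pos: "product_rule a b" if "a \<in> E6_roots" "b \<in> E6_roots" "snd a \<ge> 0" "snd b \<ge> 0" for a b
    using nonneg[of a b] nonneg[of b a] product_rule_sym[of b a] that by linarith
  show ?thesis
    using pos[of a b] neg[of "- a" b] product_rule_sym[of "- (- b)" a] neg[of "- b" a] product_rule_minus[of "- a" "- b"]
      pos[of "- a" "- b"] assms roots_minus[OF assms(1)] roots_minus[OF assms(2)]
    by (cases "snd a \<ge> 0"; cases "snd b \<ge> 0") simp_all
qed

section \<open>The Cartan subalgebra\<close>

definition E6_H :: "elt set" where
  "E6_H = range h_elt"

text \<open>The diagonal entries of the second component are the eigenvalues on the basis vectors,
  and \<open>h_zero\<close> acts by the degree. The value 0 off \<open>E6_H\<close> follows the
  convention for functionals on a subspace.\<close>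

definition weight :: "lat \<Rightarrow> elt \<Rightarrow> complex" where
  "weight a x = (if x \<in> E6_H
     then (\<Sum>i\<in>UNIV. of_int (fst a $ i) * snd (endS x) $ i $ i) + of_int (snd a) * h0c x else 0)"

lemma h_elt_linear: "h_elt (d + d') = h_elt d + h_elt d'" "h_elt (c *s d) = escale c (h_elt d)"
  "- h_elt d = h_elt (- d)" "h_elt 0 = 0"
  by (simp_all add: h_elt_def elt_eq_iff prod_eq_iff diag_mat_def vec_eq_iff sum.distrib pscale_def
      mscale_def sum_negf add_divide_distrib flip: sum_distrib_left)

lemma h_elt_sum: "h_elt (\<Sum>i\<in>A. c i *s d i) = (\<Sum>i\<in>A. escale (c i) (h_elt (d i)))"
  by (induction A rule: infinite_finite_induct) (simp_all add: h_elt_linear)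

lemma subspace_H: "elt_space.subspace E6_H"
proof (rule elt_space.subspaceI)
  show "0 \<in> E6_H" unfolding E6_H_def by (rule range_eqI[of _ _ 0]) (simp add: h_elt_linear)
  fix x y c assume "x \<in> E6_H" "y \<in> E6_H"
  then obtain d d' where "x = h_elt d" "y = h_elt d'" by (auto simp: E6_H_def)
  thus "x + y \<in> E6_H" "escale c x \<in> E6_H" by (simp_all add: E6_H_def flip: h_elt_linear)
qed

lemma weight_h_elt: "weight a (h_elt d)
    = (\<Sum>i\<in>UNIV. of_int (fst a $ i) * d $ i) - of_int (snd a) * ((\<Sum>i\<in>UNIV. d $ i) / 3)"
  by (simp add: weight_def E6_H_def) (simp add: h_elt_def diag_mat_def)

lemma coroot_in_H: "coroot_elt a \<in> E6_H"
  by (simp add: coroot_elt_def E6_H_def)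

text \<open>The trace of the coroot of a is three times the degree of a, so its
  \<open>h_zero\<close> part contributes minus the product of the degrees: the negative term of
  \<open>ip\<close>.\<close>

lemma weight_coroot: "a \<in> E6_roots \<Longrightarrow> weight b (coroot_elt a) = of_int (ip a b)"
proof -
  assume a: "a \<in> E6_roots"
  have "(\<Sum>i\<in>UNIV. of_int (fst a $ i) :: complex) = of_int (\<Sum>i\<in>UNIV. fst a $ i)" by simp
  also have "\<dots> = 3 * of_int (snd a)" using roots_sum[OF a] by simp
  finally show ?thesis by (simp add: coroot_elt_def weight_h_elt ip_def mult.commute)
qed

lemma ebr_h_elt_h_elt: "ebr (h_elt d) (h_elt d') = 0"
proof -
  have "(diag_mat d ** diag_mat d') $ p $ q = (\<Sum>r\<in>UNIV. if r = p then (if p = q then d $ p * d' $ p else 0) else 0)" for d d' p q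
    unfolding matrix_matrix_mult_def diag_mat_def vec_lambda_beta by (intro sum.cong) auto
  hence "diag_mat d ** diag_mat d' = diag_mat d' ** diag_mat d" by (simp add: vec_eq_iff)
  thus ?thesis by (simp add: h_elt_def elt_eq_iff prod_eq_iff ebr_sel bilinear_simps)
qed

lemma ebr_h_elt_root_elt_nonneg:
  assumes "a \<in> E6_roots" "snd a \<ge> 0"
  shows "ebr (h_elt d) (root_elt a) = escale (weight a (h_elt d)) (root_elt a)"
proof -
  define s where "s = (\<Sum>i\<in>UNIV. d $ i) / 3"
  have ofint: "(\<Sum>i\<in>UNIV. of_int (ind S $ i) * d $ i) = (\<Sum>i\<in>S. d $ i)" for S
  proof -
    have "(\<Sum>i\<in>UNIV. of_int (ind S $ i) * d $ i) = (\<Sum>i\<in>UNIV. if i \<in> S then d $ i else 0)"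
      by (intro sum.cong) (auto simp: ind_def)
    thus ?thesis by (simp add: sum.If_cases)
  qed
  have br: "ebr (h_elt d) (Elt 0 0 0 0 x y)
      = Elt 0 0 0 0 (Der (diag_mat d) x - s *s x) (Der (diag_mat d) y - (2 * s) *s y)" for x y
    by (simp add: h_elt_def s_def elt_eq_iff prod_eq_iff ebr_sel bilinear_simps)
  have "(\<exists>i j. i \<noteq> j \<and> a = diff_root i j) \<or> (\<exists>S. card S = 3 \<and> a = set_root S) \<or> a = top_root"
    by (rule root_cases_nonneg[OF assms])
  thus ?thesis
  proof (elim disjE exE conjE)
    fix i j assume ij: "i \<noteq> j" and a: "a = diff_root i j"
    have "transpose (diag_mat d) = diag_mat d" by (simp add: transpose_def diag_mat_def vec_eq_iff)
    hence h: "h_elt d = iota_plus (diag_mat d) - escale s h_zero"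
      by (simp add: h_elt_def iota_plus_def adj_eq_transpose h_zero_def s_def elt_eq_iff prod_eq_iff
          pscale_def mscale_simps)
    have "(diag_mat d ** munit i j) $ p $ q = (\<Sum>r\<in>UNIV. if r = p then mscale (d $ i) (munit i j) $ p $ q else 0)"
      "(munit i j ** diag_mat d) $ p $ q = (\<Sum>r\<in>UNIV. if r = q then mscale (d $ j) (munit i j) $ p $ q else 0)" for p q
      unfolding matrix_matrix_mult_def diag_mat_def munit_def mscale_def vec_lambda_beta
      by (intro sum.cong; auto)+
    hence "diag_mat d ** munit i j - munit i j ** diag_mat d = mscale (d $ i - d $ j) (munit i j)"
      by (simp add: vec_eq_iff mscale_def left_diff_distrib)
    hence "ebr (iota_plus (diag_mat d)) (iota_plus (munit i j)) = escale (d $ i - d $ j) (iota_plus (munit i j))"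
      by (simp add: ebr_iota iota_linear)
    moreover have "ebr h_zero (iota_plus A) = 0" for A
      by (simp add: h_zero_def iota_plus_def elt_eq_iff prod_eq_iff ebr_sel bilinear_simps)
    ultimately have "ebr (h_elt d) (iota_plus (munit i j)) = escale (d $ i - d $ j) (iota_plus (munit i j))"
      using ebr_add(1)[of "iota_plus (diag_mat d)" "- escale s h_zero"]
      by (simp add: h ebr_minus ebr_scale)
    moreover have "weight a (h_elt d) = d $ i - d $ j"
      unfolding weight_h_elt a diff_root_def
      by (simp add: left_diff_distrib sum_subtractf ofint)
    ultimately show ?thesis using ij by (simp add: a root_elt_diff ebr_scale mult.commute)
  next
    fix S :: "6 set" assume "card S = 3" and a: "a = set_root S"
    have "weight a (h_elt d) = (\<Sum>i\<in>S. d $ i) - s"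
      unfolding weight_h_elt a set_root_def by (simp add: ofint s_def)
    thus ?thesis unfolding a root_elt_set br
      by (simp add: diag_mat_def Der_diag_axis Der_simps elt_eq_iff prod_eq_iff pscale_def mscale_simps
          vec.scale_left_diff_distrib)
  next
    assume a: "a = top_root"
    have "weight a (h_elt d) = (\<Sum>i\<in>UNIV. d $ i) - 2 * s"
      unfolding weight_h_elt a top_root_def by (simp add: ofint s_def)
    thus ?thesis unfolding a root_elt_top br
      by (simp add: diag_mat_def Der_diag_axis Der_simps elt_eq_iff prod_eq_iff pscale_def mscale_simps
          vec.scale_left_diff_distrib)
  qed
qed

lemma weight_minus: "weight (- a) x = - weight a x"
  by (simp add: weight_def sum_negf)

text \<open>\<open>flip_elt\<close> sends \<open>h_elt d\<close> to its negative and exchanges a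
  with -a, so nonnegative degrees suffice.\<close>

lemma ebr_h_elt_root_elt:
  assumes a: "a \<in> E6_roots"
  shows "ebr (h_elt d) (root_elt a) = escale (weight a (h_elt d)) (root_elt a)"
proof (cases "snd a \<ge> 0")
  case False
  have "flip_elt (h_elt d) = - h_elt d"
    by (simp add: h_elt_def flip_elt_def elt_eq_iff prod_eq_iff)
  hence "flip_elt (ebr (h_elt d) (root_elt a)) = - ebr (h_elt d) (root_elt (- a))"
    using a by (simp flip: flip_elt_ebr add: flip_root_elt ebr_minus)
  also have "\<dots> = escale (weight a (h_elt d)) (root_elt (- a))"
    using ebr_h_elt_root_elt_nonneg[OF roots_minus[OF a]] False by (simp add: weight_minus)
  also have "\<dots> = flip_elt (escale (weight a (h_elt d)) (root_elt a))"
    using a by (simp add: flip_elt_simps flip_root_elt)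
  finally show ?thesis by (metis flip_elt_simps(4))
qed (rule ebr_h_elt_root_elt_nonneg[OF a])

lemma ebr_root_elt_h_elt:
  assumes a: "a \<in> E6_roots"
  shows "ebr (root_elt a) (h_elt d) = escale (- weight a (h_elt d)) (root_elt a)"
proof -
  have "ebr (root_elt a) (h_elt d) = - ebr (h_elt d) (root_elt a)"
    using root_elt_deg[OF a] by (intro ebr_swap) (simp_all add: h_elt_def ext_deg_def)
  thus ?thesis by (simp add: ebr_h_elt_root_elt[OF a])
qed

section \<open>Coordinates with respect to the root elements\<close>

text \<open>For e_i - e_j the double sum has one nonzero term. Written this way, the coordinate is
  read off from a without choosing i and j, and it is linear for every lattice vector a.\<close>

definition root_coord :: "lat \<Rightarrow> elt \<Rightarrow> complex" where
  "root_coord a X =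
    (if snd a = 0 then \<Sum>p\<in>UNIV. \<Sum>q\<in>UNIV. if fst a $ p = 1 \<and> fst a $ q = -1
        then ext_sign {p} {q} * snd (endS X) $ p $ q else 0
     else if snd a = 1 then pos1 X $ {i. fst a $ i = 1}
     else if snd a = 2 then pos2 X $ UNIV
     else if snd a = -1 then neg1 X $ {i. fst a $ i = -1}
     else neg2 X $ UNIV)"

text \<open>The signs that lead from \<open>root_elt\<close> back to the given basis: in degree 0
  they undo the factor in \<open>root_mat\<close>, and in negative degrees they are the reversal
  sign of \<open>v_minus\<close>, which is -1 for three and for six factors.\<close>

definition root_sign :: "lat \<Rightarrow> complex" where
  "root_sign a =
    (if snd a = 0 then \<Sum>p\<in>UNIV. \<Sum>q\<in>UNIV. if fst a $ p = 1 \<and> fst a $ q = -1 then ext_sign {p} {q} else 0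
     else if snd a > 0 then 1 else -1)"

lemma sum_diff_root:
  assumes "i \<noteq> j"
  shows "(\<Sum>p\<in>UNIV. \<Sum>q\<in>UNIV. if fst (diff_root i j) $ p = 1 \<and> fst (diff_root i j) $ q = -1
    then f p q else 0) = (f i j :: complex)"
proof -
  have "(\<Sum>p\<in>UNIV. \<Sum>q\<in>UNIV. if fst (diff_root i j) $ p = 1 \<and> fst (diff_root i j) $ q = -1 then f p q else 0)
      = (\<Sum>p\<in>UNIV. if p = i then (\<Sum>q\<in>UNIV. if q = j then f p q else 0) else 0)"
  proof (intro sum.cong refl)
    fix p :: 6
    have "fst (diff_root i j) $ p = 1 \<longleftrightarrow> p = i" "fst (diff_root i j) $ q = -1 \<longleftrightarrow> q = j" for q
      using assms by (auto simp: diff_root_def ind_def)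
    thus "(\<Sum>q\<in>UNIV. if fst (diff_root i j) $ p = 1 \<and> fst (diff_root i j) $ q = -1 then f p q else 0)
        = (if p = i then (\<Sum>q\<in>UNIV. if q = j then f p q else 0) else 0)"
      by simp
  qed
  thus ?thesis by simp
qed

lemma root_coord_simps:
  "i \<noteq> j \<Longrightarrow> root_coord (diff_root i j) X = ext_sign {i} {j} * snd (endS X) $ i $ j"
  "root_coord (set_root S) X = pos1 X $ S" "root_coord (- set_root S) X = neg1 X $ S"
  "root_coord top_root X = pos2 X $ UNIV" "root_coord (- top_root) X = neg2 X $ UNIV"
proof -
  have "{i. fst (set_root S) $ i = 1} = S" by (simp add: set_root_def ind_def)
  thus "root_coord (set_root S) X = pos1 X $ S" "root_coord (- set_root S) X = neg1 X $ S"
    by (simp_all add: root_coord_def)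
qed (simp_all add: root_coord_def sum_diff_root)

lemma root_sign_simps:
  "i \<noteq> j \<Longrightarrow> root_sign (diff_root i j) = ext_sign {i} {j}"
  "root_sign (set_root S) = 1" "root_sign (- set_root S) = -1"
  "root_sign top_root = 1" "root_sign (- top_root) = -1"
  by (simp_all add: root_sign_def sum_diff_root)

lemma root_coord_linear:
  "root_coord a (X + Y) = root_coord a X + root_coord a Y"
  "root_coord a (escale c X) = c * root_coord a X"
  by (auto simp: root_coord_def pscale_def mscale_def sum_distrib_left algebra_simps
      simp flip: sum.distrib intro!: sum.cong)

lemma root_eq_simps:
  "i \<noteq> j \<Longrightarrow> k \<noteq> l \<Longrightarrow> diff_root i j = diff_root k l \<longleftrightarrow> i = k \<and> j = l"
  "set_root S = set_root T \<longleftrightarrow> S = T"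
proof -
  show "set_root S = set_root T \<longleftrightarrow> S = T"
    by (auto simp: set_root_def ind_def vec_eq_iff split: if_splits)
  assume ij: "i \<noteq> j" "k \<noteq> l"
  have "i = k \<and> j = l" if "diff_root i j = diff_root k l"
  proof -
    have "fst (diff_root i j) $ k = 1" "fst (diff_root i j) $ l = -1"
      unfolding that using ij by (simp_all add: diff_root_def ind_def)
    thus ?thesis by (auto simp: diff_root_def ind_def split: if_splits)
  qed
  thus "diff_root i j = diff_root k l \<longleftrightarrow> i = k \<and> j = l" by blast
qed

lemma root_coord_root_elt:
  assumes "a \<in> E6_roots" "b \<in> E6_roots"
  shows "root_coord a (root_elt b) = (if a = b then 1 else 0)"
proof (cases "snd a = snd b")
  case True
  show ?thesis using assms(1)
  proof (cases rule: root_cases)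
    case (diff i j)
    from assms(2) show ?thesis
      by (cases rule: root_cases) (use diff True in \<open>auto simp: root_coord_simps root_elt_diff
        root_eq_simps iota_plus_def pscale_def mscale_def munit_def\<close>)
  qed (use assms(2) True in \<open>cases rule: root_cases; auto simp: root_coord_simps root_elt_set root_elt_top
      root_eq_simps axis_def\<close>)+
next
  case False
  hence "a \<noteq> b" by auto
  with assms(1) show ?thesis using False assms(2)
    by (cases rule: root_cases; cases rule: root_cases[OF assms(2)])
      (auto simp: root_coord_simps root_elt_diff root_elt_set root_elt_top iota_plus_def pscale_def mscale_def)
qed

lemma root_coord_H: "a \<in> E6_roots \<Longrightarrow> x \<in> E6_H \<Longrightarrow> root_coord a x = 0"
  by (cases rule: root_cases) (auto simp: root_coord_simps E6_H_def h_elt_def diag_mat_def)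

lemma root_sign_sq: "a \<in> E6_roots \<Longrightarrow> root_sign a * root_sign a = 1"
  by (cases rule: root_cases) (auto simp: root_sign_simps)

lemma root_sign_minus: "a \<in> E6_roots \<Longrightarrow> root_sign (- a) = - root_sign a"
  by (cases rule: root_cases) (auto simp: root_sign_simps diff_root_minus intro: ext_sign_singletons)

section \<open>The simple roots\<close>

text \<open>Bourbaki's numbering: nodes 1, 3, 4, 5, 6 form the chain of consecutive differences,
  hence the index shift from 3 on. Node 2 hangs on node 4, the only one of these differences not
  orthogonal to the triple of the last three indices.\<close>

definition simple_root :: "nat \<Rightarrow> lat" where
  "simple_root i = (if i = 1 then diff_root (ix 1) (ix 2) else if i = 2 then set_root {ix 4, ix 5, ix 6}
     else diff_root (ix (i - 1)) (ix i))"

lemma ix_eq_iff: "i \<in> {1..6} \<Longrightarrow> j \<in> {1..6} \<Longrightarrow> ix i = ix j \<longleftrightarrow> i = j"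
  using strict_mono_on_imp_inj_on[OF ix_strict_mono] by (auto simp: inj_on_def)

lemma interval_1_6: "{1..6} = {1, 2, 3, 4, 5, 6 :: nat}"
  by auto

lemma sum_1_6: "(\<Sum>i\<in>{1..6}. f i) = f 1 + (f 2 + (f 3 + (f 4 + (f 5 + f (6 :: nat)))))"
  unfolding interval_1_6 by simp

lemma sum_ix: "(\<Sum>i\<in>UNIV. f i) = f (ix 1) + (f (ix 2) + (f (ix 3) + (f (ix 4) + (f (ix 5) + f (ix 6)))))"
proof -
  have "(\<Sum>i\<in>UNIV. f i) = (\<Sum>i\<in>ix ` {1..6}. f i)" by (simp only: ix_image)
  also have "\<dots> = (\<Sum>i\<in>{1..6}. f (ix i))"
    by (simp only: sum.reindex[OF strict_mono_on_imp_inj_on[OF ix_strict_mono]] o_def)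
  finally show ?thesis by (simp only: sum_1_6)
qed

lemma all_ix: "(\<forall>i. P i) \<longleftrightarrow> P (ix 1) \<and> P (ix 2) \<and> P (ix 3) \<and> P (ix 4) \<and> P (ix 5) \<and> P (ix 6)"
proof -
  have "(\<forall>i. P i) \<longleftrightarrow> (\<forall>i\<in>ix ` {1..6}. P i)" by (simp only: ix_image) simp
  also have "\<dots> \<longleftrightarrow> (\<forall>i\<in>{1, 2, 3, 4, 5, 6}. P (ix i))" unfolding interval_1_6 by blast
  finally show ?thesis by simp
qed

lemma ball_1_6: "(\<forall>i\<in>{1..6 :: nat}. P i) \<longleftrightarrow> P 1 \<and> P 2 \<and> P 3 \<and> P 4 \<and> P 5 \<and> P 6"
  unfolding interval_1_6 by simp

lemma card_ix_456: "card {ix 4, ix 5, ix 6} = 3"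
  by (simp add: ix_eq_iff)

lemma simple_root_in: "i \<in> {1..6} \<Longrightarrow> simple_root i \<in> E6_roots"
  unfolding interval_1_6 by (auto simp: simple_root_def ix_eq_iff card_ix_456 intro!: diff_root_in set_root_in)

lemma ip_simple_root_ball:
  "\<forall>i\<in>{1..6}. \<forall>j\<in>{1..6}. ip (simple_root i) (simple_root j) = cartan_matrix_E6 i j"
  unfolding ball_1_6
  by (simp add: simple_root_def ip_diff_root ip_set_root)
    (simp add: diff_root_def set_root_def ind_def ix_eq_iff cartan_matrix_E6_def doubleton_eq_iff)

lemma ip_simple_root: "i \<in> {1..6} \<Longrightarrow> j \<in> {1..6} \<Longrightarrow> ip (simple_root i) (simple_root j) = cartan_matrix_E6 i j"
  using ip_simple_root_ball by blast

lemma inj_simple_root: "inj_on simple_root {1..6}"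
proof (rule inj_onI)
  fix i j assume ij: "i \<in> {1..6}" "j \<in> {1..6}" "simple_root i = simple_root j"
  hence "cartan_matrix_E6 i j = 2"
    using ip_simple_root[of i j] roots_norm[OF simple_root_in[of j]] by simp
  thus "i = j" by (simp add: cartan_matrix_E6_def split: if_splits)
qed

lemma cartan_nondegenerate:
  fixes m :: "nat \<Rightarrow> complex"
  assumes "\<And>j. j \<in> {1..6} \<Longrightarrow> (\<Sum>i\<in>{1..6}. m i * of_int (ip (simple_root i) (simple_root j))) = 0"
    and i: "i \<in> {1..6}"
  shows "m i = 0"
proof -
  have "\<forall>j\<in>{1..6}. (\<Sum>i\<in>{1..6}. m i * of_int (cartan_matrix_E6 i j)) = 0"
    using assms(1) by (simp add: ip_simple_root del: One_nat_def)
  hence eqs: "2 * m 1 = m 3" "2 * m 2 = m 4" "2 * m 3 = m 1 + m 4" "2 * m 4 = m 2 + m 3 + m 5"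
    "2 * m 5 = m 4 + m 6" "2 * m 6 = m 5"
    unfolding ball_1_6 sum_1_6 by (simp_all add: cartan_matrix_E6_def doubleton_eq_iff algebra_simps)
  have m4: "m 4 = 3 * m 1" using eqs(3) by (simp flip: eqs(1) del: One_nat_def)
  have m4_6: "m 4 = 3 * m 6" using eqs(5) by (simp flip: eqs(6))
  hence m6: "m 6 = m 1" using m4 by simp
  \<comment> \<open>The three arms express everything by \<open>m 1\<close>, and the equation at the
    branching node becomes \<open>12 * m 1 = 11 * m 1\<close>.\<close>
  have "2 * (2 * m 4) = 2 * m 2 + (2 * m 3 + 2 * m 5)" unfolding eqs(4) by (simp only: distrib_left add.assoc)
  also have "\<dots> = m 4 + (2 * (2 * m 1) + (m 4 + m 6))" by (simp only: eqs)
  finally have "m 1 = 0" by (simp add: m4 m6 del: One_nat_def)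
  hence "m 3 = 0" "m 4 = 0" "m 6 = 0" using eqs(1) m4 m6 by (simp_all del: One_nat_def)
  moreover from this have "m 2 = 0" "m 5 = 0" using eqs(2,6) by simp_all
  ultimately have "\<forall>i\<in>{1..6}. m i = 0" unfolding ball_1_6 using \<open>m 1 = 0\<close> by simp
  thus ?thesis using i by blast
qed

text \<open>The coefficients of the vector with entries \<open>A 1, \<dots>, A 6\<close> and sum \<open>3 * k\<close> with respect to
  the simple roots are its partial sums, corrected by the contribution of \<open>k\<close> copies of
  \<open>set_root {ix 4, ix 5, ix 6}\<close>.\<close>

definition simple_coeff :: "(nat \<Rightarrow> 'a::comm_ring_1) \<Rightarrow> 'a \<Rightarrow> nat \<Rightarrow> 'a" where
  "simple_coeff A k i =
    (if i = 1 then A 1 else if i = 2 then k else if i = 3 then A 1 + A 2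
     else if i = 4 then A 1 + A 2 + A 3 else if i = 5 then A 1 + A 2 + A 3 + A 4 - k
     else A 1 + A 2 + A 3 + A 4 + A 5 - 2 * k)"

lemma span_coroot_simple: "elt_space.span (coroot_elt ` simple_root ` {1..6}) = E6_H"
proof (intro equalityI subsetI)
  have "coroot_elt ` simple_root ` {1..6} \<subseteq> E6_H" using coroot_in_H by blast
  thus "x \<in> E6_H" if "x \<in> elt_space.span (coroot_elt ` simple_root ` {1..6})" for x
    using elt_space.span_minimal[OF _ subspace_H] that by blast
  fix x assume "x \<in> E6_H"
  then obtain d where x: "x = h_elt d" by (auto simp: E6_H_def)
  define k where "k = (\<Sum>i\<in>UNIV. d $ i) / 3"
  define c where "c = simple_coeff (\<lambda>i. d $ ix i) k"
  have "3 * k = d $ ix 1 + (d $ ix 2 + (d $ ix 3 + (d $ ix 4 + (d $ ix 5 + d $ ix 6))))"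
    by (simp only: k_def sum_ix) simp
  hence d6: "d $ ix 6 = 3 * k - (d $ ix 1 + (d $ ix 2 + (d $ ix 3 + (d $ ix 4 + d $ ix 5))))"
    by (simp add: algebra_simps)
  have "d = (\<Sum>i\<in>{1..6}. c i *s (\<chi> j. of_int (fst (simple_root i) $ j)))"
    unfolding sum_1_6 vec_eq_iff all_ix
    by (simp add: c_def simple_coeff_def simple_root_def diff_root_def set_root_def ind_def ix_eq_iff d6
        algebra_simps)
  hence "x = (\<Sum>i\<in>{1..6}. escale (c i) (coroot_elt (simple_root i)))"
    unfolding x coroot_elt_def by (subst h_elt_sum[symmetric]) simp
  also have "\<dots> \<in> elt_space.span (coroot_elt ` simple_root ` {1..6})"
    by (intro elt_space.span_sum elt_space.span_scale elt_space.span_base) auto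
  finally show "x \<in> elt_space.span (coroot_elt ` simple_root ` {1..6})" .
qed

lemma weight_simple_coeff:
  assumes a: "a \<in> E6_roots"
  shows "weight a x = (\<Sum>i\<in>{1..6}. of_int (simple_coeff (\<lambda>i. fst a $ ix i) (snd a) i) * weight (simple_root i) x)"
proof (cases "x \<in> E6_H")
  case True
  then obtain d where x: "x = h_elt d" by (auto simp: E6_H_def)
  define s where "s = (\<Sum>i\<in>UNIV. d $ i) / 3"
  have a6: "fst a $ ix 6 = 3 * snd a - (fst a $ ix 1 + fst a $ ix 2 + fst a $ ix 3 + fst a $ ix 4 + fst a $ ix 5)"
    using roots_sum[OF a] by (simp add: sum_ix)
  have w: "weight b x = of_int (fst b $ ix 1) * d $ ix 1 + (of_int (fst b $ ix 2) * d $ ix 2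
      + (of_int (fst b $ ix 3) * d $ ix 3 + (of_int (fst b $ ix 4) * d $ ix 4
      + (of_int (fst b $ ix 5) * d $ ix 5 + of_int (fst b $ ix 6) * d $ ix 6)))) - of_int (snd b) * s" for b
    unfolding x weight_h_elt s_def[symmetric] unfolding sum_ix ..
  show ?thesis unfolding sum_1_6 w
    by (simp add: simple_coeff_def simple_root_def diff_root_def set_root_def ind_def ix_eq_iff a6
        algebra_simps)
qed (simp add: weight_def)

text \<open>For e_x - e_y the partial sums are 0 or 1 if x < y, and 0 or -1 otherwise. For e_S the
  last two coefficients are 2 - a_5 - a_6 and 1 - a_6, because the entries add up to 3.\<close>

lemma simple_coeff_nonneg:
  assumes a: "a \<in> E6_roots" "snd a \<ge> 0"
  shows "(\<forall>i\<in>{1..6}. simple_coeff (\<lambda>i. fst a $ ix i) (snd a) i \<ge> 0) \<or>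
    (\<forall>i\<in>{1..6}. simple_coeff (\<lambda>i. fst a $ ix i) (snd a) i \<le> 0)"
proof -
  note sum = roots_sum[OF a(1), unfolded sum_ix]
  have "(\<exists>i j. i \<noteq> j \<and> a = diff_root i j) \<or> (\<exists>S. card S = 3 \<and> a = set_root S) \<or> a = top_root"
    by (rule root_cases_nonneg[OF a])
  thus ?thesis
  proof (elim disjE exE conjE)
    fix i j assume ij: "i \<noteq> j" "a = diff_root i j"
    have "i \<in> ix ` {1..6}" "j \<in> ix ` {1..6}" unfolding ix_image by simp_all
    then obtain x y where xy: "i = ix x" "j = ix y" "x \<in> {1..6}" "y \<in> {1..6}" by blast
    have val: "fst a $ ix m = (if m = x then 1 else 0) - (if m = y then 1 else 0)" if "m \<in> {1..6}" for m
      using that xy ix_eq_iff by (simp add: ij diff_root_def ind_def)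
    have k: "snd a = 0" by (simp add: ij)
    show ?thesis
    proof (cases "x < y")
      case True
      have "\<forall>i\<in>{1..6}. simple_coeff (\<lambda>i. fst a $ ix i) (snd a) i \<ge> 0"
        unfolding ball_1_6 simple_coeff_def using True xy(3,4) by (auto simp: val k)
      thus ?thesis ..
    next
      case False
      have "\<forall>i\<in>{1..6}. simple_coeff (\<lambda>i. fst a $ ix i) (snd a) i \<le> 0"
        unfolding ball_1_6 simple_coeff_def using False xy(3,4) by (auto simp: val k)
      thus ?thesis ..
    qed
  next
    fix S :: "6 set" assume aS: "a = set_root S"
    have bounds: "0 \<le> fst a $ i" "fst a $ i \<le> 1" for i by (simp_all add: aS set_root_def ind_def)
    have k: "snd a = 1" by (simp add: aS)
    have "\<forall>i\<in>{1..6}. simple_coeff (\<lambda>i. fst a $ ix i) (snd a) i \<ge> 0"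
      unfolding ball_1_6 simple_coeff_def k
      using sum[unfolded k] bounds[of "ix 1"] bounds[of "ix 2"] bounds[of "ix 3"] bounds[of "ix 4"]
        bounds[of "ix 5"] bounds[of "ix 6"] by simp
    thus ?thesis ..
  next
    assume "a = top_root"
    hence "\<forall>i\<in>{1..6}. simple_coeff (\<lambda>i. fst a $ ix i) (snd a) i \<ge> 0"
      unfolding ball_1_6 simple_coeff_def by (simp add: top_root_def ind_def)
    thus ?thesis ..
  qed
qed

lemma simple_coeff_sign:
  assumes a: "a \<in> E6_roots"
  shows "(\<forall>i\<in>{1..6}. simple_coeff (\<lambda>i. fst a $ ix i) (snd a) i \<ge> 0) \<or>
    (\<forall>i\<in>{1..6}. simple_coeff (\<lambda>i. fst a $ ix i) (snd a) i \<le> 0)"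
proof (cases "snd a \<ge> 0")
  case False
  have "simple_coeff (\<lambda>i. fst (- a) $ ix i) (snd (- a)) i = - simple_coeff (\<lambda>i. fst a $ ix i) (snd a) i" for i
    by (simp add: simple_coeff_def)
  thus ?thesis using simple_coeff_nonneg[OF roots_minus[OF a]] False by (simp del: fst_uminus snd_uminus) auto
qed (rule simple_coeff_nonneg[OF a])

section \<open>The axioms for the concrete root system and bracket\<close>

interpretation E6: simply_laced escale ebr E6_roots ip eps E6_H weight coroot_elt root_elt root_coord
  simple_root 6
proof (intro simply_laced.intro simply_laced_axioms.intro)
  fix a b d :: lat and x y z :: elt and c :: complex
  show "vector_space escale" by (rule vector_space_escale)
  show "ebr (x + y) z = ebr x z + ebr y z" "ebr x (y + z) = ebr x y + ebr x z"
    "ebr (escale c x) y = escale c (ebr x y)" "ebr x (escale c y) = escale c (ebr x y)"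
    by (rule ebr_add ebr_scale)+
  show "finite E6_roots" by (rule finite_roots)
  show "E6_roots \<noteq> {}" using top_root_in by blast
  show "ip (a + b) d = ip a d + ip b d" "ip a b = ip b a" by (rule ip_add ip_sym)+
  show "eps (a + b) d = eps a d * eps b d" "eps d (a + b) = eps d a * eps d b" "eps a b * eps a b = 1"
    by (rule eps_add eps_sq)+
  show "elt_space.subspace E6_H" by (rule subspace_H)
  show "weight (a + b) x = weight a x + weight b x"
    by (simp add: weight_def algebra_simps sum.distrib)
  show "coroot_elt (a + b) = coroot_elt a + coroot_elt b"
    unfolding coroot_elt_def h_elt_linear(1)[symmetric] by (rule arg_cong[of _ _ h_elt]) (simp add: vec_eq_iff)
  show "root_coord a (x + y) = root_coord a x + root_coord a y"
    "root_coord a (escale c x) = c * root_coord a x" by (rule root_coord_linear)+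
  show "inj_on simple_root {1..6}" by (rule inj_simple_root)
  show "elt_space.span (coroot_elt ` simple_root ` {1..6}) = E6_H" by (rule span_coroot_simple)
  show "x \<notin> E6_H \<Longrightarrow> weight a x = 0" by (simp add: weight_def)
  show "x \<in> E6_H \<Longrightarrow> weight a (escale c x) = c * weight a x"
    using elt_space.subspace_scale[OF subspace_H]
    by (simp add: weight_def pscale_def mscale_def algebra_simps sum_distrib_left)
  show "x \<in> E6_H \<Longrightarrow> y \<in> E6_H \<Longrightarrow> weight a (x + y) = weight a x + weight a y"
    using elt_space.subspace_add[OF subspace_H]
    by (simp add: weight_def algebra_simps sum.distrib)
  show "x \<in> E6_H \<Longrightarrow> y \<in> E6_H \<Longrightarrow> ebr x y = 0" by (auto simp: E6_H_def ebr_h_elt_h_elt)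
  show "coroot_elt a \<in> E6_H" by (rule coroot_in_H)
next
  fix a b :: lat and x :: elt assume a: "a \<in> E6_roots"
  show "ip a a = 2" "- a \<in> E6_roots" "eps a a = -1"
    using a by (rule roots_norm roots_minus eps_self)+
  show "x \<in> E6_H \<Longrightarrow> ebr x (root_elt a) = escale (weight a x) (root_elt a)"
    "x \<in> E6_H \<Longrightarrow> ebr (root_elt a) x = escale (- weight a x) (root_elt a)"
    using a by (auto simp: E6_H_def ebr_h_elt_root_elt ebr_root_elt_h_elt)
  show "ebr (root_elt a) (root_elt (- a)) = - coroot_elt a"
    using product_rule_roots[OF a roots_minus[OF a]] by (simp add: product_rule_def)
  show "x \<in> E6_H \<Longrightarrow> root_coord a x = 0" by (rule root_coord_H[OF a])
  show "\<exists>n :: nat \<Rightarrow> int. (\<forall>x. weight a x = (\<Sum>i\<in>{1..6}. of_int (n i) * weight (simple_root i) x)) \<and>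
      ((\<forall>i\<in>{1..6}. n i \<ge> 0) \<or> (\<forall>i\<in>{1..6}. n i \<le> 0))"
    using weight_simple_coeff[OF a] simple_coeff_sign[OF a] by blast
  assume b: "b \<in> E6_roots"
  show "ip a b = -1 \<Longrightarrow> a + b \<in> E6_roots" "-2 \<le> ip a b" "ip a b = -2 \<Longrightarrow> b = - a"
    "ip a b = 0 \<Longrightarrow> eps a b = eps b a" "ip a b = -1 \<Longrightarrow> eps a b = - eps b a"
    using a b by (auto intro: roots_add ip_ge eps_comm eps_anticomm)
  show "weight b (coroot_elt a) = of_int (ip a b)" by (rule weight_coroot[OF a])
  show "ip a b = -1 \<Longrightarrow> ebr (root_elt a) (root_elt b) = escale (eps a b) (root_elt (a + b))"
    "ip a b \<ge> 0 \<Longrightarrow> ebr (root_elt a) (root_elt b) = 0"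
    using product_rule_roots[OF a b] by (auto simp: product_rule_def)
  show "root_coord a (root_elt b) = (if a = b then 1 else 0)" by (rule root_coord_root_elt[OF a b])
qed (use simple_root_in cartan_nondegenerate roots_irreducible in blast)+

section \<open>Identification with the given Lie algebra and the given basis\<close>

lemma lieS_iff: "A \<in> lieS \<longleftrightarrow> fst A = - transpose (snd A)"
proof -
  have minus: "dot ((- B) *v v) u = - dot (B *v v) u" for B :: mat6 and v u
    by (simp add: dot_def matrix_vector_mult_def sum_negf)
  have "A \<in> lieS \<longleftrightarrow> (\<forall>v u. dot ((- fst A) *v v) u = dot v (snd A *v u))"
    unfolding minus lieS_def case_prod_unfold mem_Collect_eq add_eq_0_iff by metis
  also have "\<dots> \<longleftrightarrow> - fst A = transpose (snd A)"
    using adj_ex1[of "snd A"] dot_transpose[of "snd A"] by metis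
  finally show ?thesis by (metis add.inverse_inverse)
qed

lemma elt_sum_sel:
  "neg2 (sum f A) = (\<Sum>a\<in>A. neg2 (f a))" "neg1 (sum f A) = (\<Sum>a\<in>A. neg1 (f a))"
  "endS (sum f A) = (\<Sum>a\<in>A. endS (f a))" "h0c (sum f A) = (\<Sum>a\<in>A. h0c (f a))"
  "pos1 (sum f A) = (\<Sum>a\<in>A. pos1 (f a))" "pos2 (sum f A) = (\<Sum>a\<in>A. pos2 (f a))"
  by (induction A rule: infinite_finite_induct) simp_all

lemma trace_simps:
  "trace (mscale c A) = c * trace A" "trace (A + B) = trace A + trace (B :: mat6)" "trace (0 :: mat6) = 0"
  "i \<noteq> j \<Longrightarrow> trace (munit i j) = 0"
  by (auto simp: trace_def mscale_def munit_def sum_distrib_left sum.distrib intro!: sum.neutral)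

lemma subspace_E_alg: "elt_space.subspace E_alg"
proof (rule elt_space.subspaceI)
  have deg: "0 \<in> ext_deg k" "x \<in> ext_deg k \<Longrightarrow> y \<in> ext_deg k \<Longrightarrow> x + y \<in> ext_deg k"
    "x \<in> ext_deg k \<Longrightarrow> c *s x \<in> ext_deg k" for k c and x y :: form
    unfolding ext_deg_def by (auto, metis add_0)
  note tr = trace_simps
  have tp: "transpose (A + B) = transpose A + transpose B" "transpose 0 = 0" for A B :: mat6
    by (simp_all add: transpose_def vec_eq_iff)
  show "0 \<in> E_alg" by (simp add: E_alg_def Etilde_def lieS_iff deg tr tp)
  fix X Y c assume "X \<in> E_alg" "Y \<in> E_alg"
  thus "X + Y \<in> E_alg" "escale c X \<in> E_alg"
    by (auto simp: E_alg_def Etilde_def lieS_iff deg tr tp pscale_def mscale_simps algebra_simps)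
      (simp_all add: mult.left_commute flip: distrib_left)
qed

text \<open>In nonzero degrees \<open>E_alg\<close> is spanned by monomials. An element of degree 0
  is determined by a matrix A and a coefficient of \<open>h_zero\<close>; the off-diagonal part of A
  is a combination of root elements, and the trace condition fixes the coefficient.\<close>

lemma L_eq: "E6.L = E_alg"
proof
  have deg0: "0 \<in> ext_deg k" for k by (simp add: ext_deg_def)
  have "root_elt a \<in> E_alg" if a: "a \<in> E6_roots" for a
  proof -
    have "endS (root_elt a) \<in> lieS \<and> trace (snd (endS (root_elt a))) + 3 * h0c (root_elt a) = 0"
      using a by (cases rule: root_cases)
        (auto simp: root_elt_diff root_elt_set root_elt_top lieS_iff iota_plus_def adj_eq_transpose pscale_def
          mscale_simps trace_simps, auto simp: transpose_def vec_eq_iff)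
    thus ?thesis using root_elt_deg[OF a] by (simp add: E_alg_def Etilde_def)
  qed
  moreover have "h_elt d \<in> E_alg" for d
    by (simp add: h_elt_def E_alg_def Etilde_def deg0 lieS_iff trace_def)
      (simp add: diag_mat_def transpose_def vec_eq_iff)
  ultimately show "E6.L \<subseteq> E_alg" unfolding E6.L_def E6.gens_def
    by (intro elt_space.span_minimal subspace_E_alg) (auto simp: E6_H_def)
  show "E_alg \<subseteq> E6.L"
  proof
    fix X assume X: "X \<in> E_alg"
    have rootL: "root_elt a \<in> E6.L" if "a \<in> E6_roots" for a by (rule E6.e_in_L[OF that])
    have iotaL: "iota_plus (munit i j) \<in> E6.L" if "i \<noteq> j" for i j
    proof -
      have "iota_plus (munit i j) = escale (ext_sign {i} {j}) (root_elt (diff_root i j))"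
        using that by (simp add: root_elt_diff)
      thus ?thesis using rootL[OF diff_root_in[OF that]] elt_space.subspace_scale[OF E6.subspace_L] by simp
    qed
    have n1: "neg1 X \<in> ext_deg 3" and p1: "pos1 X \<in> ext_deg 3" and n2: "neg2 X \<in> ext_deg 6"
      and p2: "pos2 X \<in> ext_deg 6" and S: "fst (endS X) = - transpose (snd (endS X))"
      and tr: "trace (snd (endS X)) + 3 * h0c X = 0"
      using X by (auto simp: E_alg_def Etilde_def lieS_iff)
    have deg3: "x = (\<Sum>S\<in>{S. card S = 3}. (x $ S) *s axis S 1)" if "x \<in> ext_deg 3" for x :: form
    proof -
      have "x = (\<Sum>S\<in>UNIV. (x $ S) *s axis S 1)" by (rule ext_expand)
      also have "\<dots> = (\<Sum>S\<in>{S. card S = 3}. (x $ S) *s axis S 1)"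
        using that by (intro sum.mono_neutral_right) (auto simp: ext_deg_def)
      finally show ?thesis .
    qed
    have deg6: "x = (x $ UNIV) *s axis UNIV 1" if x: "x \<in> ext_deg 6" for x :: form
    proof -
      have "x $ T = 0" if "T \<noteq> UNIV" for T
      proof (rule ccontr)
        assume "x $ T \<noteq> 0"
        hence "card T = card (UNIV :: 6 set)" using x by (auto simp: ext_deg_def)
        hence "T = UNIV" by (intro card_subset_eq) auto
        with that show False by simp
      qed
      thus ?thesis by (auto simp: vec_eq_iff axis_def)
    qed
    define A where "A = snd (endS X)"
    define d where "d = (\<chi> i. A $ i $ i)"
    have A: "A - diag_mat d = (\<Sum>i\<in>UNIV. \<Sum>j\<in>UNIV. if i = j then 0 else mscale (A $ i $ j) (munit i j))"
    proof -
      have "(\<Sum>i\<in>UNIV. \<Sum>j\<in>UNIV. if i = j then 0 else mscale (A $ i $ j) (munit i j)) $ p $ q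
          = (\<Sum>i\<in>UNIV. \<Sum>j\<in>UNIV. if j = q then (if i = p then (if p = q then 0 else A $ p $ q) else 0) else 0)" for p q
        unfolding sum_component by (intro sum.cong) (auto simp: mscale_def munit_def)
      thus ?thesis by (simp add: vec_eq_iff diag_mat_def d_def)
    qed
    have iota_sum: "iota_plus (sum f I) = (\<Sum>i\<in>I. iota_plus (f i))" for f and I :: "6 set"
      by (induction I rule: infinite_finite_induct) (simp_all add: iota_linear iota_add)
    have off: "iota_plus (A - diag_mat d) \<in> E6.L"
      unfolding A iota_sum using iotaL
      by (intro elt_space.subspace_sum[OF E6.subspace_L])
        (auto simp: iota_linear elt_space.subspace_0[OF E6.subspace_L] intro: elt_space.subspace_scale[OF E6.subspace_L])
    have h: "h_elt d \<in> E6.L" using E6.H_le_L by (auto simp: E6_H_def)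
    \<comment> \<open>The diagonal of A goes into \<open>h_elt d\<close>, which also supplies the
      \<open>h_zero\<close> coefficient; what is left of A has zero diagonal.\<close>
    have "Elt (neg2 X) (neg1 X) (endS X) (h0c X) (pos1 X) (pos2 X)
       = escale (neg2 X $ UNIV) (root_elt (- top_root)) + escale (pos2 X $ UNIV) (root_elt top_root)
        + (\<Sum>S\<in>{S. card S = 3}. escale (neg1 X $ S) (root_elt (- set_root S)))
        + (\<Sum>S\<in>{S. card S = 3}. escale (pos1 X $ S) (root_elt (set_root S)))
        + (h_elt d + iota_plus (A - diag_mat d))"
    proof -
      have "h0c X = - (\<Sum>i\<in>UNIV. d $ i) / 3"
        using tr by (simp add: trace_def d_def A_def field_simps add_eq_0_iff)
      moreover have "endS X = (- transpose A, A)" using S by (simp add: A_def prod_eq_iff)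
      moreover have "transpose (diag_mat d) = diag_mat d" by (simp add: diag_mat_def transpose_def vec_eq_iff)
      ultimately have "h_elt d + iota_plus (A - diag_mat d) = Elt 0 0 (endS X) (h0c X) 0 0"
        by (simp add: h_elt_def iota_plus_def adj_eq_transpose elt_eq_iff prod_eq_iff transpose_diff)
      moreover have "pscale c 0 = 0" for c by (simp add: pscale_def mscale_simps prod_eq_iff)
      ultimately show ?thesis
        using deg3[OF n1] deg3[OF p1] deg6[OF n2] deg6[OF p2]
        by (simp add: elt_eq_iff elt_sum_sel root_elt_set root_elt_top)
    qed
    also have "\<dots> \<in> E6.L"
      using rootL top_root_in set_root_in roots_minus off h
      by (intro elt_space.subspace_add[OF E6.subspace_L] elt_space.subspace_sum[OF E6.subspace_L]
          elt_space.subspace_scale[OF E6.subspace_L]) auto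
    finally show "X \<in> E6.L" by simp
  qed
qed

text \<open>The numberings differ by a permutation: \<open>h_basis 6\<close> is the coroot of simple
  root 2, its summand \<open>- h_zero\<close> being the coefficient -3/3, while
  \<open>h_basis 2\<close>, ..., \<open>h_basis 5\<close> belong to simple roots 3, ..., 6.\<close>

lemma coroot_simple_eq_h_basis: "coroot_elt ` simple_root ` {1..6} = h_basis ` {1..6}"
proof -
  have "coroot_elt (set_root {ix 4, ix 5, ix 6}) = h_basis 6"
  proof -
    define D where "D = munit (ix 4) (ix 4) + munit (ix 5) (ix 5) + munit (ix 6) (ix 6)"
    have "diag_mat (\<chi> i. of_int (fst (set_root {ix 4, ix 5, ix 6}) $ i)) = D"
      by (simp add: D_def vec_eq_iff all_ix diag_mat_def munit_def set_root_def ind_def ix_eq_iff)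
    moreover have "transpose D = D" by (auto simp: D_def transpose_def munit_def vec_eq_iff)
    moreover have "(\<Sum>i\<in>UNIV. of_int (fst (set_root {ix 4, ix 5, ix 6}) $ i) :: complex) = 3"
      unfolding sum_ix by (simp add: set_root_def ind_def ix_eq_iff)
    ultimately show ?thesis
      by (simp add: coroot_elt_def h_elt_def h_basis_def iota_plus_def h_zero_def adj_eq_transpose
          elt_eq_iff flip: D_def)
  qed
  hence "coroot_elt (simple_root 1) = h_basis 1" "coroot_elt (simple_root 2) = h_basis 6"
    "coroot_elt (simple_root 3) = h_basis 2" "coroot_elt (simple_root 4) = h_basis 3"
    "coroot_elt (simple_root 5) = h_basis 4" "coroot_elt (simple_root 6) = h_basis 5"
    by (simp_all add: simple_root_def coroot_elt_diff, simp_all add: h_basis_def numeral_eq_Suc)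
  thus ?thesis
    unfolding interval_1_6 image_insert image_empty by (simp only:) auto
qed

lemma B_E_eq: "B_E = coroot_elt ` simple_root ` {1..6} \<union> (\<lambda>a. escale (root_sign a) (root_elt a)) ` E6_roots"
proof -
  let ?f = "\<lambda>a. escale (root_sign a) (root_elt a)"
  have pz: "pscale c 0 = 0" for c by (simp add: pscale_def mscale_simps prod_eq_iff)
  have f: "i \<noteq> j \<Longrightarrow> ?f (diff_root i j) = iota_plus (munit i j)"
    "?f (set_root S) = Elt 0 0 0 0 (v_plus S) 0"
    "card S = 3 \<Longrightarrow> ?f (- set_root S) = Elt 0 (v_minus S) 0 0 0 0"
    "?f top_root = Elt 0 0 0 0 0 (v_plus UNIV)" "?f (- top_root) = Elt (v_minus UNIV) 0 0 0 0 0" for i j S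
    by (simp_all add: root_sign_simps root_elt_diff root_elt_set root_elt_top v_plus_eq v_minus_eq
        choose_2 elt_eq_iff pz)
  have "?f ` E6_roots = {iota_plus (munit i j) | i j. i \<noteq> j}
     \<union> {Elt 0 0 0 0 (v_plus S) 0 | S. card S = 3}
     \<union> {Elt 0 (v_minus S) 0 0 0 0 | S. card S = 3}
     \<union> {Elt 0 0 0 0 0 (v_plus UNIV), Elt (v_minus UNIV) 0 0 0 0 0}" (is "_ = ?B")
  proof (intro equalityI subsetI)
    fix x assume "x \<in> ?f ` E6_roots"
    then obtain a where a: "a \<in> E6_roots" "x = ?f a" by blast
    from a(1) show "x \<in> ?B"
    proof (cases rule: root_cases)
      case (diff i j)
      hence "x = iota_plus (munit i j)" using a f(1) by simp
      thus ?thesis using diff by blast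
    next
      case (set S)
      hence "x = Elt 0 0 0 0 (v_plus S) 0" using a f(2) by simp
      thus ?thesis using set by blast
    next
      case (minus_set S)
      hence "x = Elt 0 (v_minus S) 0 0 0 0" using a f(3) by simp
      thus ?thesis using minus_set by blast
    qed (use a f(4,5) in auto)
  next
    fix x assume "x \<in> ?B"
    then consider i j where "i \<noteq> j" "x = ?f (diff_root i j)" | S where "card S = 3" "x = ?f (set_root S)"
      | S where "card S = 3" "x = ?f (- set_root S)" | "x = ?f top_root" | "x = ?f (- top_root)"
      using f by auto
    thus "x \<in> ?f ` E6_roots"
      by cases (use diff_root_in set_root_in top_root_in roots_minus in blast)+
  qed
  thus ?thesis unfolding B_E_def coroot_simple_eq_h_basis by (simp only: Un_assoc)
qed

theorem proposition7p7p9: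
  shows "findim_lie_algebra escale E_alg ebr \<and>
    findim_lie_algebra.simple_lie_algebra escale E_alg ebr \<and>
    findim_lie_algebra.has_cartan_matrix escale E_alg ebr 6 cartan_matrix_E6 \<and>
    findim_lie_algebra.chevalley_basis escale E_alg ebr B_E"
  using E6.findim E6.simple E6.has_cartan_matrix[OF ip_simple_root]
    E6.chevalley_basis[of root_sign, OF root_sign_sq root_sign_minus]
  unfolding L_eq B_E_eq by blast

end
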